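(* Let $G$ be a compact Hausdorff topological group with a countable basis and more than one element, and let $\mu=(\mu_k:k\in-\mathbb{N})$ be a family of Borel probability laws on $G$. Let $(\lambda_k)$, $(\alpha_l)$ and $H$ satisfy conditions (I1)-(I4) of the context, let $\boldsymbol{s}:G/H\to G$ be a measurable section and let $\boldsymbol{h}(g)=(\boldsymbol{s}(gH))^{-1}g$ for $g\in G$. Let $\{(\eta_k),(\xi_k)\}$ be any solution with noise law $\mu$. For any $k\in-\mathbb{N}$, define $$\phi_k=\boldsymbol{s}\Big(\lim_{l\to-\infty}\xi_k\xi_{k-1}\cdots\xi_l\,\alpha_lH\Big),\qquad V=\boldsymbol{s}\Big(\lim_{l\to-\infty}\eta_l^{-1}\phi_lH\Big)^{-1},\qquad U_k=\boldsymbol{h}(\eta_kV^{-1})$$ (the limits being a.s. limits in $G/H$). Then, for any $k\in-\mathbb{N}$, the random variable $\eta_k$ is factorized as $\eta_k=\phi_kU_kV$ (a.s.), and the following statements hold: (i) $\phi_k$ is a.s. measurable with respect to $\mathcal{F}^\xi_k$; (ii) $U_k$ is independent of $\sigma(V)\vee\mathcal{F}^\xi_0$ and is uniform on $H$ (its law is the normalized Haar measure of $H$); (iii) $\mathcal{F}^\eta_{-\infty}=\sigma(V)$ up to null sets. Moreover, for any $k\in-\mathbb{N}$, $$\mathcal{F}^\eta_k=\sigma(U_k)\vee\sigma(V)\vee\mathcal{F}^\xi_k\quad\text{up to null sets},$$ where the three $\sigma$-fields $\sigma(U_k)$, $\sigma(V)$ and $\mathcal{F}^\xi_k$ are independent.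
   Context: $\mathbb{N}=\{0,1,2,\ldots\}$ and $-\mathbb{N}=\{0,-1,-2,\ldots\}$. A solution (with noise law $\mu$) is a pair of $G$-valued processes $\{(\eta_k)_{k\in-\mathbb{N}},(\xi_k)_{k\in-\mathbb{N}}\}$ defined on a common probability space such that, for every $k\in-\mathbb{N}$: $\eta_k=\xi_k\eta_{k-1}$ a.s.; $\xi_k$ is independent of $\mathcal{F}^\eta_{k-1}$; and $\xi_k$ has law $\mu_k$. Here $\mathcal{F}^\eta_k=\sigma(\eta_m:m\le k)$, $\mathcal{F}^\xi_k=\sigma(\xi_m:m\le k)$ and $\mathcal{F}^\eta_{-\infty}=\bigcap_{k\in-\mathbb{N}}\mathcal{F}^\eta_k$. For a compact subgroup $H$, $G/H$ is the set of left cosets with the quotient topology; a measurable section is a Borel map $\boldsymbol{s}:G/H\to G$ with $\boldsymbol{s}(gH)\in gH$ for all $g$ (one always exists). Conditions on $(\lambda_k)_{k\in-\mathbb{N}}$ (probability laws on $G$), $(\alpha_l)_{l\in-\mathbb{N}}$ (elements of $G$) and $H$ (compact subgroup of $G$); such a triple always exists: (I1) $\mu_k*\mu_{k-1}*\cdots*\mu_l*\delta_{\alpha_l}\to\lambda_k$ weakly as $l\to-\infty$ for each $k$; (I2) $\delta_{\alpha_l^{-1}}*\lambda_{l-1}\to\omega_H$ weakly as $l\to-\infty$, where $\omega_H$ is the normalized Haar measure of $H$; (I3) $\lambda_k*\delta_h=\lambda_k$ for each $h\in H$ and each $k$; (I4) if $\xi_k$ are independent with respective laws $\mu_k$, then for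 any $k$, $\xi_k\xi_{k-1}\cdots\xi_l\alpha_lH$ converges a.s. in $G/H$ as $l\to-\infty$. *)

theory Defs
  imports "HOL-Probability.Probability" "HOL-Library.Set_Algebras"
begin

text \<open>
  The group is written additively because the library's class of (not necessarily commutative)
  topological groups is \<^class>\<open>topological_group_add\<close>: the product x y is \<open>x + y\<close>, the inverse of x is
  \<open>- x\<close>, and the left coset g H is \<open>g +o H\<close>. Addition is not assumed commutative anywhere.
  Families indexed by the nonpositive integers are functions on \<^typ>\<open>int\<close>, of which only the
  values at arguments \<open>\<le> 0\<close> matter; a limit for l tending to minus infinity is along \<open>at_bot\<close>.
\<close>

definition compact_subgroup :: "'a::topological_group_add set \<Rightarrow> bool" where
  "compact_subgroup H \<longleftrightarrow>
     0 \<in> H \<and> (\<forall>x\<in>H. \<forall>y\<in>H. x + y \<in> H) \<and> (\<forall>x\<in>H. - x \<in> H) \<and> compact H"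

definition coset_space :: "'a::topological_group_add set \<Rightarrow> 'a set topology" where
  "coset_space H =
     topology (\<lambda>\<C>. \<C> \<subseteq> range (\<lambda>g. g +o H) \<and> open {g. g +o H \<in> \<C>})"

lemma openin_coset_space:
  "openin (coset_space H) \<C> \<longleftrightarrow> \<C> \<subseteq> range (\<lambda>g. g +o H) \<and> open {g. g +o H \<in> \<C>}"
proof -
  have "istopology (\<lambda>\<C>. \<C> \<subseteq> range (\<lambda>g. g +o H) \<and> open {g. g +o H \<in> \<C>})"
    unfolding istopology_def
  proof (intro conjI allI impI)
    fix S T
    assume S: "S \<subseteq> range (\<lambda>g. g +o H) \<and> open {g. g +o H \<in> S}"
      and T: "T \<subseteq> range (\<lambda>g. g +o H) \<and> open {g. g +o H \<in> T}"
    show "S \<inter> T \<subseteq> range (\<lambda>g. g +o H)" using S by blast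
    have "{g. g +o H \<in> S \<inter> T} = {g. g +o H \<in> S} \<inter> {g. g +o H \<in> T}" by auto
    then show "open {g. g +o H \<in> S \<inter> T}" using S T by (simp add: open_Int)
  next
    fix \<K>
    assume K: "\<forall>S\<in>\<K>. S \<subseteq> range (\<lambda>g. g +o H) \<and> open {g. g +o H \<in> S}"
    then show "\<Union>\<K> \<subseteq> range (\<lambda>g. g +o H)" by blast
    have "{g. g +o H \<in> \<Union>\<K>} = (\<Union>S\<in>\<K>. {g. g +o H \<in> S})" by auto
    then show "open {g. g +o H \<in> \<Union>\<K>}" using K by (simp add: open_UN)
  qed
  then show ?thesis unfolding coset_space_def by (simp add: topology_inverse')
qed

lemma topspace_coset_space: "topspace (coset_space H) = range (\<lambda>g. g +o H)"
proof -
  have "openin (coset_space H) (range (\<lambda>g. g +o H))" by (simp add: openin_coset_space)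
  then show ?thesis
    by (metis openin_coset_space openin_subset openin_topspace subset_antisym)
qed

lemma quotient_map_coset_space: "quotient_map euclidean (coset_space H) (\<lambda>g. g +o H)"
  unfolding quotient_map_def by (auto simp: topspace_coset_space openin_coset_space)

text \<open>Unspecified if the family does not converge; limits in \<open>G/H\<close> are unique for compact H and
  Hausdorff G.\<close>

definition coset_lim :: "'a::topological_group_add set \<Rightarrow> (int \<Rightarrow> 'a set) \<Rightarrow> 'a set" where
  "coset_lim H x = (THE c. limitin (coset_space H) x c at_bot)"

definition measurable_section :: "'a::topological_group_add set \<Rightarrow> ('a set \<Rightarrow> 'a) \<Rightarrow> bool" where
  "measurable_section H s \<longleftrightarrow>
     s \<in> borel_measurable (sigma (topspace (coset_space H)) {\<C>. openin (coset_space H) \<C>}) \<and>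
     (\<forall>g. s (g +o H) \<in> g +o H)"

definition h_part :: "('a set \<Rightarrow> 'a) \<Rightarrow> 'a::topological_group_add set \<Rightarrow> 'a \<Rightarrow> 'a" where
  "h_part s H g = - s (g +o H) + g"

definition borel_law :: "'a::topological_space measure \<Rightarrow> bool" where
  "borel_law N \<longleftrightarrow> prob_space N \<and> sets N = sets borel"

text \<open>The library's \<^const>\<open>convolution\<close> is restricted to Euclidean spaces.\<close>

definition conv :: "'a::topological_group_add measure \<Rightarrow> 'a measure \<Rightarrow> 'a measure" where
  "conv M N = distr (M \<Otimes>\<^sub>M N) borel (\<lambda>(x, y). x + y)"

text \<open>\<open>conv_prod \<mu> k l N\<close> is \<open>\<mu> k * \<mu> (k - 1) * \<dots> * \<mu> l * N\<close>.\<close>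

definition conv_prod ::
    "(int \<Rightarrow> 'a::topological_group_add measure) \<Rightarrow> int \<Rightarrow> int \<Rightarrow> 'a measure \<Rightarrow> 'a measure" where
  "conv_prod \<mu> k l N = foldr conv (map \<mu> (rev [l..k])) N"

definition weakly_tendsto ::
    "('i \<Rightarrow> 'a::topological_space measure) \<Rightarrow> 'a measure \<Rightarrow> 'i filter \<Rightarrow> bool" where
  "weakly_tendsto N L F \<longleftrightarrow>
     (\<forall>f :: 'a \<Rightarrow> real. continuous_on UNIV f \<and> bounded (range f) \<longrightarrow>
        ((\<lambda>i. \<integral>x. f x \<partial>N i) \<longlongrightarrow> (\<integral>x. f x \<partial>L)) F)"

text \<open>The normalized Haar measure of H, regarded as a law on the whole group carried by H.\<close>

definition normalized_haar :: "'a::topological_group_add set \<Rightarrow> 'a measure \<Rightarrow> bool" where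
  "normalized_haar H \<omega> \<longleftrightarrow>
     borel_law \<omega> \<and> emeasure \<omega> H = 1 \<and> (\<forall>h\<in>H. distr \<omega> borel (\<lambda>x. h + x) = \<omega>)"

text \<open>Sigma-fields are represented as sets of events.\<close>

definition sigma_rv :: "'b measure \<Rightarrow> ('b \<Rightarrow> 'a::topological_space) \<Rightarrow> 'b set set" where
  "sigma_rv M X = {X -` A \<inter> space M | A. A \<in> sets borel}"

definition past :: "'b measure \<Rightarrow> (int \<Rightarrow> 'b \<Rightarrow> 'a::topological_space) \<Rightarrow> int \<Rightarrow> 'b set set" where
  "past M X k = sigma_sets (space M) (\<Union>m\<in>{..k}. sigma_rv M (X m))"

definition remote_past :: "'b measure \<Rightarrow> (int \<Rightarrow> 'b \<Rightarrow> 'a::topological_space) \<Rightarrow> 'b set set" where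
  "remote_past M X = (\<Inter>k\<in>{..0}. past M X k)"

definition sigma_join :: "'b measure \<Rightarrow> 'b set set \<Rightarrow> 'b set set \<Rightarrow> 'b set set" where
  "sigma_join M \<A> \<B> = sigma_sets (space M) (\<A> \<union> \<B>)"

definition eq_mod_null :: "'b measure \<Rightarrow> 'b set set \<Rightarrow> 'b set set \<Rightarrow> bool" where
  "eq_mod_null M \<A> \<B> \<longleftrightarrow>
     (\<forall>A\<in>\<A>. \<exists>B\<in>\<B>. (A - B) \<union> (B - A) \<in> null_sets M) \<and>
     (\<forall>B\<in>\<B>. \<exists>A\<in>\<A>. (A - B) \<union> (B - A) \<in> null_sets M)"

definition as_measurable ::
    "'b measure \<Rightarrow> 'b set set \<Rightarrow> ('b \<Rightarrow> 'a::topological_space) \<Rightarrow> bool" where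
  "as_measurable M \<A> X \<longleftrightarrow>
     (\<exists>Y \<in> borel_measurable (sigma (space M) \<A>). AE w in M. X w = Y w)"

definition is_solution ::
    "(int \<Rightarrow> 'a::topological_group_add measure) \<Rightarrow> 'b measure \<Rightarrow>
     (int \<Rightarrow> 'b \<Rightarrow> 'a) \<Rightarrow> (int \<Rightarrow> 'b \<Rightarrow> 'a) \<Rightarrow> bool" where
  "is_solution \<mu> M \<eta> \<xi> \<longleftrightarrow>
     prob_space M \<and>
     (\<forall>k\<le>0. \<eta> k \<in> borel_measurable M) \<and>
     (\<forall>k\<le>0. \<xi> k \<in> borel_measurable M) \<and>
     (\<forall>k\<le>0. AE w in M. \<eta> k w = \<xi> k w + \<eta> (k - 1) w) \<and>
     (\<forall>k\<le>0. prob_space.indep_set M (sigma_rv M (\<xi> k)) (past M \<eta> (k - 1))) \<and>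
     (\<forall>k\<le>0. distr M borel (\<xi> k) = \<mu> k)"

definition noise_prod :: "(int \<Rightarrow> 'b \<Rightarrow> 'a::topological_group_add) \<Rightarrow> int \<Rightarrow> int \<Rightarrow> 'b \<Rightarrow> 'a" where
  "noise_prod \<xi> k l w = sum_list (map (\<lambda>j. \<xi> j w) (rev [l..k]))"

definition phi_cosets ::
    "'a::topological_group_add set \<Rightarrow> (int \<Rightarrow> 'a) \<Rightarrow> (int \<Rightarrow> 'b \<Rightarrow> 'a) \<Rightarrow> int \<Rightarrow> 'b \<Rightarrow> int \<Rightarrow> 'a set" where
  "phi_cosets H \<alpha> \<xi> k w l = (noise_prod \<xi> k l w + \<alpha> l) +o H"

definition phi ::
    "('a set \<Rightarrow> 'a) \<Rightarrow> 'a::topological_group_add set \<Rightarrow> (int \<Rightarrow> 'a) \<Rightarrow>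
     (int \<Rightarrow> 'b \<Rightarrow> 'a) \<Rightarrow> int \<Rightarrow> 'b \<Rightarrow> 'a" where
  "phi s H \<alpha> \<xi> k w = s (coset_lim H (phi_cosets H \<alpha> \<xi> k w))"

definition V_cosets ::
    "('a set \<Rightarrow> 'a) \<Rightarrow> 'a::topological_group_add set \<Rightarrow> (int \<Rightarrow> 'a) \<Rightarrow>
     (int \<Rightarrow> 'b \<Rightarrow> 'a) \<Rightarrow> (int \<Rightarrow> 'b \<Rightarrow> 'a) \<Rightarrow> 'b \<Rightarrow> int \<Rightarrow> 'a set" where
  "V_cosets s H \<alpha> \<eta> \<xi> w l = (- \<eta> l w + phi s H \<alpha> \<xi> l w) +o H"

definition V_rv ::
    "('a set \<Rightarrow> 'a) \<Rightarrow> 'a::topological_group_add set \<Rightarrow> (int \<Rightarrow> 'a) \<Rightarrow>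
     (int \<Rightarrow> 'b \<Rightarrow> 'a) \<Rightarrow> (int \<Rightarrow> 'b \<Rightarrow> 'a) \<Rightarrow> 'b \<Rightarrow> 'a" where
  "V_rv s H \<alpha> \<eta> \<xi> w = - s (coset_lim H (V_cosets s H \<alpha> \<eta> \<xi> w))"

definition U_rv ::
    "('a set \<Rightarrow> 'a) \<Rightarrow> 'a::topological_group_add set \<Rightarrow> (int \<Rightarrow> 'a) \<Rightarrow>
     (int \<Rightarrow> 'b \<Rightarrow> 'a) \<Rightarrow> (int \<Rightarrow> 'b \<Rightarrow> 'a) \<Rightarrow> int \<Rightarrow> 'b \<Rightarrow> 'a" where
  "U_rv s H \<alpha> \<eta> \<xi> k w = h_part s H (\<eta> k w + (- V_rv s H \<alpha> \<eta> \<xi> w))"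

definition cond_I1 ::
    "(int \<Rightarrow> 'a::topological_group_add measure) \<Rightarrow> (int \<Rightarrow> 'a measure) \<Rightarrow> (int \<Rightarrow> 'a) \<Rightarrow> bool" where
  "cond_I1 \<mu> \<Lambda> \<alpha> \<longleftrightarrow>
     (\<forall>k\<le>0. weakly_tendsto (\<lambda>l. conv_prod \<mu> k l (return borel (\<alpha> l))) (\<Lambda> k) at_bot)"

definition cond_I2 ::
    "(int \<Rightarrow> 'a::topological_group_add measure) \<Rightarrow> (int \<Rightarrow> 'a) \<Rightarrow> 'a measure \<Rightarrow> bool" where
  "cond_I2 \<Lambda> \<alpha> \<omega> \<longleftrightarrow>
     weakly_tendsto (\<lambda>l. conv (return borel (- \<alpha> l)) (\<Lambda> (l - 1))) \<omega> at_bot"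

definition cond_I3 ::
    "(int \<Rightarrow> 'a::topological_group_add measure) \<Rightarrow> 'a set \<Rightarrow> bool" where
  "cond_I3 \<Lambda> H \<longleftrightarrow> (\<forall>h\<in>H. \<forall>k\<le>0. conv (\<Lambda> k) (return borel h) = \<Lambda> k)"

text \<open>
  A formula cannot quantify over all sample-space types, so the independent families range over
  all probability spaces with sample-space type \<^typ>\<open>int \<Rightarrow> 'a\<close>. This type carries the canonical
  model (the coordinates under the product of the \<open>\<mu> k\<close>), and almost sure convergence only depends
  on the joint law.
\<close>

definition cond_I4 ::
    "(int \<Rightarrow> 'a::topological_group_add measure) \<Rightarrow> (int \<Rightarrow> 'a) \<Rightarrow> 'a set \<Rightarrow> bool" where
  "cond_I4 \<mu> \<alpha> H \<longleftrightarrow>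
     (\<forall>(P :: (int \<Rightarrow> 'a) measure) \<xi>.
        prob_space P \<and> prob_space.indep_vars P (\<lambda>_. borel) \<xi> {..0} \<and>
        (\<forall>k\<le>0. distr P borel (\<xi> k) = \<mu> k) \<longrightarrow>
        (\<forall>k\<le>0. AE w in P. \<exists>c. limitin (coset_space H) (phi_cosets H \<alpha> \<xi> k w) c at_bot))"

end

theory Submission
  imports Defs
begin

text \<open>
  Along a solution the coset \<open>\<eta>\<^sub>k\<^sup>-\<^sup>1 \<phi>\<^sub>k H\<close> does not depend on k, because \<open>\<phi>\<^sub>k H = \<xi>\<^sub>k \<phi>\<^sub>k\<^sub>-\<^sub>1 H\<close>. So V is measurable
  with respect to the augmented remote past, and \<open>\<zeta>\<^sub>k = \<eta>\<^sub>k V\<^sup>-\<^sup>1 = \<phi>\<^sub>k U\<^sub>k\<close> with \<open>U\<^sub>k \<in> H\<close>.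

  Write \<open>\<zeta>\<^sub>k = X Y\<close> with \<open>X = \<xi>\<^sub>k \<dots> \<xi>\<^sub>l \<alpha>\<^sub>l\<close> and \<open>Y = \<alpha>\<^sub>l\<^sup>-\<^sup>1 \<zeta>\<^sub>l\<^sub>-\<^sub>1\<close>. The factor X is independent of the past
  before l and its law tends to \<open>\<lambda>\<^sub>k\<close>, which is right H-invariant, while Y approaches H by (I2). Hence
  \<open>\<zeta>\<^sub>k\<close> is independent of the remote past with law \<open>\<lambda>\<^sub>k\<close>. The invariance of \<open>\<lambda>\<^sub>k\<close> makes \<open>U\<^sub>k\<close> uniform on H
  and independent of \<open>\<phi>\<^sub>k\<close>; since \<open>U\<^sub>k = Z U\<^sub>j\<close> for an H-valued Z that depends only on \<open>\<phi>\<^sub>j\<close> and the noise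
  after j, it is independent of the whole noise. Finally, the process \<open>\<zeta>\<close> is independent of the remote
  past and generates everything together with V, so an event of the remote past is determined by V.
\<close>

section \<open>Coset spaces of a compact group\<close>

text \<open>Showing that \<open>\<zeta> k\<close> has law \<open>\<Lambda> k\<close> looks circular,
  because (I2) speaks of \<open>\<Lambda>\<close> and not of \<open>\<zeta>\<close>. The way out:
  the distance of Y from H depends on the coset of \<open>\<zeta>\<close> only, this coset is that
  of \<open>\<phi>\<close>, and on cosets the law is already known, since the partial products
  converge almost surely by (I4) and in law by (I1). The second obstacle is the remote past. A join
  of sigma-fields need not commute with a decreasing intersection, so generators of every single
  past do not determine the intersection of the pasts; independence of the process
  \<open>\<zeta>\<close> from the remote past replaces such an exchange. The identities behind all
  this hold only almost surely. The pasts are therefore augmented from the start, and the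
  intersection of the augmented pasts is compared with the true remote past at the end. G comes
  without a metric; a countable separating family of continuous functions on \<open>G/H\<close>
  supplies the one that Cauchy sequences and measurable limits need.\<close>

lemma compact_Hausdorff_separating_sequence:
  assumes "compact_space X" "Hausdorff_space X" "second_countable X"
  obtains F :: "nat \<Rightarrow> 'c \<Rightarrow> real"
  where "\<And>n. continuous_map X euclideanreal (F n)"
    and "\<And>x y. x \<in> topspace X \<Longrightarrow> y \<in> topspace X \<Longrightarrow> (\<And>n. F n x = F n y) \<Longrightarrow> x = y"
proof -
  have normal: "normal_space X"
    using assms by (simp add: compact_Hausdorff_or_regular_imp_normal_space)
  obtain \<B> where \<B>: "countable \<B>" "\<And>V. V \<in> \<B> \<Longrightarrow> openin X V"
    "\<And>U x. openin X U \<Longrightarrow> x \<in> U \<Longrightarrow> \<exists>V\<in>\<B>. x \<in> V \<and> V \<subseteq> U"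
    using assms(3) unfolding second_countable_def by metis
  \<comment> \<open>Countably many pairs of basic open sets with disjoint closures, each handed to
    Urysohn's lemma. The pair of empty sets only keeps \<open>\<P>\<close> nonempty, so that
    \<open>from_nat_into\<close> enumerates it.\<close>
  define \<P> where "\<P> = insert ({}, {}) {p \<in> \<B> \<times> \<B>. disjnt (X closure_of fst p) (X closure_of snd p)}"
  have "countable \<P>"
    unfolding \<P>_def using \<B>(1) by (intro countable_insert countable_Collect) auto
  have "\<exists>f. continuous_map X euclideanreal f \<and>
      f ` (X closure_of fst p) \<subseteq> {0} \<and> f ` (X closure_of snd p) \<subseteq> {1}" if "p \<in> \<P>" for p
  proof -
    have "disjnt (X closure_of fst p) (X closure_of snd p)"
      using that by (auto simp: \<P>_def)
    then show ?thesis
      using Urysohn_lemma_alt[OF normal closedin_closure_of closedin_closure_of] by metis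
  qed
  then have "\<forall>p\<in>\<P>. \<exists>f. continuous_map X euclideanreal f \<and>
      f ` (X closure_of fst p) \<subseteq> {0} \<and> f ` (X closure_of snd p) \<subseteq> {1}" by blast
  from bchoice[OF this] obtain u where u: "\<And>p. p \<in> \<P> \<Longrightarrow> continuous_map X euclideanreal (u p)"
      "\<And>p x. p \<in> \<P> \<Longrightarrow> x \<in> X closure_of fst p \<Longrightarrow> u p x = 0"
      "\<And>p x. p \<in> \<P> \<Longrightarrow> x \<in> X closure_of snd p \<Longrightarrow> u p x = (1::real)"
    by (auto simp: image_subset_iff)
  define F where "F n = u (from_nat_into \<P> n)" for n
  have ne: "\<P> \<noteq> {}" by (auto simp: \<P>_def)
  show thesis
  proof
    show "continuous_map X euclideanreal (F n)" for n
      unfolding F_def using u(1) from_nat_into[OF ne] by blast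
    fix x y assume xy: "x \<in> topspace X" "y \<in> topspace X" and eq: "\<And>n. F n x = F n y"
    show "x = y"
    proof (rule ccontr)
      assume "x \<noteq> y"
      then have "closedin X {x}" "closedin X {y}" "disjnt {x} {y}"
        using xy assms(2) by (auto simp: closedin_Hausdorff_singleton)
      \<comment> \<open>The gap between the levels 1/3 and 2/3 of f leaves room for basic
        neighbourhoods of x and y whose closures are still disjoint, hence for a pair in
        \<open>\<P>\<close>.\<close>
      then obtain f where f: "continuous_map X euclideanreal f" "f x = 0" "f y = (1::real)"
        using Urysohn_lemma_alt[OF normal, of "{x}" "{y}" 0 1] by force
      have pre: "openin X {z \<in> topspace X. f z \<in> S}" if "open S" for S
        using f(1) that by (simp add: openin_continuous_map_preimage)
      have cpre: "closedin X {z \<in> topspace X. f z \<in> S}" if "closed S" for S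
        using f(1) that by (simp add: closedin_continuous_map_preimage)
      obtain A where A: "A \<in> \<B>" "x \<in> A" "A \<subseteq> {z \<in> topspace X. f z \<in> {..<1/3}}"
        using \<B>(3)[OF pre[OF open_lessThan[of "1/3"]], of x] xy f by auto
      obtain B where B: "B \<in> \<B>" "y \<in> B" "B \<subseteq> {z \<in> topspace X. f z \<in> {2/3<..}}"
        using \<B>(3)[OF pre[OF open_greaterThan[of "2/3"]], of y] xy f by auto
      have "X closure_of A \<subseteq> {z \<in> topspace X. f z \<in> {..1/3}}"
        using A by (intro closure_of_minimal cpre) force+
      moreover have "X closure_of B \<subseteq> {z \<in> topspace X. f z \<in> {2/3..}}"
        using B by (intro closure_of_minimal cpre) force+
      ultimately have "disjnt (X closure_of A) (X closure_of B)"
        by (fastforce simp: disjnt_def)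
      then have p: "(A, B) \<in> \<P>" using A B by (simp add: \<P>_def)
      have "x \<in> X closure_of A" "y \<in> X closure_of B"
        using A(1,2) B(1,2) \<B>(2) by (meson closure_of_subset openin_subset subsetD)+
      then have "u (A, B) x \<noteq> u (A, B) y" using u(2,3)[OF p] by simp
      moreover obtain n where "from_nat_into \<P> n = (A, B)"
        using from_nat_into_surj[OF \<open>countable \<P>\<close> p] by blast
      ultimately show False using eq[of n] by (simp add: F_def)
    qed
  qed
qed

lemma coset_eq_iff:
  assumes "compact_subgroup H"
  shows "g +o H = g' +o H \<longleftrightarrow> - g + g' \<in> H"
proof
  assume "g +o H = g' +o H"
  moreover have "g' \<in> g' +o H"
    using assms by (auto simp: compact_subgroup_def elt_set_plus_def intro!: bexI[of _ 0])
  ultimately obtain h where "h \<in> H" "g' = g + h" by (auto simp: elt_set_plus_def)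
  then show "- g + g' \<in> H" by (simp add: add.assoc[symmetric])
next
  have sub: "a +o H \<subseteq> b +o H" if "- b + a \<in> H" for a b
  proof
    fix x assume "x \<in> a +o H"
    then obtain h where h: "h \<in> H" "x = a + h" by (auto simp: elt_set_plus_def)
    then have "x = b + ((- b + a) + h)" by (simp add: add.assoc[symmetric])
    then show "x \<in> b +o H"
      using h that assms by (auto simp: compact_subgroup_def elt_set_plus_def)
  qed
  assume "- g + g' \<in> H"
  moreover from this have "- g' + g \<in> H"
    using assms by (metis compact_subgroup_def minus_add minus_minus)
  ultimately show "g +o H = g' +o H" using sub by blast
qed

text \<open>The preimage of the image of W is the union of the right translates of W by elements of
  H, so the quotient map is open.\<close>

lemma openin_coset_image:
  assumes "compact_subgroup H" "open W"
  shows "openin (coset_space H) ((\<lambda>g. g +o H) ` W)"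
proof -
  have "{g. g +o H \<in> (\<lambda>g. g +o H) ` W} = (\<Union>h\<in>H. (\<lambda>g. g + h) -` W)"
  proof (intro set_eqI iffI)
    fix g assume "g \<in> {g. g +o H \<in> (\<lambda>g. g +o H) ` W}"
    then obtain w where w: "w \<in> W" "g +o H = w +o H" by auto
    then have "- g + w \<in> H" using coset_eq_iff[OF assms(1)] by blast
    moreover have "g + (- g + w) \<in> W" using w by (simp add: add.assoc[symmetric])
    ultimately show "g \<in> (\<Union>h\<in>H. (\<lambda>g. g + h) -` W)" by blast
  next
    fix g assume "g \<in> (\<Union>h\<in>H. (\<lambda>g. g + h) -` W)"
    then obtain h where h: "h \<in> H" "g + h \<in> W" by auto
    then have "g +o H = (g + h) +o H"
      by (subst coset_eq_iff[OF assms(1)]) (simp add: add.assoc[symmetric])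
    then show "g \<in> {g. g +o H \<in> (\<lambda>g. g +o H) ` W}" using h by auto
  qed
  moreover have "open ((\<lambda>g. g + h) -` W)" for h
    using assms(2) by (intro open_vimage continuous_intros)
  ultimately show ?thesis
    by (auto simp: openin_coset_space)
qed

text \<open>Since H is closed, \<open>- x + y \<notin> H\<close> is an open condition on the pair; a
  product neighbourhood inside it has disjoint images, which are open because the quotient map
  is.\<close>

lemma Hausdorff_coset_space:
  fixes H :: "'a::{topological_group_add, t2_space} set"
  assumes "compact_subgroup H"
  shows "Hausdorff_space (coset_space H)"
  unfolding Hausdorff_space_def
proof (intro allI impI, elim conjE)
  fix c d assume "c \<in> topspace (coset_space H)" "d \<in> topspace (coset_space H)" and ne: "c \<noteq> d"
  then obtain a b where ab: "c = a +o H" "d = b +o H" by (auto simp: topspace_coset_space)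
  have "closed H" using assms by (simp add: compact_subgroup_def compact_imp_closed)
  then have "open ((\<lambda>(x, y). - x + y) -` (- H))"
    by (intro open_vimage) (auto simp: case_prod_unfold intro!: continuous_intros)
  moreover have "(a, b) \<in> (\<lambda>(x, y). - x + y) -` (- H)"
    using ne ab coset_eq_iff[OF assms] by auto
  ultimately obtain A B where AB: "open A" "open B" "(a, b) \<in> A \<times> B"
    "A \<times> B \<subseteq> (\<lambda>(x, y). - x + y) -` (- H)"
    by (rule open_prod_elim)
  have "disjnt ((\<lambda>g. g +o H) ` A) ((\<lambda>g. g +o H) ` B)"
    using AB(4) coset_eq_iff[OF assms] by (auto simp: disjnt_iff)
  then show "\<exists>U V. openin (coset_space H) U \<and> openin (coset_space H) V \<and> c \<in> U \<and> d \<in> V \<and> disjnt U V"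
    using AB ab openin_coset_image[OF assms]
    by (intro exI[of _ "(\<lambda>g. g +o H) ` A"] exI[of _ "(\<lambda>g. g +o H) ` B"]) auto
qed

text \<open>The separating functions of the compact Hausdorff space \<open>G/H\<close> are pulled
  back to G. As e lives on the group and not on the set of cosets, its continuity and limits belong
  to the type class topology.\<close>

lemma coset_embedding:
  fixes H :: "'a::{topological_group_add, t2_space, second_countable_topology} set"
  assumes "compact (UNIV :: 'a set)" "compact_subgroup H"
  obtains e :: "'a \<Rightarrow> nat \<Rightarrow> real"
  where "continuous_on UNIV e" "\<And>g g'. e g = e g' \<longleftrightarrow> g +o H = g' +o H"
proof -
  let ?q = "\<lambda>g. g +o H"
  have q: "continuous_map euclidean (coset_space H) ?q"
    by (rule quotient_imp_continuous_map[OF quotient_map_coset_space])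
  have "second_countable (euclidean :: 'a topology)"
  proof -
    obtain \<B> :: "'a set set" where \<B>: "countable \<B>" "\<And>C. C \<in> \<B> \<Longrightarrow> open C"
      "\<And>S. open S \<Longrightarrow> \<exists>U. U \<subseteq> \<B> \<and> S = \<Union>U"
      using univ_second_countable by metis
    then show ?thesis
      unfolding second_countable_def
      by (intro exI[of _ \<B>]) (simp, metis Union_iff Union_upper subset_iff)
  qed
  then have "second_countable (coset_space H)"
    by (rule second_countable_open_map_image[rotated 3])
      (use q openin_coset_image[OF assms(2)] in \<open>auto simp: open_map_def topspace_coset_space\<close>)
  moreover have "compact_space (coset_space H)"
    using image_compactin[OF _ q, of UNIV] assms(1)
    by (simp add: compact_space_def topspace_coset_space)
  ultimately obtain F :: "nat \<Rightarrow> 'a set \<Rightarrow> real"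
    where F: "\<And>n. continuous_map (coset_space H) euclideanreal (F n)"
      "\<And>x y. x \<in> topspace (coset_space H) \<Longrightarrow> y \<in> topspace (coset_space H) \<Longrightarrow>
        (\<And>n. F n x = F n y) \<Longrightarrow> x = y"
    using compact_Hausdorff_separating_sequence Hausdorff_coset_space[OF assms(2)] by metis
  show thesis
  proof
    have "continuous_on UNIV (\<lambda>g. F n (?q g))" for n
      using continuous_map_compose[OF q F(1)] by (simp add: o_def)
    then show "continuous_on UNIV (\<lambda>g n. F n (?q g))"
      by (rule continuous_on_coordinatewise_then_product)
    show "(\<lambda>n. F n (?q g)) = (\<lambda>n. F n (?q g')) \<longleftrightarrow> g +o H = g' +o H" for g g'
      using F(2)[of "?q g" "?q g'"] by (auto simp: topspace_coset_space fun_eq_iff)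
  qed
qed

section \<open>Limits at minus infinity as limits of sequences\<close>

lemma filterlim_minus_int_at_bot: "filterlim (\<lambda>n. - int n) at_bot sequentially"
  unfolding filterlim_at_bot
proof
  fix z :: int
  show "\<forall>\<^sub>F n in sequentially. - int n \<le> z"
    by (rule eventually_sequentiallyI[of "nat (- z)"]) linarith
qed

lemma eventually_at_bot_int_iff:
  fixes P :: "int \<Rightarrow> bool"
  shows "eventually P at_bot \<longleftrightarrow> (\<forall>\<^sub>F n in sequentially. P (- int n))"
proof
  show "eventually P at_bot \<Longrightarrow> \<forall>\<^sub>F n in sequentially. P (- int n)"
    by (rule eventually_compose_filterlim[OF _ filterlim_minus_int_at_bot])
  assume "\<forall>\<^sub>F n in sequentially. P (- int n)"
  then obtain N where N: "\<And>n. n \<ge> N \<Longrightarrow> P (- int n)" by (auto simp: eventually_sequentially)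
  have "P z" if "z \<le> - int N" for z
    using N[of "nat (- z)"] that by simp
  then show "eventually P at_bot" by (auto simp: eventually_at_bot_linorder)
qed

text \<open>Opens the way for results about sequences, such as completeness, measurability of limits
  and dominated convergence.\<close>

lemma filterlim_at_bot_int_iff:
  "filterlim f F (at_bot :: int filter) \<longleftrightarrow> filterlim (\<lambda>n. f (- int n)) F sequentially"
  unfolding filterlim_iff by (simp add: eventually_at_bot_int_iff)

text \<open>The map \<open>e\<close> induces an embedding of \<open>G/H\<close> into the metric space \<open>nat \<Rightarrow> real\<close>, which turns limits of
  cosets into limits of sequences.\<close>

locale coset_embedded =
  fixes H :: "'a::{topological_group_add, t2_space, second_countable_topology} set"
    and e :: "'a \<Rightarrow> nat \<Rightarrow> real"
  assumes compact_UNIV: "compact (UNIV :: 'a set)"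
    and subgroup: "compact_subgroup H"
    and cont_e: "continuous_on UNIV e"
    and e_eq_iff: "e g = e g' \<longleftrightarrow> g +o H = g' +o H"
begin

lemma e_eq_iff': "e g = e g' \<longleftrightarrow> - g + g' \<in> H"
  using e_eq_iff coset_eq_iff[OF subgroup] by blast

lemma compact_range_e: "compact (range e)"
  using compact_continuous_image[OF cont_e compact_UNIV] .

text \<open>Left to right, preimages under e are unions of cosets, so they give open sets of
  \<open>G/H\<close>. Right to left, compactness makes e a closed map: the complement of an open set
  of cosets has a closed image that misses \<open>e g\<close>.\<close>

lemma limitin_coset_iff:
  "limitin (coset_space H) (\<lambda>l. x l +o H) (g +o H) F \<longleftrightarrow> ((\<lambda>l. e (x l)) \<longlongrightarrow> e g) F"
proof
  assume lim: "limitin (coset_space H) (\<lambda>l. x l +o H) (g +o H) F"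
  show "((\<lambda>l. e (x l)) \<longlongrightarrow> e g) F"
  proof (rule topological_tendstoI)
    fix S assume S: "open S" "e g \<in> S"
    define C where "C = (\<lambda>g. g +o H) ` (e -` S)"
    have C_iff: "y +o H \<in> C \<longleftrightarrow> e y \<in> S" for y
      unfolding C_def image_iff by (metis e_eq_iff vimageE vimageI2)
    have "openin (coset_space H) C"
      unfolding C_def
      by (intro openin_coset_image subgroup open_vimage S cont_e)
    with S have "\<forall>\<^sub>F l in F. x l +o H \<in> C"
      using lim C_iff unfolding limitin_def by blast
    then show "\<forall>\<^sub>F l in F. e (x l) \<in> S" by (simp add: C_iff)
  qed
next
  assume lim: "((\<lambda>l. e (x l)) \<longlongrightarrow> e g) F"
  show "limitin (coset_space H) (\<lambda>l. x l +o H) (g +o H) F"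
    unfolding limitin_def
  proof (intro conjI allI impI)
    show "g +o H \<in> topspace (coset_space H)" by (simp add: topspace_coset_space)
    fix C assume C: "openin (coset_space H) C \<and> g +o H \<in> C"
    have "closed {y. y +o H \<notin> C}"
      using C by (simp add: openin_coset_space closed_def Collect_neg_eq[symmetric])
    then have "compact {y. y +o H \<notin> C}"
      using compact_UNIV compact_Int_closed[of UNIV] by simp
    then have "closed (e ` {y. y +o H \<notin> C})"
      by (intro compact_imp_closed compact_continuous_image continuous_on_subset[OF cont_e]) auto
    moreover have "e g \<notin> e ` {y. y +o H \<notin> C}"
      using C e_eq_iff by (auto simp: image_iff)
    ultimately have "\<forall>\<^sub>F l in F. e (x l) \<in> - e ` {y. y +o H \<notin> C}"
      using lim by (intro topological_tendstoD) auto
    then show "\<forall>\<^sub>F l in F. x l +o H \<in> C"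
      by eventually_elim blast
  qed
qed

lemma coset_lim_eqI:
  assumes "limitin (coset_space H) (\<lambda>l. x l +o H) c at_bot"
  shows "coset_lim H (\<lambda>l. x l +o H) = c"
  unfolding coset_lim_def
proof (rule the_equality)
  show "limitin (coset_space H) (\<lambda>l. x l +o H) c at_bot" by (rule assms)
  show "d = c" if "limitin (coset_space H) (\<lambda>l. x l +o H) d at_bot" for d
    using limitin_Hausdorff_unique[OF that assms trivial_limit_at_bot_linorder
        Hausdorff_coset_space[OF subgroup]] .
qed

lemma limitin_topspaceE:
  assumes "limitin (coset_space H) x c F"
  obtains g where "c = g +o H"
  using assms by (auto simp: limitin_def topspace_coset_space)

text \<open>Makes convergence in \<open>G/H\<close> an event that does not mention the limit, hence
  a measurable one. Compactness of the range of e keeps the limit of a Cauchy sequence of the form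
  \<open>e g\<close>.\<close>

lemma ex_limitin_iff_Cauchy:
  "(\<exists>c. limitin (coset_space H) (\<lambda>l. x l +o H) c at_bot) \<longleftrightarrow> Cauchy (\<lambda>n. e (x (- int n)))"
proof
  assume "\<exists>c. limitin (coset_space H) (\<lambda>l. x l +o H) c at_bot"
  then obtain g where "limitin (coset_space H) (\<lambda>l. x l +o H) (g +o H) at_bot"
    by (metis limitin_topspaceE)
  then have "(\<lambda>n. e (x (- int n))) \<longlonglongrightarrow> e g"
    by (simp add: limitin_coset_iff filterlim_at_bot_int_iff)
  then show "Cauchy (\<lambda>n. e (x (- int n)))" by (rule LIMSEQ_imp_Cauchy)
next
  assume "Cauchy (\<lambda>n. e (x (- int n)))"
  then obtain L where L: "(\<lambda>n. e (x (- int n))) \<longlonglongrightarrow> L"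
    by (auto simp: Cauchy_convergent_iff convergent_def)
  then have "L \<in> range e"
    by (intro closed_sequentially[OF compact_imp_closed[OF compact_range_e] _ L]) auto
  then obtain g where "L = e g" by auto
  with L have "limitin (coset_space H) (\<lambda>l. x l +o H) (g +o H) at_bot"
    by (simp add: limitin_coset_iff filterlim_at_bot_int_iff)
  then show "\<exists>c. limitin (coset_space H) (\<lambda>l. x l +o H) c at_bot" by blast
qed

text \<open>Going back from \<open>e g\<close> to the coset of g is measurable on the compact range
  of e, because e maps closed sets to closed sets. A section thus becomes a Borel function of points
  in a metric space.\<close>

lemma section_factor:
  assumes "measurable_section H s"
  obtains \<theta> where "\<theta> \<in> borel_measurable borel" "\<And>g. s (g +o H) = \<theta> (e g)"
proof -
  let ?Q = "sigma (topspace (coset_space H)) {\<C>. openin (coset_space H) \<C>}"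
  define j where "j y = inv e y +o H" for y
  have je: "j (e g) = g +o H" for g
    unfolding j_def using e_eq_iff f_inv_into_f[of "e g" e UNIV] by blast
  have j: "j \<in> measurable (restrict_space borel (range e)) ?Q"
  proof (rule measurable_measure_of)
    show "{\<C>. openin (coset_space H) \<C>} \<subseteq> Pow (topspace (coset_space H))"
      using openin_subset by blast
    show "j \<in> space (restrict_space borel (range e)) \<rightarrow> topspace (coset_space H)"
      by (auto simp: j_def topspace_coset_space)
    fix C assume "C \<in> {\<C>. openin (coset_space H) \<C>}"
    then have "open {g. g +o H \<in> C}" by (simp add: openin_coset_space)
    then have "compact (- {g. g +o H \<in> C})"
      using compact_UNIV compact_Int_closed[of UNIV "- {g. g +o H \<in> C}"] by (simp add: closed_Compl)
    then have "closed (e ` (- {g. g +o H \<in> C}))"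
      by (intro compact_imp_closed compact_continuous_image continuous_on_subset[OF cont_e]) auto
    moreover have "j -` C \<inter> space (restrict_space borel (range e)) =
        - (e ` (- {g. g +o H \<in> C})) \<inter> range e"
      using je by (auto simp: space_restrict_space)
    ultimately show "j -` C \<inter> space (restrict_space borel (range e))
        \<in> sets (restrict_space borel (range e))"
      by (auto simp: sets_restrict_space intro!: image_eqI[of _ _ "- (e ` (- {g. g +o H \<in> C}))"])
  qed
  have s: "s \<in> borel_measurable ?Q" using assms by (simp add: measurable_section_def)
  \<comment> \<open>Off the range of e the value is arbitrary; 0 keeps the function Borel because
    the range is a Borel set.\<close>
  define \<theta> where "\<theta> y = (if y \<in> range e then s (j y) else 0)" for y
  show thesis
  proof
    have "range e \<in> sets borel" using compact_range_e by (simp add: borel_compact)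
    moreover have "(\<lambda>y. s (j y)) \<in> borel_measurable (restrict_space borel (range e))"
      using j s by (rule measurable_compose)
    ultimately show "\<theta> \<in> borel_measurable borel"
      unfolding \<theta>_def by (simp add: measurable_If_restrict_space_iff)
    show "s (g +o H) = \<theta> (e g)" for g
      unfolding \<theta>_def by (simp only: je rangeI if_True)
  qed
qed

lemma measurable_section_coset:
  assumes "measurable_section H s"
  shows "(\<lambda>g. s (g +o H)) \<in> borel_measurable borel"
proof -
  obtain \<theta> where [measurable]: "\<theta> \<in> borel_measurable borel" and \<theta>: "\<And>g. s (g +o H) = \<theta> (e g)"
    using section_factor[OF assms] by blast
  have [measurable]: "e \<in> borel_measurable borel" using cont_e by (rule borel_measurable_continuous_onI)
  show ?thesis unfolding \<theta> by measurable
qed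

text \<open>The set where the cosets converge is a Cauchy event, on it the value is
  \<open>\<theta>\<close> of a pointwise limit, and off it the value is constant. Having this for
  any N, without exceptional sets, later makes \<open>\<phi> k\<close> measurable for the past of
  the noise itself.\<close>

lemma measurable_section_coset_lim:
  assumes "measurable_section H s" and X: "\<And>l. l \<le> 0 \<Longrightarrow> X l \<in> borel_measurable N"
  shows "(\<lambda>w. s (coset_lim H (\<lambda>l. X l w +o H))) \<in> borel_measurable N"
proof -
  obtain \<theta> where [measurable]: "\<theta> \<in> borel_measurable borel" and \<theta>: "\<And>g. s (g +o H) = \<theta> (e g)"
    using section_factor[OF assms(1)] by blast
  have [measurable]: "e \<in> borel_measurable borel" using cont_e by (rule borel_measurable_continuous_onI)
  have [measurable]: "X (- int n) \<in> borel_measurable N" for n by (rule X) simp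
  define C where "C w = Cauchy (\<lambda>n. e (X (- int n) w))" for w
  have [measurable]: "Measurable.pred N C"
    unfolding C_def by measurable
  define L where "L w = (if C w then lim (\<lambda>n. e (X (- int n) w)) else e 0)" for w
  have L: "(\<lambda>n. e (X (- int n) w)) \<longlonglongrightarrow> L w" if "C w" for w
    using that by (simp add: C_def L_def Cauchy_convergent_iff convergent_LIMSEQ_iff)
  have [measurable]: "L \<in> borel_measurable N"
  proof (rule borel_measurable_LIMSEQ_metric)
    show "(\<lambda>w. if C w then e (X (- int n) w) else e 0) \<in> borel_measurable N" for n
      by measurable
    show "(\<lambda>n. if C w then e (X (- int n) w) else e 0) \<longlonglongrightarrow> L w" for w
      using L by (cases "C w") (auto simp: L_def)
  qed
  \<comment> \<open>Where no limit exists, the definite description has an unsatisfiable body, the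
    same for all such w, so a single unspecified constant appears.\<close>
  have "s (coset_lim H (\<lambda>l. X l w +o H)) = (if C w then \<theta> (L w) else s (THE c. False))" for w
  proof (cases "C w")
    case True
    then obtain c where c: "limitin (coset_space H) (\<lambda>l. X l w +o H) c at_bot"
      using ex_limitin_iff_Cauchy[of "\<lambda>l. X l w"] by (auto simp: C_def)
    then obtain g where g: "c = g +o H" by (metis limitin_topspaceE)
    have "(\<lambda>n. e (X (- int n) w)) \<longlonglongrightarrow> e g"
      using c unfolding g by (simp add: limitin_coset_iff filterlim_at_bot_int_iff)
    then have "L w = e g" using L[OF True] by (metis LIMSEQ_unique)
    then show ?thesis using True coset_lim_eqI[OF c] by (simp add: g \<theta>)
  next
    case False
    then have "\<nexists>c. limitin (coset_space H) (\<lambda>l. X l w +o H) c at_bot"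
      using ex_limitin_iff_Cauchy[of "\<lambda>l. X l w"] by (auto simp: C_def)
    then show ?thesis using False by (simp add: coset_lim_def)
  qed
  then show ?thesis by simp
qed

text \<open>A continuous map that is constant on cosets factors through \<open>G/H\<close>; so
  convergence of cosets suffices even when \<open>x l\<close> itself does not converge.\<close>

lemma tendsto_invariant:
  fixes f :: "'a \<Rightarrow> 'c::topological_space"
  assumes f: "continuous_on UNIV f" "\<And>x h. h \<in> H \<Longrightarrow> f (x + h) = f x"
    and lim: "((\<lambda>l. e (x l)) \<longlongrightarrow> e g) F"
  shows "((\<lambda>l. f (x l)) \<longlongrightarrow> f g) F"
proof (rule topological_tendstoI)
  fix S assume S: "open S" "f g \<in> S"
  define C where "C = (\<lambda>g. g +o H) ` (f -` S)"
  have f_cong: "f y = f z" if "y +o H = z +o H" for y z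
    using f(2)[of "- y + z" y] that coset_eq_iff[OF subgroup, of y z]
    by (simp add: add.assoc[symmetric])
  have C_iff: "y +o H \<in> C \<longleftrightarrow> f y \<in> S" for y
    unfolding C_def image_iff by (metis f_cong vimageE vimageI2)
  have "openin (coset_space H) C"
    unfolding C_def by (intro openin_coset_image subgroup open_vimage S f)
  with S have "\<forall>\<^sub>F l in F. x l +o H \<in> C"
    using lim C_iff unfolding limitin_coset_iff[symmetric] limitin_def by blast
  then show "\<forall>\<^sub>F l in F. f (x l) \<in> S" by (simp add: C_iff)
qed

end

section \<open>Augmentation and independence\<close>

lemma sigma_algebra_sigma_rv: "sigma_algebra (space M) (sigma_rv M X)"
proof -
  have "sigma_rv M X = sets (vimage_algebra (space M) X borel)"
    by (auto simp: sigma_rv_def sets_vimage_algebra2)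
  then show ?thesis by (metis sets.sigma_algebra_axioms space_vimage_algebra)
qed

lemma sigma_rv_subset_iff:
  assumes "sigma_algebra (space M) \<G>"
  shows "sigma_rv M X \<subseteq> \<G> \<longleftrightarrow> X \<in> borel_measurable (sigma (space M) \<G>)"
proof -
  have "\<G> \<subseteq> Pow (space M)" "sigma_sets (space M) \<G> = \<G>"
    using assms by (auto simp: sigma_algebra.sigma_sets_eq sigma_algebra_iff2)
  then show ?thesis
    unfolding sigma_rv_def measurable_def by (simp add: subset_iff) blast
qed

lemma sigma_rv_subset_sets_iff: "sigma_rv M X \<subseteq> sets M \<longleftrightarrow> X \<in> borel_measurable M"
  by (auto simp: sigma_rv_def measurable_def)

lemma past_subset_sets:
  assumes "\<And>m. m \<le> k \<Longrightarrow> X m \<in> borel_measurable M"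
  shows "past M X k \<subseteq> sets M"
  unfolding past_def using assms sigma_rv_subset_sets_iff
  by (intro sets.sigma_sets_subset) blast

lemma sigma_rv_subset_Pow: "sigma_rv M X \<subseteq> Pow (space M)"
  by (auto simp: sigma_rv_def)

lemma sigma_algebra_past: "sigma_algebra (space M) (past M X k)"
  unfolding past_def using sigma_rv_subset_Pow by (intro sigma_algebra_sigma_sets) blast

lemma sigma_rv_subset_past: "m \<le> k \<Longrightarrow> sigma_rv M (X m) \<subseteq> past M X k"
  unfolding past_def by auto

lemma past_subset:
  assumes "sigma_algebra (space M) \<G>" "\<And>m. m \<le> k \<Longrightarrow> sigma_rv M (X m) \<subseteq> \<G>"
  shows "past M X k \<subseteq> \<G>"
  unfolding past_def using assms(2)
  by (intro sigma_algebra.sigma_sets_subset[OF assms(1)]) auto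

lemma past_mono: "j \<le> k \<Longrightarrow> past M X j \<subseteq> past M X k"
  by (intro past_subset sigma_algebra_past sigma_rv_subset_past) auto

text \<open>The completion of \<open>\<A>\<close> inside \<open>sets M\<close>. The measure M may be
  incomplete, so altering a set of \<open>\<A>\<close> on a null set counts only if the result is an
  event.\<close>

definition augment :: "'b measure \<Rightarrow> 'b set set \<Rightarrow> 'b set set" where
  "augment M \<A> = {A \<in> sets M. \<exists>B\<in>\<A>. AE w in M. w \<in> A \<longleftrightarrow> w \<in> B}"

lemma augmentI:
  "A \<in> sets M \<Longrightarrow> B \<in> \<A> \<Longrightarrow> AE w in M. w \<in> A \<longleftrightarrow> w \<in> B \<Longrightarrow> A \<in> augment M \<A>"
  by (auto simp: augment_def)

lemma augment_subset_sets: "augment M \<A> \<subseteq> sets M"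
  by (auto simp: augment_def)

lemma subset_augment: "\<A> \<subseteq> sets M \<Longrightarrow> \<A> \<subseteq> augment M \<A>"
  by (auto simp: augment_def)

lemma augment_mono: "\<A> \<subseteq> \<B> \<Longrightarrow> augment M \<A> \<subseteq> augment M \<B>"
  by (auto simp: augment_def)

lemma augment_augment: "augment M (augment M \<A>) \<subseteq> augment M \<A>"
proof
  fix A assume "A \<in> augment M (augment M \<A>)"
  then obtain B C where "A \<in> sets M" "C \<in> \<A>"
    and 1: "AE w in M. w \<in> A \<longleftrightarrow> w \<in> B" and 2: "AE w in M. w \<in> B \<longleftrightarrow> w \<in> C"
    by (auto simp: augment_def)
  moreover from 1 2 have "AE w in M. w \<in> A \<longleftrightarrow> w \<in> C" by eventually_elim auto
  ultimately show "A \<in> augment M \<A>" by (intro augmentI)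
qed

lemma sigma_algebra_augment:
  assumes "sigma_algebra (space M) \<A>"
  shows "sigma_algebra (space M) (augment M \<A>)"
proof -
  interpret A: sigma_algebra "space M" \<A> by fact
  show ?thesis
    unfolding sigma_algebra_iff2
  proof (intro conjI ballI allI impI)
    show "augment M \<A> \<subseteq> Pow (space M)" using sets.sets_into_space by (auto simp: augment_def)
    show "{} \<in> augment M \<A>" by (auto simp: augment_def intro!: bexI[of _ "{}"])
  next
    fix A assume "A \<in> augment M \<A>"
    then obtain B where B: "A \<in> sets M" "B \<in> \<A>" "AE w in M. w \<in> A \<longleftrightarrow> w \<in> B"
      by (auto simp: augment_def)
    from B(3) have "AE w in M. w \<in> space M - A \<longleftrightarrow> w \<in> space M - B" by eventually_elim auto
    with B show "space M - A \<in> augment M \<A>" by (intro augmentI[of _ _ "space M - B"]) auto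
  next
    fix A :: "nat \<Rightarrow> 'a set" assume A: "range A \<subseteq> augment M \<A>"
    then have "\<forall>i. \<exists>B. B \<in> \<A> \<and> (AE w in M. w \<in> A i \<longleftrightarrow> w \<in> B)" by (auto simp: augment_def)
    then obtain B where B: "\<And>i. B i \<in> \<A>" "\<And>i. AE w in M. w \<in> A i \<longleftrightarrow> w \<in> B i" by metis
    from B(2) have "AE w in M. \<forall>i. w \<in> A i \<longleftrightarrow> w \<in> B i" by (simp add: AE_all_countable)
    then have "AE w in M. w \<in> (\<Union>i. A i) \<longleftrightarrow> w \<in> (\<Union>i. B i)" by eventually_elim auto
    moreover have "(\<Union>i. A i) \<in> sets M" using A augment_subset_sets by fast
    moreover have "(\<Union>i. B i) \<in> \<A>" using B(1) by blast
    ultimately show "(\<Union>i. A i) \<in> augment M \<A>" by (intro augmentI)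
  qed
qed

text \<open>Almost sure identities between random variables enter the sigma-field arguments through
  this inclusion.\<close>

lemma sigma_rv_subset_augment:
  assumes "X \<in> borel_measurable M" "AE w in M. X w = Y w" "sigma_rv M Y \<subseteq> \<A>"
  shows "sigma_rv M X \<subseteq> augment M \<A>"
proof
  fix S assume "S \<in> sigma_rv M X"
  then obtain A where A: "A \<in> sets borel" "S = X -` A \<inter> space M" by (auto simp: sigma_rv_def)
  have "Y -` A \<inter> space M \<in> \<A>" using A assms(3) by (auto simp: sigma_rv_def)
  moreover have "S \<in> sets M" using A assms(1) by (auto simp: measurable_sets)
  moreover have "AE w in M. w \<in> S \<longleftrightarrow> w \<in> Y -` A \<inter> space M"
    using assms(2) by eventually_elim (simp add: A)
  ultimately show "S \<in> augment M \<A>" by (intro augmentI)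
qed

text \<open>Augmentations of sigma-fields are sigma-fields, so in this form an equality up to null
  sets can be checked on generators.\<close>

lemma eq_mod_null_iff_augment:
  assumes "\<A> \<subseteq> sets M" "\<B> \<subseteq> sets M"
  shows "eq_mod_null M \<A> \<B> \<longleftrightarrow> \<A> \<subseteq> augment M \<B> \<and> \<B> \<subseteq> augment M \<A>"
proof -
  have null: "(A - B) \<union> (B - A) \<in> null_sets M \<longleftrightarrow> (AE w in M. w \<in> A \<longleftrightarrow> w \<in> B)"
    if "A \<in> sets M" "B \<in> sets M" for A B
  proof -
    have "(A - B) \<union> (B - A) \<in> null_sets M \<longleftrightarrow> (AE w in M. w \<notin> (A - B) \<union> (B - A))"
      using that by (intro AE_iff_null_sets) auto
    also have "\<dots> \<longleftrightarrow> (AE w in M. w \<in> A \<longleftrightarrow> w \<in> B)" by (intro AE_cong) auto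
    finally show ?thesis .
  qed
  have "(\<forall>A\<in>\<A>. \<exists>B\<in>\<B>. (A - B) \<union> (B - A) \<in> null_sets M) \<longleftrightarrow> \<A> \<subseteq> augment M \<B>"
    using assms null by (fastforce simp: augment_def subset_iff)
  moreover have "(\<forall>B\<in>\<B>. \<exists>A\<in>\<A>. (A - B) \<union> (B - A) \<in> null_sets M) \<longleftrightarrow> \<B> \<subseteq> augment M \<A>"
    using assms null by (fastforce simp: augment_def subset_iff Un_commute)
  ultimately show ?thesis by (simp add: eq_mod_null_def)
qed

section \<open>Generators stable under intersection\<close>

lemma sigma_sets_Un_eq_Int:
  assumes "sigma_algebra \<Omega> \<A>" "sigma_algebra \<Omega> \<B>"
  shows "sigma_sets \<Omega> (\<A> \<union> \<B>) = sigma_sets \<Omega> {A \<inter> B | A B. A \<in> \<A> \<and> B \<in> \<B>}" (is "_ = sigma_sets \<Omega> ?P")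
proof
  interpret A: sigma_algebra \<Omega> \<A> by fact
  interpret B: sigma_algebra \<Omega> \<B> by fact
  have "A \<in> ?P" if "A \<in> \<A>" for A
    using that A.sets_into_space[OF that] by (intro CollectI exI[of _ A] exI[of _ \<Omega>]) auto
  moreover have "B \<in> ?P" if "B \<in> \<B>" for B
    using that B.sets_into_space[OF that] by (intro CollectI exI[of _ \<Omega>] exI[of _ B]) auto
  ultimately show "sigma_sets \<Omega> (\<A> \<union> \<B>) \<subseteq> sigma_sets \<Omega> ?P"
    by (intro sigma_sets_mono') auto
  show "sigma_sets \<Omega> ?P \<subseteq> sigma_sets \<Omega> (\<A> \<union> \<B>)"
  proof (rule sigma_sets_mono, clarify)
    interpret S: sigma_algebra \<Omega> "sigma_sets \<Omega> (\<A> \<union> \<B>)"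
      using A.space_closed B.space_closed by (intro sigma_algebra_sigma_sets) auto
    fix A B assume "A \<in> \<A>" "B \<in> \<B>"
    then show "A \<inter> B \<in> sigma_sets \<Omega> (\<A> \<union> \<B>)" by (intro S.Int) auto
  qed
qed

text \<open>These intersections generate the join of the two sigma-fields, so statements about a
  join reduce to them by the pi-lambda theorem.\<close>

lemma Int_stable_Int_sets:
  assumes "sigma_algebra \<Omega> \<A>" "sigma_algebra \<Omega> \<B>"
  shows "Int_stable {A \<inter> B | A B. A \<in> \<A> \<and> B \<in> \<B>}"
proof (rule Int_stableI, clarify)
  interpret A: sigma_algebra \<Omega> \<A> by fact
  interpret B: sigma_algebra \<Omega> \<B> by fact
  fix A B A' B' assume "A \<in> \<A>" "B \<in> \<B>" "A' \<in> \<A>" "B' \<in> \<B>"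
  then show "\<exists>A'' B''. A \<inter> B \<inter> (A' \<inter> B') = A'' \<inter> B'' \<and> A'' \<in> \<A> \<and> B'' \<in> \<B>"
    by (intro exI[of _ "A \<inter> A'"] exI[of _ "B \<inter> B'"]) auto
qed

lemma Int_stable_sigma_algebra: "sigma_algebra \<Omega> \<A> \<Longrightarrow> Int_stable \<A>"
  by (metis Int_stableI algebra_iff_Int sigma_algebra.axioms(1))

lemma Int_stable_Union_decseq:
  fixes \<C> :: "int \<Rightarrow> 'c set set"
  assumes "\<And>j. j \<le> 0 \<Longrightarrow> Int_stable (\<C> j)" "\<And>i j. i \<le> j \<Longrightarrow> j \<le> 0 \<Longrightarrow> \<C> j \<subseteq> \<C> i"
  shows "Int_stable (\<Union>j\<in>{..0}. \<C> j)"
proof (rule Int_stableI)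
  fix a b assume "a \<in> (\<Union>j\<in>{..0}. \<C> j)" "b \<in> (\<Union>j\<in>{..0}. \<C> j)"
  then obtain i j where "i \<le> 0" "j \<le> 0" "a \<in> \<C> i" "b \<in> \<C> j" by auto
  then have "a \<in> \<C> (min i j)" "b \<in> \<C> (min i j)"
    using assms(2)[of "min i j" i] assms(2)[of "min i j" j] by auto
  then show "a \<inter> b \<in> (\<Union>j\<in>{..0}. \<C> j)"
    using assms(1)[of "min i j"] \<open>i \<le> 0\<close> by (auto simp: Int_stable_def intro!: bexI[of _ "min i j"])
qed

section \<open>Independence of sigma-fields\<close>

context prob_space
begin

lemma indep_set_mono: "indep_set \<A> \<B> \<Longrightarrow> \<A>' \<subseteq> \<A> \<Longrightarrow> \<B>' \<subseteq> \<B> \<Longrightarrow> indep_set \<A>' \<B>'"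
  unfolding indep_sets2_eq by blast

lemma indep_set_commute: "indep_set \<A> \<B> \<Longrightarrow> indep_set \<B> \<A>"
  unfolding indep_sets2_eq by (metis Int_commute mult.commute)

lemma indep_set_augment:
  assumes "indep_set \<A> \<B>"
  shows "indep_set (augment M \<A>) (augment M \<B>)"
proof (rule indep_setI)
  fix a b assume "a \<in> augment M \<A>" "b \<in> augment M \<B>"
  then obtain a' b' where ab: "a \<in> events" "b \<in> events" "a' \<in> \<A>" "b' \<in> \<B>"
    and 1: "AE w in M. w \<in> a \<longleftrightarrow> w \<in> a'" and 2: "AE w in M. w \<in> b \<longleftrightarrow> w \<in> b'"
    by (auto simp: augment_def)
  have ev: "a' \<in> events" "b' \<in> events" using assms ab by (auto simp: indep_sets2_eq)
  have "prob (a \<inter> b) = prob (a' \<inter> b')"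
    using 1 2 ab ev by (intro finite_measure_eq_AE) auto
  moreover have "prob a = prob a'" "prob b = prob b'"
    using 1 2 ab ev by (auto intro!: finite_measure_eq_AE)
  ultimately show "prob (a \<inter> b) = prob a * prob b"
    using indep_setD[OF assms ab(3,4)] by simp
qed (rule augment_subset_sets)+

text \<open>\<open>P(A B C) = P(A B) P(C) = P(A) P(B) P(C) = P(A) P(B C)\<close>. The family
  \<open>\<D>\<close> stands for a past that contains both \<open>\<A>\<close> and
  \<open>\<B>\<close> and is independent of the new sigma-field \<open>\<C>\<close>.\<close>

lemma indep_set_join:
  assumes sa: "sigma_algebra (space M) \<A>" "sigma_algebra (space M) \<B>" "sigma_algebra (space M) \<C>"
    and AB: "indep_set \<A> \<B>" and DC: "indep_set \<D> \<C>"
    and ABD: "\<And>A B. A \<in> \<A> \<Longrightarrow> B \<in> \<B> \<Longrightarrow> A \<inter> B \<in> \<D>"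
  shows "indep_set \<A> (sigma_sets (space M) (\<B> \<union> \<C>))"
proof -
  let ?P = "{B \<inter> C | B C. B \<in> \<B> \<and> C \<in> \<C>}"
  have ev: "\<A> \<subseteq> events" "\<B> \<subseteq> events" "\<C> \<subseteq> events"
    using AB DC by (auto simp: indep_sets2_eq)
  have "space M \<in> \<A>" using sa(1) by (simp add: sigma_algebra_iff2) (metis Diff_empty)
  have "indep_set \<A> ?P"
  proof (rule indep_setI)
    show "?P \<subseteq> events" using ev by blast
    fix a b assume a: "a \<in> \<A>" and "b \<in> ?P"
    then obtain B C where b: "b = B \<inter> C" "B \<in> \<B>" "C \<in> \<C>" by auto
    \<comment> \<open>Taking the whole space for the set from \<open>\<A>\<close> puts B itself into
      \<open>\<D>\<close>, which gives \<open>P(B C) = P(B) P(C)\<close>.\<close>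
    have "B = space M \<inter> B" using b(2) ev sets.sets_into_space by blast
    then have "B \<in> \<D>" using ABD[OF \<open>space M \<in> \<A>\<close> b(2)] by simp
    then have "prob (B \<inter> C) = prob B * prob C" using DC b by (metis indep_setD)
    moreover have "prob ((a \<inter> B) \<inter> C) = prob (a \<inter> B) * prob C"
      using ABD[OF a b(2)] DC b by (metis indep_setD)
    moreover have "prob (a \<inter> B) = prob a * prob B" using AB a b by (metis indep_setD)
    ultimately show "prob (a \<inter> b) = prob a * prob b" by (simp add: b Int_assoc)
  qed (use ev in auto)
  then have "indep_set (sigma_sets (space M) \<A>) (sigma_sets (space M) ?P)"
    using sa by (intro indep_set_sigma_sets Int_stable_Int_sets Int_stable_sigma_algebra)
  then show ?thesis
    using sa by (simp add: sigma_sets_Un_eq_Int sigma_algebra.sigma_sets_eq)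
qed

text \<open>The union of a chain of sigma-fields is closed under intersection, though not a
  sigma-field in general. This passes from the noise after time j to all of the noise as j
  decreases.\<close>

lemma indep_set_sigma_Union:
  fixes \<C> :: "int \<Rightarrow> 'a set set"
  assumes "sigma_algebra (space M) \<A>" "\<And>j. j \<le> 0 \<Longrightarrow> sigma_algebra (space M) (\<C> j)"
    and "\<And>i j. i \<le> j \<Longrightarrow> j \<le> 0 \<Longrightarrow> \<C> j \<subseteq> \<C> i"
    and "\<And>j. j \<le> 0 \<Longrightarrow> indep_set \<A> (\<C> j)"
  shows "indep_set \<A> (sigma_sets (space M) (\<Union>j\<in>{..0}. \<C> j))"
proof -
  have "indep_set \<A> (\<Union>j\<in>{..0}. \<C> j)"
    using assms(4) assms(4)[of 0] unfolding indep_sets2_eq by blast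
  then have "indep_set (sigma_sets (space M) \<A>) (sigma_sets (space M) (\<Union>j\<in>{..0}. \<C> j))"
    using assms by (intro indep_set_sigma_sets Int_stable_Union_decseq Int_stable_sigma_algebra) auto
  then show ?thesis using assms(1) by (simp add: sigma_algebra.sigma_sets_eq)
qed

text \<open>X and the identity map into the space equipped with \<open>\<G>\<close> have a product
  joint law, so Fubini's theorem integrates X out while Y is held fixed. The indicator of A makes
  this a formula for the conditional expectation of \<open>g (X, Y)\<close> given
  \<open>\<G>\<close>.\<close>

lemma integral_freeze:
  fixes X :: "'a \<Rightarrow> 'c::topological_space" and Y :: "'a \<Rightarrow> 'd::topological_space"
    and g :: "'c \<times> 'd \<Rightarrow> real"
  assumes X[measurable]: "X \<in> borel_measurable M"
    and sa: "sigma_algebra (space M) \<G>" and ind: "indep_set (sigma_rv M X) \<G>"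
    and Y: "Y \<in> borel_measurable (sigma (space M) \<G>)" and A: "A \<in> \<G>"
    and g: "g \<in> borel_measurable (borel \<Otimes>\<^sub>M borel)" and bound: "\<And>z. \<bar>g z\<bar> \<le> B"
  shows "(\<integral>w. indicator A w * g (X w, Y w) \<partial>M) =
    (\<integral>w. indicator A w * (\<integral>x. g (x, Y w) \<partial>distr M borel X) \<partial>M)"
proof -
  define N where "N = sigma (space M) \<G>"
  have ev: "\<G> \<subseteq> events" using ind by (simp add: indep_sets2_eq)
  have N: "space N = space M" "sets N = \<G>"
    using sa by (auto simp: N_def sigma_algebra.sigma_sets_eq sigma_algebra_iff2)
  have id[measurable]: "(\<lambda>w. w) \<in> measurable M N"
    using ev N by (auto simp: measurable_def intro: sets.sets_into_space Int_absorb1)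
  have Y'[measurable]: "Y \<in> borel_measurable N" using Y by (simp add: N_def)
  have A'[measurable]: "A \<in> sets N" using A N by simp
  note g[measurable]
  interpret D: prob_space "distr M borel X" by (rule prob_space_distr) simp
  interpret N: prob_space "distr M N (\<lambda>w. w)" by (rule prob_space_distr) simp
  interpret P: pair_prob_space "distr M borel X" "distr M N (\<lambda>w. w)" ..
  have eq: "distr M borel X \<Otimes>\<^sub>M distr M N (\<lambda>w. w) = distr M (borel \<Otimes>\<^sub>M N) (\<lambda>w. (X w, w))"
  proof (rule pair_measure_eqI)
    show "sigma_finite_measure (distr M borel X)" "sigma_finite_measure (distr M N (\<lambda>w. w))"
      by unfold_locales
    fix C D assume "C \<in> sets (distr M borel X)" "D \<in> sets (distr M N (\<lambda>w. w))"
    then have CD[measurable]: "C \<in> sets borel" "D \<in> sets N" by auto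
    have "(\<lambda>w. (X w, w)) -` (C \<times> D) \<inter> space M = (X -` C \<inter> space M) \<inter> D"
      using sets.sets_into_space[OF CD(2)] by (auto simp: N)
    moreover have "prob ((X -` C \<inter> space M) \<inter> D) = prob (X -` C \<inter> space M) * prob D"
      using ind CD by (intro indep_setD) (auto simp: sigma_rv_def N)
    moreover have "D \<inter> space M = D" using sets.sets_into_space[OF CD(2)] by (auto simp: N)
    ultimately show "emeasure (distr M borel X) C * emeasure (distr M N (\<lambda>w. w)) D =
        emeasure (distr M (borel \<Otimes>\<^sub>M N) (\<lambda>w. (X w, w))) (C \<times> D)"
      by (simp add: emeasure_distr emeasure_eq_measure ennreal_mult'')
  qed (simp cong: sets_pair_measure_cong)
  define h where "h = (\<lambda>(x, w). indicator A w * g (x, Y w))"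
  have h[measurable]: "h \<in> borel_measurable (borel \<Otimes>\<^sub>M N)" unfolding h_def by measurable
  have "B \<ge> 0" using bound[of undefined] by linarith
  then have int: "integrable (distr M borel X \<Otimes>\<^sub>M distr M N (\<lambda>w. w)) h"
  proof (intro P.integrable_const_bound[of _ B])
    show "AE z in distr M borel X \<Otimes>\<^sub>M distr M N (\<lambda>w. w). norm (h z) \<le> B"
      using bound \<open>B \<ge> 0\<close> by (auto simp: h_def indicator_def)
    show "h \<in> borel_measurable (distr M borel X \<Otimes>\<^sub>M distr M N (\<lambda>w. w))"
      using h by (simp cong: measurable_cong_sets sets_pair_measure_cong)
  qed
  have "(\<integral>w. indicator A w * g (X w, Y w) \<partial>M) = (\<integral>z. h z \<partial>distr M (borel \<Otimes>\<^sub>M N) (\<lambda>w. (X w, w)))"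
    by (subst integral_distr) (auto simp: h_def)
  also have "\<dots> = (\<integral>w. (\<integral>x. h (x, w) \<partial>distr M borel X) \<partial>distr M N (\<lambda>w. w))"
    unfolding eq[symmetric] using P.integral_snd[of "\<lambda>x w. h (x, w)"] int
    by (simp add: case_prod_eta)
  also have "\<dots> = (\<integral>w. (\<integral>x. h (x, w) \<partial>distr M borel X) \<partial>M)"
    by (subst integral_distr) (auto intro!: D.borel_measurable_lebesgue_integral)
  finally show ?thesis by (simp add: h_def)
qed

text \<open>The reason: \<open>P(A | \<W> \<or> \<V>) = P(A | \<V>)\<close>, and the left side is the indicator of A.\<close>

lemma in_augment_if_indep:
  assumes sa: "sigma_algebra (space M) \<T>" "sigma_algebra (space M) \<W>" "sigma_algebra (space M) \<V>"
    and ind: "indep_set \<W> \<T>" and VT: "\<V> \<subseteq> \<T>" and AT: "A \<in> \<T>"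
    and A: "A \<in> augment M (sigma_sets (space M) (\<W> \<union> \<V>))"
  shows "A \<in> augment M \<V>"
proof -
  have ev: "\<T> \<subseteq> events" "\<W> \<subseteq> events" "\<V> \<subseteq> events"
    using ind VT by (auto simp: indep_sets2_eq)
  have [measurable]: "A \<in> events" using ev AT by auto
  interpret T: sigma_algebra "space M" \<T> by fact
  define G where "G = sigma (space M) \<V>"
  have G: "space G = space M" "sets G = \<V>"
    using sa(3) by (auto simp: G_def sigma_algebra.sigma_sets_eq sigma_algebra_iff2)
  have sub: "subalgebra M G" using G ev by (simp add: subalgebra_def)
  interpret finite_measure_subalgebra M G by unfold_locales (rule sub)
  define f where "f = real_cond_exp M G (indicator A)"
  have fG[measurable]: "f \<in> borel_measurable G" by (simp add: f_def)
  have f[measurable]: "f \<in> borel_measurable M" by (rule measurable_from_subalg[OF sub fG])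
  have iA: "integrable M (indicator A :: 'a \<Rightarrow> real)"
    by (simp add: integrable_indicator_iff emeasure_eq_measure)
  have if': "integrable M f" unfolding f_def by (rule real_cond_exp_int(1)[OF iA])
  have f_D: "(\<integral>w. indicator D w * f w \<partial>M) = prob (D \<inter> A)" if "D \<in> \<V>" for D
  proof -
    have "D \<inter> A \<inter> space M = D \<inter> A" using sets.sets_into_space[OF \<open>A \<in> events\<close>] by auto
    then show ?thesis
      using real_cond_exp_intA[OF iA, of D] that ev
      by (simp add: G f_def set_lebesgue_integral_def indicator_inter_arith[symmetric] subset_iff)
  qed
  have f0: "AE w in M. 0 \<le> f w" unfolding f_def by (rule real_cond_exp_pos) auto
  have f1: "AE w in M. f w \<le> 1"
  proof -
    have "AE w in M. f w \<le> real_cond_exp M G (\<lambda>_. 1) w"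
      unfolding f_def by (rule real_cond_exp_mono) (auto simp: iA indicator_def)
    moreover have "AE w in M. real_cond_exp M G (\<lambda>_. 1) w = 1"
      by (rule real_cond_exp_F_meas) auto
    ultimately show ?thesis by eventually_elim auto
  qed
  have iEf: "integrable M (\<lambda>w. indicator E w * f w)" if "E \<in> events" for E
    using integrable_real_mult_indicator[OF that if'] by (simp add: mult.commute)
  \<comment> \<open>The variable \<open>indicator D * f\<close> is \<open>\<V>\<close>-measurable,
    so W splits off; it is put back because \<open>D \<inter> A\<close> belongs to
    \<open>\<T>\<close>.\<close>
  have WV: "(\<integral>w. indicator (W \<inter> D) w * f w \<partial>M) = prob ((W \<inter> D) \<inter> A)" if W: "W \<in> \<W>" and D: "D \<in> \<V>" for W D
  proof -
    have [measurable]: "W \<in> events" "D \<in> events" "D \<in> sets G" using ev W D G by auto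
    have "sigma_rv M (indicator W :: 'a \<Rightarrow> real) \<subseteq> \<W>"
    proof -
      have "W \<in> sets (sigma (space M) \<W>)"
        using W sa(2) by (auto simp: sigma_algebra_iff2)
      then show ?thesis unfolding sigma_rv_subset_iff[OF sa(2)] by measurable
    qed
    moreover have "sigma_rv M (\<lambda>w. indicator D w * f w) \<subseteq> \<V>"
      unfolding sigma_rv_subset_iff[OF sa(3)] G_def[symmetric] by measurable
    ultimately have "indep_set (sigma_rv M (indicator W :: 'a \<Rightarrow> real)) (sigma_rv M (\<lambda>w. indicator D w * f w))"
      using ind VT by (intro indep_set_mono[OF ind]) auto
    then have "indep_var borel (indicator W :: 'a \<Rightarrow> real) borel (\<lambda>w. indicator D w * f w)"
      unfolding indep_var_eq sigma_rv_def[symmetric] 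
      by (simp add: sigma_rv_def[symmetric] sigma_algebra.sigma_sets_eq[OF sigma_algebra_sigma_rv])
    then have "(\<integral>w. indicator W w * (indicator D w * f w) \<partial>M) =
        (\<integral>w. indicator W w \<partial>M) * (\<integral>w. indicator D w * f w \<partial>M)"
      by (intro indep_var_lebesgue_integral iEf) (auto simp: integrable_indicator_iff emeasure_eq_measure)
    also have "\<dots> = prob W * prob (D \<inter> A)" by (simp add: f_D[OF D])
    also have "\<dots> = prob (W \<inter> (D \<inter> A))"
      using indep_setD[OF ind W, of "D \<inter> A"] D AT VT T.Int by (metis subsetD)
    finally show ?thesis by (simp add: indicator_inter_arith mult.assoc Int_assoc)
  qed
  have space_V: "space M \<in> \<V>" using sa(3) by (simp add: sigma_algebra_iff2) (metis Diff_empty)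
  \<comment> \<open>Hence f is also a conditional probability of A given the larger join of
    \<open>\<W>\<close> and \<open>\<V>\<close>.\<close>
  have key: "(\<integral>w. indicator E w * f w \<partial>M) = prob (E \<inter> A)" if "E \<in> sigma_sets (space M) (\<W> \<union> \<V>)" for E
  proof -
    have *: "sigma_sets (space M) {A \<inter> B |A B. A \<in> \<W> \<and> B \<in> \<V>} \<subseteq> events"
      using ev by (intro sets.sigma_sets_subset) blast
    have Pow: "{A \<inter> B |A B. A \<in> \<W> \<and> B \<in> \<V>} \<subseteq> Pow (space M)"
      using ev sets.sets_into_space by blast
    have "E \<in> sigma_sets (space M) {A \<inter> B |A B. A \<in> \<W> \<and> B \<in> \<V>}"
      using that by (simp add: sigma_sets_Un_eq_Int[OF sa(2,3)])
    with Int_stable_Int_sets[OF sa(2,3)] Pow show ?thesis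
    proof (induction E rule: sigma_sets_induct_disjoint)
      case (basic E) then show ?case using WV by auto
    next
      case empty then show ?case by simp
    next
      case (compl E)
      then have [measurable]: "E \<in> events" using * by auto
      have "(\<integral>w. indicator (space M - E) w * f w \<partial>M) = (\<integral>w. f w - indicator E w * f w \<partial>M)"
        by (intro Bochner_Integration.integral_cong) (auto simp: indicator_def)
      also have "\<dots> = (\<integral>w. indicator (space M) w * f w \<partial>M) - (\<integral>w. indicator E w * f w \<partial>M)"
        by (subst Bochner_Integration.integral_diff[OF if' iEf])
          (auto intro!: Bochner_Integration.integral_cong)
      also have "\<dots> = prob A - prob (E \<inter> A)"
        using f_D[OF space_V] compl by simp
      also have "\<dots> = prob ((space M - E) \<inter> A)"
      proof -
        have "(space M - E) \<inter> A = A - E \<inter> A" using sets.sets_into_space[OF \<open>A \<in> events\<close>] by auto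
        then show ?thesis by (simp add: finite_measure_Diff)
      qed
      finally show ?case .
    next
      case (union E)
      then have [measurable]: "E i \<in> events" for i using * by blast
      have "(\<integral>w. indicator (\<Union>i. E i) w * f w \<partial>M) = (\<Sum>i. \<integral>w. indicator (E i) w * f w \<partial>M)"
        using lebesgue_integral_countable_add[of E M f] union iEf[of "\<Union>i. E i"]
        by (simp add: set_lebesgue_integral_def set_integrable_def disjoint_family_on_def)
      also have "\<dots> = (\<Sum>i. prob (E i \<inter> A))" using union by simp
      also have "\<dots> = prob (\<Union>i. E i \<inter> A)"
        using union(1)
        by (intro sums_unique[symmetric] finite_measure_UNION) (auto simp: disjoint_family_on_def)
      finally show ?case by simp
    qed
  qed
  obtain B where B: "B \<in> sigma_sets (space M) (\<W> \<union> \<V>)" and AB: "AE w in M. w \<in> A \<longleftrightarrow> w \<in> B"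
    using A by (auto simp: augment_def)
  have "sigma_sets (space M) (\<W> \<union> \<V>) \<subseteq> events" using ev by (intro sets.sigma_sets_subset) auto
  with B have [measurable]: "B \<in> events" by auto
  \<comment> \<open>Testing \<open>key\<close> on a version B of A shows that f has integral
    \<open>prob A\<close> over A. As f is at most 1, it equals 1 almost everywhere on A; its total
    integral is \<open>prob A\<close> too, so it vanishes off A.\<close>
  have "(\<integral>w. indicator A w * f w \<partial>M) = (\<integral>w. indicator B w * f w \<partial>M)"
    using AB by (intro integral_cong_AE) (auto simp: indicator_def)
  also have "\<dots> = prob (B \<inter> A)" by (rule key[OF B])
  also have "\<dots> = prob A" using AB by (intro finite_measure_eq_AE) auto
  finally have Af: "(\<integral>w. indicator A w * f w \<partial>M) = prob A" .
  have "(\<integral>w. indicator (space M) w * f w \<partial>M) = prob (space M \<inter> A)"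
    by (rule f_D[OF space_V])
  then have ff: "(\<integral>w. f w \<partial>M) = prob A"
    by (subst Bochner_Integration.integral_cong[of M M f "\<lambda>w. indicator (space M) w * f w"]) auto
  have "(\<integral>w. indicator A w - indicator A w * f w \<partial>M) = 0"
    by (subst Bochner_Integration.integral_diff[OF iA iEf]) (auto simp: Af)
  moreover have "AE w in M. 0 \<le> indicator A w - indicator A w * f w"
    using f1 by eventually_elim (auto simp: indicator_def)
  ultimately have 1: "AE w in M. indicator A w - indicator A w * f w = 0"
    by (subst (asm) integral_nonneg_eq_0_iff_AE) (auto intro!: iA iEf)
  have "(\<integral>w. f w - indicator A w * f w \<partial>M) = 0"
    by (subst Bochner_Integration.integral_diff[OF if' iEf]) (auto simp: Af ff)
  moreover have "AE w in M. 0 \<le> f w - indicator A w * f w"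
    using f0 by eventually_elim (auto simp: indicator_def)
  ultimately have 2: "AE w in M. f w - indicator A w * f w = 0"
    by (subst (asm) integral_nonneg_eq_0_iff_AE) (auto intro!: if' iEf)
  \<comment> \<open>f is almost surely the indicator of A, so every threshold in
    \<open>[0, 1)\<close> cuts out a version of A that lies in \<open>\<V>\<close>.\<close>
  have "{w \<in> space G. f w > 1/2} \<in> sets G" by measurable
  then have "{w \<in> space M. f w > 1/2} \<in> \<V>" by (simp add: G)
  moreover have "AE w in M. w \<in> A \<longleftrightarrow> w \<in> {w \<in> space M. f w > 1/2}"
    using 1 2 AE_space by eventually_elim (auto simp: indicator_def split: if_splits)
  ultimately show ?thesis by (rule augmentI[OF \<open>A \<in> events\<close>])
qed

end

section \<open>Laws on a compact group\<close>

lemma continuous_real_bound: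
  fixes f :: "'a::topological_space \<Rightarrow> real"
  assumes "compact (UNIV :: 'a set)" "continuous_on UNIV f"
  obtains B where "0 < B" "\<And>x. \<bar>f x\<bar> \<le> B"
proof -
  have "bounded (range f)"
    using compact_continuous_image[OF assms(2,1)] by (rule compact_imp_bounded)
  then obtain B where "0 < B" "\<And>x. \<bar>f x\<bar> \<le> B"
    by (auto simp: bounded_pos)
  then show thesis by (rule that)
qed

lemma integrable_continuous_compact:
  fixes f :: "'a::topological_space \<Rightarrow> real"
  assumes "compact (UNIV :: 'a set)" "continuous_on UNIV f" "borel_law N"
  shows "integrable N f"
proof -
  interpret prob_space N using assms(3) by (simp add: borel_law_def)
  have [measurable_cong]: "sets N = sets borel" using assms(3) by (simp add: borel_law_def)
  obtain B where B: "\<And>x. \<bar>f x\<bar> \<le> B" using continuous_real_bound[OF assms(1,2)] by metis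
  have [measurable]: "f \<in> borel_measurable borel"
    using assms(2) by (rule borel_measurable_continuous_onI)
  have "f \<in> borel_measurable N" by measurable
  then show ?thesis using B by (intro integrable_const_bound[of _ B]) auto
qed

lemma open_indicator_approx:
  fixes U :: "'a::{topological_group_add, t2_space, second_countable_topology} set"
  assumes "compact (UNIV :: 'a set)" "open U"
  obtains f :: "nat \<Rightarrow> 'a \<Rightarrow> real"
  where "\<And>n. continuous_on UNIV (f n)" "\<And>n x. 0 \<le> f n x" "\<And>n x. f n x \<le> 1"
    "\<And>x. (\<lambda>n. f n x) \<longlonglongrightarrow> indicator U x"
proof (cases "U = UNIV")
  case True
  then show thesis by (intro that[of "\<lambda>_ _. 1"]) auto
next
  case False
  \<comment> \<open>For the trivial subgroup the coset embedding is an embedding of G itself, and it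
    supplies a distance to the complement of U.\<close>
  have sg: "compact_subgroup {0 :: 'a}" by (simp add: compact_subgroup_def)
  then obtain e :: "'a \<Rightarrow> nat \<Rightarrow> real"
    where e: "continuous_on UNIV e" "\<And>g g'. e g = e g' \<longleftrightarrow> g +o {0} = g' +o {0}"
    using coset_embedding[OF assms(1)] by metis
  have inj: "e g = e g' \<Longrightarrow> g = g'" for g g'
    using e(2)[of g g'] by (auto simp: elt_set_plus_def)
  define K where "K = e ` (- U)"
  have "compact (- U)"
    using compact_Int_closed[OF assms(1), of "- U"] assms(2) by (simp add: closed_Compl)
  then have "closed K"
    unfolding K_def
    by (intro compact_imp_closed compact_continuous_image continuous_on_subset[OF e(1)]) auto
  \<comment> \<open>By convention the distance to the empty set is 0, which is why
    \<open>U = UNIV\<close> is treated apart.\<close>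
  have "K \<noteq> {}" using False by (auto simp: K_def)
  define f :: "nat \<Rightarrow> 'a \<Rightarrow> real" where "f n x = min 1 (real n * infdist (e x) K)" for n x
  show thesis
  proof (rule that)
    show "continuous_on UNIV (f n)" for n
      unfolding f_def by (intro continuous_intros continuous_on_infdist e)
    show "0 \<le> f n x" "f n x \<le> 1" for n x by (simp_all add: f_def infdist_nonneg)
    show "(\<lambda>n. f n x) \<longlonglongrightarrow> indicator U x" for x
    proof (cases "x \<in> U")
      case True
      then have "e x \<notin> K" using inj by (auto simp: K_def)
      then have pos: "infdist (e x) K > 0"
        using \<open>closed K\<close> \<open>K \<noteq> {}\<close> infdist_nonneg[of "e x" K] in_closed_iff_infdist_zero by force
      obtain N where N: "real N * infdist (e x) K > 1"
        using reals_Archimedean3[OF pos] by blast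
      have "f n x = 1" if "n \<ge> N" for n
        using N mult_right_mono[of "real N" "real n" "infdist (e x) K"] that pos
        unfolding f_def by linarith
      then have "\<forall>\<^sub>F n in sequentially. f n x = 1" by (auto simp: eventually_sequentially)
      then show ?thesis using True by (simp add: tendsto_eventually)
    next
      case False
      then have "f n x = 0" for n by (simp add: f_def K_def)
      then show ?thesis using False by simp
    qed
  qed
qed

text \<open>Yields the law of Z and its independence of A at once. Indicators of open sets are
  limits of continuous functions, and the open sets form a pi-system that generates the Borel
  sets.\<close>

lemma (in prob_space) prob_Int_eq_if_continuous:
  fixes Z :: "'a \<Rightarrow> 'c::{topological_group_add, t2_space, second_countable_topology}"
  assumes comp: "compact (UNIV :: 'c set)"
    and A[measurable]: "A \<in> events" and Z[measurable]: "Z \<in> borel_measurable M" and L: "borel_law L"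
    and eq: "\<And>f :: 'c \<Rightarrow> real. continuous_on UNIV f \<Longrightarrow>
      (\<integral>w. indicator A w * f (Z w) \<partial>M) = prob A * (\<integral>x. f x \<partial>L)"
    and B: "B \<in> sets borel"
  shows "prob (A \<inter> (Z -` B \<inter> space M)) = prob A * measure L B"
proof -
  interpret L: prob_space L using L by (simp add: borel_law_def)
  have [measurable_cong]: "sets L = sets borel" using L by (simp add: borel_law_def)
  have spL: "space L = UNIV" using sets_eq_imp_space_eq[OF \<open>sets L = sets borel\<close>] by simp
  have "Int_stable {S :: 'c set. open S}" by (auto simp: Int_stable_def)
  moreover have "{S :: 'c set. open S} \<subseteq> Pow UNIV" by simp
  moreover have "B \<in> sigma_sets UNIV {S. open S}" using B by (simp add: borel_def)
  ultimately show ?thesis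
  proof (induction B rule: sigma_sets_induct_disjoint)
    case (basic B)
    then have oB: "open B" by simp
    then have [measurable]: "B \<in> sets borel" by simp
    obtain f :: "nat \<Rightarrow> 'c \<Rightarrow> real" where f: "\<And>n. continuous_on UNIV (f n)"
      "\<And>n x. 0 \<le> f n x" "\<And>n x. f n x \<le> 1" "\<And>x. (\<lambda>n. f n x) \<longlonglongrightarrow> indicator B x"
      using open_indicator_approx[OF comp oB] by metis
    have [measurable]: "f n \<in> borel_measurable borel" for n
      using f(1) by (rule borel_measurable_continuous_onI)
    have "(\<lambda>n. \<integral>w. indicator A w * f n (Z w) \<partial>M) \<longlonglongrightarrow> (\<integral>w. indicator A w * indicator B (Z w) \<partial>M :: real)"
    proof (rule integral_dominated_convergence[where w="\<lambda>_. 1"])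
      show "AE w in M. (\<lambda>n. indicator A w * f n (Z w)) \<longlonglongrightarrow> indicator A w * indicator B (Z w)"
        by (intro AE_I2 tendsto_mult tendsto_const f(4))
      show "AE w in M. norm (indicator A w * f n (Z w)) \<le> 1" for n
        using f(2,3) by (intro AE_I2) (simp add: indicator_def)
    qed auto
    moreover have "(\<lambda>n. \<integral>x. f n x \<partial>L) \<longlonglongrightarrow> (\<integral>x. indicator B x \<partial>L)"
      by (rule integral_dominated_convergence[where w="\<lambda>_. 1"]) (use f in auto)
    then have "(\<lambda>n. prob A * (\<integral>x. f n x \<partial>L)) \<longlonglongrightarrow> prob A * (\<integral>x. indicator B x \<partial>L)"
      by (rule tendsto_mult_left)
    ultimately have "(\<integral>w. indicator A w * indicator B (Z w) \<partial>M :: real) = prob A * (\<integral>x. indicator B x \<partial>L)"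
      using eq[OF f(1)] by (simp add: LIMSEQ_unique)
    moreover have "(\<integral>w. indicator A w * indicator B (Z w) \<partial>M :: real) =
        (\<integral>w. indicator (A \<inter> (Z -` B \<inter> space M)) w \<partial>M)"
      by (intro Bochner_Integration.integral_cong) (auto simp: indicator_def)
    ultimately show ?case by (simp add: spL)
  next
    case empty then show ?case by simp
  next
    case (compl B)
    then have [measurable]: "B \<in> sets borel" by (simp add: borel_def)
    have "A \<inter> (Z -` (UNIV - B) \<inter> space M) = A - (A \<inter> (Z -` B \<inter> space M))"
      using sets.sets_into_space[OF A] by auto
    then have "prob (A \<inter> (Z -` (UNIV - B) \<inter> space M)) = prob A - prob (A \<inter> (Z -` B \<inter> space M))"
      by (simp add: finite_measure_Diff)
    also have "\<dots> = prob A * (1 - measure L B)" using compl by (simp add: right_diff_distrib)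
    also have "1 - measure L B = measure L (UNIV - B)"
      using L.prob_compl[of B] by (simp add: spL)
    finally show ?case .
  next
    case (union B)
    then have [measurable]: "B i \<in> sets borel" for i by (auto simp: borel_def)
    have "(\<lambda>i. prob (A \<inter> (Z -` B i \<inter> space M))) sums prob (\<Union>i. A \<inter> (Z -` B i \<inter> space M))"
      using union(1) by (intro finite_measure_UNION) (auto simp: disjoint_family_on_def)
    moreover have "(\<lambda>i. measure L (B i)) sums measure L (\<Union>i. B i)"
      using union(1) by (intro L.finite_measure_UNION) auto
    then have "(\<lambda>i. prob A * measure L (B i)) sums (prob A * measure L (\<Union>i. B i))"
      by (rule sums_mult)
    moreover have "(\<Union>i. A \<inter> (Z -` B i \<inter> space M)) = A \<inter> (Z -` (\<Union>i. B i) \<inter> space M)" by auto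
    ultimately show ?case using union(3) by (simp add: sums_unique2)
  qed
qed

section \<open>Integrals of translates on a compact group\<close>

lemma eventually_uniform_translate:
  fixes f :: "'a::topological_group_add \<Rightarrow> real"
  assumes "compact (UNIV :: 'a set)" "continuous_on UNIV f" "\<epsilon> > 0"
  shows "\<exists>N. open N \<and> y0 \<in> N \<and> (\<forall>y\<in>N. \<forall>x. \<bar>f (x + y) - f (x + y0)\<bar> < \<epsilon>)"
proof -
  let ?W = "{z. \<bar>f (snd z + fst z) - f (snd z + y0)\<bar> < \<epsilon>}"
  have "continuous_on UNIV (\<lambda>z. \<bar>f (snd z + fst z) - f (snd z + y0)\<bar>)"
    by (intro continuous_intros continuous_on_compose2[OF assms(2)]) auto
  then have "open ?W"
    by (intro open_Collect_less continuous_on_const)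
  moreover have "{y0} \<times> UNIV \<subseteq> ?W" using assms(3) by auto
  \<comment> \<open>By compactness in the variable x, one neighbourhood of \<open>y0\<close> serves
    all x.\<close>
  ultimately obtain N where "y0 \<in> N" "open N" "N \<times> UNIV \<subseteq> ?W"
    using Elementary_Topology.tube_lemma[OF assms(1), of ?W y0] by blast
  moreover from this have "\<bar>f (x + y) - f (x + y0)\<bar> < \<epsilon>" if "y \<in> N" for x y
    using that subsetD[of "N \<times> UNIV" ?W "(y, x)"] by simp
  ultimately show ?thesis by blast
qed

lemma integral_translate_close:
  fixes f :: "'a::{topological_group_add, second_countable_topology} \<Rightarrow> real"
  assumes "compact (UNIV :: 'a set)" "continuous_on UNIV f" "borel_law N"
    and "\<And>x. \<bar>f (x + y) - f (x + z)\<bar> \<le> \<epsilon>"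
  shows "\<bar>(\<integral>x. f (x + y) \<partial>N) - (\<integral>x. f (x + z) \<partial>N)\<bar> \<le> \<epsilon>"
proof -
  interpret prob_space N using assms(3) by (simp add: borel_law_def)
  have int: "integrable N (\<lambda>x. f (x + y))" for y
    by (intro integrable_continuous_compact assms continuous_intros continuous_on_compose2[OF assms(2)]) auto
  have "\<bar>(\<integral>x. f (x + y) \<partial>N) - (\<integral>x. f (x + z) \<partial>N)\<bar> = \<bar>\<integral>x. f (x + y) - f (x + z) \<partial>N\<bar>"
    by (simp add: int)
  also have "\<dots> \<le> (\<integral>x. \<bar>f (x + y) - f (x + z)\<bar> \<partial>N)"
    by (rule integral_abs_bound)
  also have "\<dots> \<le> (\<integral>x. \<epsilon> \<partial>N)"
    using assms(4) by (intro integral_mono) (auto simp: int)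
  finally show ?thesis by (simp add: prob_space)
qed

lemma continuous_integral_translate:
  fixes f :: "'a::{topological_group_add, second_countable_topology} \<Rightarrow> real"
  assumes "compact (UNIV :: 'a set)" "continuous_on UNIV f" "borel_law N"
  shows "continuous_on UNIV (\<lambda>y. \<integral>x. f (x + y) \<partial>N)"
proof (clarsimp simp: continuous_on_def tendsto_iff)
  fix y0 :: 'a and \<epsilon> :: real assume "\<epsilon> > 0"
  obtain W where W: "open W" "y0 \<in> W" "\<And>y x. y \<in> W \<Longrightarrow> \<bar>f (x + y) - f (x + y0)\<bar> < \<epsilon> / 2"
    using eventually_uniform_translate[OF assms(1,2), of "\<epsilon> / 2" y0] \<open>\<epsilon> > 0\<close> by auto
  have "\<forall>\<^sub>F y in at y0. y \<in> W" using W by (intro topological_tendstoD[OF tendsto_ident_at])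
  then show "\<forall>\<^sub>F y in at y0. dist (\<integral>x. f (x + y) \<partial>N) (\<integral>x. f (x + y0) \<partial>N) < \<epsilon>"
  proof eventually_elim
    fix y assume "y \<in> W"
    have "\<bar>(\<integral>x. f (x + y) \<partial>N) - (\<integral>x. f (x + y0) \<partial>N)\<bar> \<le> \<epsilon> / 2"
      using W(3)[OF \<open>y \<in> W\<close>] by (intro integral_translate_close assms less_imp_le) auto
    then show "dist (\<integral>x. f (x + y) \<partial>N) (\<integral>x. f (x + y0) \<partial>N) < \<epsilon>"
      using \<open>\<epsilon> > 0\<close> by (simp add: dist_real_def)
  qed
qed

text \<open>Weak convergence is applied to finitely many translates of f, and compactness makes
  every other translate uniformly close to one of them; three errors of \<epsilon>/4 result.
  Uniformity in y matters because y will be a random factor that varies with the index i.\<close>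

lemma weakly_tendsto_uniform_translate:
  fixes f :: "'a::{topological_group_add, second_countable_topology} \<Rightarrow> real"
  assumes comp: "compact (UNIV :: 'a set)" and f: "continuous_on UNIV f" and L: "borel_law L"
    and \<nu>: "\<forall>\<^sub>F i in F. borel_law (\<nu> i)" and lim: "weakly_tendsto \<nu> L F" and "\<epsilon> > 0"
  shows "\<forall>\<^sub>F i in F. \<forall>y. \<bar>(\<integral>x. f (x + y) \<partial>\<nu> i) - (\<integral>x. f (x + y) \<partial>L)\<bar> < \<epsilon>"
proof -
  have "\<forall>y0. \<exists>W. open W \<and> y0 \<in> W \<and> (\<forall>y\<in>W. \<forall>x. \<bar>f (x + y) - f (x + y0)\<bar> < \<epsilon> / 4)"
    using eventually_uniform_translate[OF comp f, of "\<epsilon> / 4"] \<open>\<epsilon> > 0\<close> by simp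
  then obtain W where W: "\<And>y. open (W y)" "\<And>y. y \<in> W y"
    "\<And>y0 y x. y \<in> W y0 \<Longrightarrow> \<bar>f (x + y) - f (x + y0)\<bar> < \<epsilon> / 4" by metis
  obtain Y where Y: "finite Y" "UNIV \<subseteq> (\<Union>y\<in>Y. W y)"
    by (rule compactE_image[OF comp, of UNIV W]) (use W in auto)
  have "\<forall>\<^sub>F i in F. \<forall>y\<in>Y. \<bar>(\<integral>x. f (x + y) \<partial>\<nu> i) - (\<integral>x. f (x + y) \<partial>L)\<bar> < \<epsilon> / 4"
  proof (rule eventually_ball_finite[OF Y(1)], rule ballI)
    fix y
    have c: "continuous_on UNIV (\<lambda>x. f (x + y))"
      by (intro continuous_intros continuous_on_compose2[OF f]) auto
    moreover have "bounded (range (\<lambda>x. f (x + y)))"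
      using compact_continuous_image[OF c comp] by (rule compact_imp_bounded)
    ultimately have "((\<lambda>i. \<integral>x. f (x + y) \<partial>\<nu> i) \<longlongrightarrow> (\<integral>x. f (x + y) \<partial>L)) F"
      using lim by (simp add: weakly_tendsto_def)
    then show "\<forall>\<^sub>F i in F. \<bar>(\<integral>x. f (x + y) \<partial>\<nu> i) - (\<integral>x. f (x + y) \<partial>L)\<bar> < \<epsilon> / 4"
      using \<open>\<epsilon> > 0\<close> unfolding dist_real_def[symmetric] by (intro tendstoD) auto
  qed
  with \<nu> show ?thesis
  proof eventually_elim
    case (elim i)
    show ?case
    proof
      fix y
      obtain y0 where y0: "y0 \<in> Y" "y \<in> W y0" using Y(2) by auto
      have "\<bar>(\<integral>x. f (x + y) \<partial>\<nu> i) - (\<integral>x. f (x + y0) \<partial>\<nu> i)\<bar> \<le> \<epsilon> / 4"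
        "\<bar>(\<integral>x. f (x + y) \<partial>L) - (\<integral>x. f (x + y0) \<partial>L)\<bar> \<le> \<epsilon> / 4"
        by (rule integral_translate_close[OF comp f _ less_imp_le[OF W(3)[OF y0(2)]]],
            rule elim(1) L)+
      moreover have "\<bar>(\<integral>x. f (x + y0) \<partial>\<nu> i) - (\<integral>x. f (x + y0) \<partial>L)\<bar> < \<epsilon> / 4"
        using elim(2) y0(1) by blast
      ultimately show "\<bar>(\<integral>x. f (x + y) \<partial>\<nu> i) - (\<integral>x. f (x + y) \<partial>L)\<bar> < \<epsilon>"
        using \<open>\<epsilon> > 0\<close> by linarith
    qed
  qed
qed

section \<open>Convolutions and products of noise variables\<close>

lemma borel_measurable_uminus_group:
  fixes f :: "'b \<Rightarrow> 'a::topological_group_add"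
  assumes "f \<in> borel_measurable N"
  shows "(\<lambda>x. - f x) \<in> borel_measurable N"
proof -
  have "(uminus :: 'a \<Rightarrow> 'a) \<in> borel_measurable borel"
    by (intro borel_measurable_continuous_onI continuous_intros)
  from measurable_compose[OF assms this] show ?thesis .
qed

lemma conv_distr:
  fixes X Y :: "'b \<Rightarrow> 'a::{topological_group_add, second_countable_topology}"
  assumes "prob_space M" and [measurable]: "X \<in> borel_measurable M" "Y \<in> borel_measurable M"
    and ind: "prob_space.indep_set M (sigma_rv M X) (sigma_rv M Y)"
  shows "conv (distr M borel X) (distr M borel Y) = distr M borel (\<lambda>w. X w + Y w)"
proof -
  interpret prob_space M by fact
  have "indep_var borel X borel Y"
    unfolding indep_var_eq using ind
    by (simp add: sigma_rv_def[symmetric] sigma_algebra.sigma_sets_eq[OF sigma_algebra_sigma_rv])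
  then have "distr M borel X \<Otimes>\<^sub>M distr M borel Y = distr M (borel \<Otimes>\<^sub>M borel) (\<lambda>w. (X w, Y w))"
    by (simp add: indep_var_distribution_eq)
  then show ?thesis
    unfolding conv_def by (simp add: distr_distr o_def case_prod_unfold)
qed

lemma (in prob_space) indep_set_const:
  assumes "\<A> \<subseteq> events"
  shows "indep_set \<A> (sigma_rv M (\<lambda>_. c))"
proof (rule indep_setI)
  fix a b assume "a \<in> \<A>" "b \<in> sigma_rv M (\<lambda>_. c)"
  then have "b = {} \<or> b = space M" "a \<inter> space M = a"
    using assms sets.sets_into_space by (auto simp: sigma_rv_def split: if_splits)
  then show "prob (a \<inter> b) = prob a * prob b" by (auto simp: prob_space)
qed (use assms in \<open>auto simp: sigma_rv_subset_sets_iff\<close>)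

lemma conv_return:
  fixes N :: "'a::{topological_group_add, second_countable_topology} measure"
  assumes "borel_law N"
  shows conv_return_right: "conv N (return borel y) = distr N borel (\<lambda>x. x + y)"
    and conv_return_left: "conv (return borel y) N = distr N borel (\<lambda>x. y + x)"
proof -
  interpret prob_space N using assms by (simp add: borel_law_def)
  have [measurable_cong]: "sets N = sets borel" using assms by (simp add: borel_law_def)
  have sub: "sigma_rv N (\<lambda>x. x) \<subseteq> events" by (simp add: sigma_rv_subset_sets_iff)
  have id: "distr N borel (\<lambda>x. x) = N" using \<open>sets N = sets borel\<close> by (intro distr_id2) simp
  have const: "distr N borel (\<lambda>x. y) = return borel y" by (rule distr_const) simp
  show "conv N (return borel y) = distr N borel (\<lambda>x. x + y)"
    using conv_distr[OF prob_space_axioms _ _ indep_set_const[OF sub], of y] by (simp add: id const)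
  show "conv (return borel y) N = distr N borel (\<lambda>x. y + x)"
    using conv_distr[OF prob_space_axioms _ _ indep_set_commute[OF indep_set_const[OF sub]], of y]
    by (simp add: id const)
qed

lemma noise_prod_empty: "k < l \<Longrightarrow> noise_prod \<xi> k l w = 0"
  by (simp add: noise_prod_def)

lemma noise_prod_rec: "l \<le> k \<Longrightarrow> noise_prod \<xi> k l w = \<xi> k w + noise_prod \<xi> (k - 1) l w"
  by (simp add: noise_prod_def upto_rec2)

lemma measurable_noise_prod:
  fixes \<xi> :: "int \<Rightarrow> 'b \<Rightarrow> 'a::{topological_group_add, second_countable_topology}"
  assumes "\<And>i. l \<le> i \<Longrightarrow> i \<le> k \<Longrightarrow> \<xi> i \<in> borel_measurable N"
  shows "noise_prod \<xi> k l \<in> borel_measurable N"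
proof (cases "l - 1 \<le> k")
  case True
  then show ?thesis using assms
  proof (induction k rule: int_ge_induct)
    case base
    have "noise_prod \<xi> (l - 1) l = (\<lambda>w. 0)" by (auto simp: noise_prod_empty)
    then show ?case by simp
  next
    case (step k)
    have "noise_prod \<xi> (k + 1) l = (\<lambda>w. \<xi> (k + 1) w + noise_prod \<xi> k l w)"
      using step.hyps noise_prod_rec[of l "k + 1" \<xi>] by auto
    moreover have "\<xi> (k + 1) \<in> borel_measurable N" "noise_prod \<xi> k l \<in> borel_measurable N"
      using step by auto
    ultimately show ?case by simp
  qed
next
  case False
  then have "noise_prod \<xi> k l = (\<lambda>w. 0)" by (auto simp: noise_prod_empty)
  then show ?thesis by simp
qed

lemma conv_prod_empty: "k < l \<Longrightarrow> conv_prod \<mu> k l N = N"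
  by (simp add: conv_prod_def)

lemma conv_prod_rec: "l \<le> k \<Longrightarrow> conv_prod \<mu> k l N = conv (\<mu> k) (conv_prod \<mu> (k - 1) l N)"
  by (simp add: conv_prod_def upto_rec2)

section \<open>Solutions\<close>

lemma coset_plus_cong: "g +o H = g' +o H \<Longrightarrow> (a + g) +o H = (a + g') +o H"
  for g :: "'a::semigroup_add"
  by (metis set_plus_rearrange2)

locale noise_solution = coset_embedded H e + prob_space M
  for H :: "'a::{topological_group_add, t2_space, second_countable_topology} set"
    and e :: "'a \<Rightarrow> nat \<Rightarrow> real" and M :: "'b measure" +
  fixes \<mu> \<Lambda> :: "int \<Rightarrow> 'a measure" and \<alpha> :: "int \<Rightarrow> 'a" and \<omega> :: "'a measure"
    and s :: "'a set \<Rightarrow> 'a" and \<eta> \<xi> :: "int \<Rightarrow> 'b \<Rightarrow> 'a"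
  assumes law_\<Lambda>: "\<And>k. k \<le> 0 \<Longrightarrow> borel_law (\<Lambda> k)"
    and haar: "normalized_haar H \<omega>"
    and I1: "cond_I1 \<mu> \<Lambda> \<alpha>" and I2: "cond_I2 \<Lambda> \<alpha> \<omega>" and I3: "cond_I3 \<Lambda> H" and I4: "cond_I4 \<mu> \<alpha> H"
    and section_s: "measurable_section H s"
    and solution: "is_solution \<mu> M \<eta> \<xi>"
begin

abbreviation "sec g \<equiv> s (g +o H)"
abbreviation "\<phi> \<equiv> phi s H \<alpha> \<xi>"
abbreviation "V \<equiv> V_rv s H \<alpha> \<eta> \<xi>"
abbreviation "U \<equiv> U_rv s H \<alpha> \<eta> \<xi>"

definition \<zeta> :: "int \<Rightarrow> 'b \<Rightarrow> 'a" where "\<zeta> k w = \<eta> k w + - V w"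

definition F :: "int \<Rightarrow> 'b set set" where "F k = augment M (past M \<eta> k)"

text \<open>The augmentation is taken before the intersection: V, known at each time only up to a
  null set, then belongs to T at once.\<close>

definition T :: "'b set set" where "T = (\<Inter>k\<in>{..0}. F k)"

section \<open>The section and its part in H\<close>

lemma coset_absorb: "h \<in> H \<Longrightarrow> (g + h) +o H = g +o H"
  by (metis coset_eq_iff[OF subgroup] add.assoc add.left_inverse add_0)

lemma diff_sec: "- sec g + g \<in> H" and coset_sec: "sec g +o H = g +o H"
proof -
  have "sec g \<in> g +o H" using section_s by (simp add: measurable_section_def)
  then obtain h where h: "h \<in> H" "sec g = g + h" by (auto simp: elt_set_plus_def)
  then show "sec g +o H = g +o H" by (simp add: coset_absorb)
  then show "- sec g + g \<in> H" by (simp add: coset_eq_iff[OF subgroup])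
qed

lemma sec_add: "h \<in> H \<Longrightarrow> sec (g + h) = sec g"
  by (simp add: coset_absorb)

lemma sec_measurable[measurable]: "(\<lambda>g. sec g) \<in> borel_measurable borel"
  by (rule measurable_section_coset[OF section_s])

lemma uminus_measurable[measurable]: "(uminus :: 'a \<Rightarrow> 'a) \<in> borel_measurable borel"
  by (intro borel_measurable_continuous_onI continuous_intros)

lemma \<eta>_measurable: "k \<le> 0 \<Longrightarrow> \<eta> k \<in> borel_measurable M"
  and \<xi>_measurable: "k \<le> 0 \<Longrightarrow> \<xi> k \<in> borel_measurable M"
  and \<eta>_step: "k \<le> 0 \<Longrightarrow> AE w in M. \<eta> k w = \<xi> k w + \<eta> (k - 1) w"
  and distr_\<xi>: "k \<le> 0 \<Longrightarrow> distr M borel (\<xi> k) = \<mu> k"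
  using solution by (auto simp: is_solution_def)

section \<open>The augmented pasts and the noise\<close>

lemma past_\<eta>_events: "k \<le> 0 \<Longrightarrow> past M \<eta> k \<subseteq> events"
  by (intro past_subset_sets \<eta>_measurable) auto

lemma past_\<xi>_events: "k \<le> 0 \<Longrightarrow> past M \<xi> k \<subseteq> events"
  by (intro past_subset_sets \<xi>_measurable) auto

lemma sigma_algebra_F: "sigma_algebra (space M) (F k)"
  unfolding F_def by (intro sigma_algebra_augment sigma_algebra_past)

lemma F_events: "F k \<subseteq> events"
  unfolding F_def by (rule augment_subset_sets)

lemma F_mono: "j \<le> k \<Longrightarrow> F j \<subseteq> F k"
  unfolding F_def by (intro augment_mono past_mono)

lemma augment_F: "augment M (F k) \<subseteq> F k"
  unfolding F_def by (rule augment_augment)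

lemma past_\<eta>_F: "k \<le> 0 \<Longrightarrow> past M \<eta> k \<subseteq> F k"
  unfolding F_def by (intro subset_augment past_\<eta>_events)

lemma \<eta>_F: "j \<le> k \<Longrightarrow> k \<le> 0 \<Longrightarrow> sigma_rv M (\<eta> j) \<subseteq> F k"
  using sigma_rv_subset_past[of j k M \<eta>] past_\<eta>_F by blast

text \<open>The noise is the increment of \<open>\<eta>\<close>, but only almost surely, so it is
  adapted to the augmented pasts.\<close>

lemma \<xi>_F: assumes "j \<le> k" "k \<le> 0" shows "sigma_rv M (\<xi> j) \<subseteq> F k"
proof -
  have "sigma_rv M (\<lambda>w. \<eta> j w + - \<eta> (j - 1) w) \<subseteq> F j"
  proof -
    have [measurable]: "\<eta> j \<in> borel_measurable (sigma (space M) (F j))"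
      "\<eta> (j - 1) \<in> borel_measurable (sigma (space M) (F j))"
      using \<eta>_F[of j j] \<eta>_F[of "j - 1" j] assms by (auto simp: sigma_rv_subset_iff[OF sigma_algebra_F])
    show ?thesis unfolding sigma_rv_subset_iff[OF sigma_algebra_F] by measurable
  qed
  moreover have "AE w in M. \<xi> j w = \<eta> j w + - \<eta> (j - 1) w"
    using \<eta>_step[of j] assms by (auto simp: add.assoc elim!: eventually_mono)
  ultimately have "sigma_rv M (\<xi> j) \<subseteq> augment M (F j)"
    using assms by (intro sigma_rv_subset_augment \<xi>_measurable) auto
  then show ?thesis using augment_F[of j] F_mono[OF assms(1)] by blast
qed

lemma indep_F_\<xi>: assumes "k \<le> 0" shows "indep_set (F (k - 1)) (sigma_rv M (\<xi> k))"
proof -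
  have "indep_set (past M \<eta> (k - 1)) (sigma_rv M (\<xi> k))"
    using solution assms unfolding is_solution_def by (blast intro: indep_set_commute)
  from indep_set_augment[OF this]
  have "indep_set (F (k - 1)) (augment M (sigma_rv M (\<xi> k)))" by (simp only: F_def)
  moreover have "sigma_rv M (\<xi> k) \<subseteq> augment M (sigma_rv M (\<xi> k))"
    using \<xi>_measurable[OF assms] by (intro subset_augment) (simp add: sigma_rv_subset_sets_iff)
  ultimately show ?thesis by (rule indep_set_mono[OF _ order_refl])
qed

text \<open>The noise variables after time j are joined one at a time: the next one is independent
  of the whole of \<open>F m\<close>, which contains \<open>\<A>\<close> and all that has been
  joined so far.\<close>

lemma indep_join_\<xi>:
  assumes sa: "sigma_algebra (space M) \<A>" "sigma_algebra (space M) \<B>"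
    and sub: "\<A> \<subseteq> F j" "\<B> \<subseteq> F j" and ind: "indep_set \<A> \<B>" and "j \<le> m" "m \<le> 0"
  shows "indep_set \<A> (sigma_sets (space M) (\<B> \<union> (\<Union>i\<in>{j<..m}. sigma_rv M (\<xi> i))))"
  using assms(6,7)
proof (induction m rule: int_ge_induct)
  case base
  then show ?case using ind sa by (simp add: sigma_algebra.sigma_sets_eq)
next
  case (step m)
  let ?S = "sigma_sets (space M) (\<B> \<union> (\<Union>i\<in>{j<..m}. sigma_rv M (\<xi> i)))"
  have Pow: "\<B> \<union> (\<Union>i\<in>{j<..m}. sigma_rv M (\<xi> i)) \<subseteq> Pow (space M)"
    using sa(2) sigma_rv_subset_Pow by (fastforce simp: sigma_algebra_iff2)
  have SF: "?S \<subseteq> F m"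
  proof (intro sigma_algebra.sigma_sets_subset[OF sigma_algebra_F] Un_least UN_least)
    show "\<B> \<subseteq> F m" using sub(2) F_mono[OF step.hyps] by blast
    show "sigma_rv M (\<xi> i) \<subseteq> F m" if "i \<in> {j<..m}" for i
      using that step.prems by (intro \<xi>_F) auto
  qed
  have "indep_set \<A> (sigma_sets (space M) (?S \<union> sigma_rv M (\<xi> (m + 1))))"
  proof (rule indep_set_join)
    show "indep_set \<A> ?S" using step by simp
    show "indep_set (F m) (sigma_rv M (\<xi> (m + 1)))" using indep_F_\<xi>[of "m + 1"] step.prems by simp
    show "A \<inter> B \<in> F m" if "A \<in> \<A>" "B \<in> ?S" for A B
    proof -
      interpret sigma_algebra "space M" "F m" by (rule sigma_algebra_F)
      show ?thesis using that SF sub(1) F_mono[OF step.hyps] by blast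
    qed
  qed (use sa Pow in \<open>auto intro: sigma_algebra_sigma_sets sigma_algebra_sigma_rv\<close>)
  then show ?case
  proof (rule indep_set_mono)
    have "{j<..m + 1} = insert (m + 1) {j<..m}" using step.hyps by auto
    then show "sigma_sets (space M) (\<B> \<union> (\<Union>i\<in>{j<..m + 1}. sigma_rv M (\<xi> i)))
        \<subseteq> sigma_sets (space M) (?S \<union> sigma_rv M (\<xi> (m + 1)))"
      by (intro sigma_sets_mono') auto
  qed simp
qed

text \<open>The event with the largest index splits off, since all the others belong to the past
  just before it. So the one-step independence of a solution makes the noise variables mutually
  independent, as (I4) demands.\<close>

lemma prob_INT_\<xi>:
  assumes "finite J" "J \<noteq> {}" "J \<subseteq> {..0}" "\<And>j. j \<in> J \<Longrightarrow> S j \<in> sigma_rv M (\<xi> j)"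
  shows "prob (\<Inter>j\<in>J. S j) = (\<Prod>j\<in>J. prob (S j))"
  using assms
proof (induction J rule: finite_linorder_max_induct)
  case empty then show ?case by simp
next
  case (insert b A)
  show ?case
  proof (cases "A = {}")
    case True then show ?thesis by simp
  next
    case False
    interpret Fb: sigma_algebra "space M" "F (b - 1)" by (rule sigma_algebra_F)
    have "S a \<in> F (b - 1)" if "a \<in> A" for a
      using insert.prems insert.hyps that \<xi>_F[of a "b - 1"] by force
    then have "(\<Inter>j\<in>A. S j) \<in> F (b - 1)"
      using False insert.hyps(1) by (intro Fb.finite_INT) auto
    then have "prob ((\<Inter>j\<in>A. S j) \<inter> S b) = prob (\<Inter>j\<in>A. S j) * prob (S b)"
      using indep_F_\<xi>[of b] insert.prems by (intro indep_setD) auto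
    moreover have "prob (\<Inter>j\<in>A. S j) = (\<Prod>j\<in>A. prob (S j))"
      using insert False by auto
    moreover have "b \<notin> A" using insert.hyps(2) by auto
    ultimately show ?thesis using insert.hyps(1) by (simp add: Int_commute mult.commute)
  qed
qed

section \<open>Convergence of cosets: the variables \<open>\<phi> k\<close> and V\<close>

lemma phi_cosets_eq: "phi_cosets H \<alpha> \<xi> k w = (\<lambda>l. (noise_prod \<xi> k l w + \<alpha> l) +o H)"
  by (auto simp: phi_cosets_def)

text \<open>Condition (I4) is transported from the coordinates under the joint law of \<open>\<xi>\<close>.\<close>

lemma phi_cosets_converge:
  assumes "k \<le> 0"
  shows "AE w in M. \<exists>c. limitin (coset_space H) (phi_cosets H \<alpha> \<xi> k w) c at_bot"
proof -
  \<comment> \<open>Positive indices carry no noise; the constant 0 there keeps g measurable and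
    never enters a product up to time k.\<close>
  define g where "g w = (\<lambda>i. if i \<le> 0 then \<xi> i w else 0)" for w
  define P where "P = distr M (Pi\<^sub>M UNIV (\<lambda>_. borel)) g"
  have g[measurable]: "g \<in> measurable M (Pi\<^sub>M UNIV (\<lambda>_. borel))"
  proof (rule measurable_PiM_single')
    show "(\<lambda>w. g w i) \<in> borel_measurable M" for i
      using \<xi>_measurable[of i] by (cases "i \<le> 0") (auto simp: g_def)
  qed (auto simp: space_PiM)
  interpret P: prob_space P unfolding P_def by (rule prob_space_distr) (rule g)
  have coord[measurable]: "(\<lambda>x. x i) \<in> borel_measurable P" for i :: int
    unfolding P_def by measurable
  have spP: "space P = UNIV" by (simp add: P_def space_PiM)
  have gS: "g -` ((\<lambda>x. x i) -` B) \<inter> space M = \<xi> i -` B \<inter> space M" if "i \<le> 0" for i and B :: "'a set"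
    using that by (auto simp: g_def)
  have law: "distr P borel (\<lambda>x. x i) = \<mu> i" if "i \<le> 0" for i
  proof -
    have "distr P borel (\<lambda>x. x i) = distr M borel (\<lambda>w. g w i)"
      unfolding P_def by (subst distr_distr) (auto simp: o_def)
    also have "(\<lambda>w. g w i) = \<xi> i" using that by (auto simp: g_def)
    finally show ?thesis using distr_\<xi>[OF that] by simp
  qed
  have "P.indep_vars (\<lambda>_. borel) (\<lambda>i x. x i) {..0}"
    unfolding P.indep_vars_def2
  proof (intro conjI ballI coord P.indep_setsI)
    show "{(\<lambda>x. x i) -` A \<inter> space P |A. A \<in> sets borel} \<subseteq> P.events" for i
      using measurable_sets[OF coord] by auto
    fix A :: "int \<Rightarrow> (int \<Rightarrow> 'a) set" and J
    assume J: "J \<noteq> {}" "J \<subseteq> {..0}" "finite J"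
      and A: "\<forall>j\<in>J. A j \<in> {(\<lambda>x. x j) -` A \<inter> space P |A. A \<in> sets borel}"
    then have "\<forall>j\<in>J. \<exists>B. B \<in> sets borel \<and> A j = (\<lambda>x. x j) -` B" by (simp add: spP) metis
    then obtain B where B: "\<And>j. j \<in> J \<Longrightarrow> B j \<in> sets borel" "\<And>j. j \<in> J \<Longrightarrow> A j = (\<lambda>x. x j) -` B j"
      by metis
    have ev: "A j \<in> P.events" if "j \<in> J" for j
      using measurable_sets[OF coord B(1)[OF that]] B(2)[OF that] by (simp add: spP)
    have PM: "measure P S = prob (g -` S \<inter> space M)" if "S \<in> P.events" for S
      using that unfolding P_def by (intro measure_distr) auto
    have A': "g -` A j \<inter> space M = \<xi> j -` B j \<inter> space M" if "j \<in> J" for j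
      using that J B gS by (auto simp: subset_iff)
    have "measure P (\<Inter>j\<in>J. A j) = prob (g -` (\<Inter>j\<in>J. A j) \<inter> space M)"
      using J ev by (intro PM sets.finite_INT) auto
    also have "g -` (\<Inter>j\<in>J. A j) \<inter> space M = (\<Inter>j\<in>J. \<xi> j -` B j \<inter> space M)"
      using A' J(1) by blast
    also have "prob \<dots> = (\<Prod>j\<in>J. prob (\<xi> j -` B j \<inter> space M))"
      using J B(1) by (intro prob_INT_\<xi>) (auto simp: sigma_rv_def)
    also have "\<dots> = (\<Prod>j\<in>J. measure P (A j))"
      using A' ev PM by (intro prod.cong) auto
    finally show "measure P (\<Inter>j\<in>J. A j) = (\<Prod>j\<in>J. measure P (A j))" .
  qed
  then have "AE x in P. \<exists>c. limitin (coset_space H) (phi_cosets H \<alpha> (\<lambda>i x. x i) k x) c at_bot"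
    using I4 law assms P.prob_space_axioms unfolding cond_I4_def by blast
  then have "AE w in M. \<exists>c. limitin (coset_space H) (phi_cosets H \<alpha> (\<lambda>i x. x i) k (g w)) c at_bot"
    unfolding P_def by (rule AE_distrD[OF g])
  moreover have "phi_cosets H \<alpha> (\<lambda>i x. x i) k (g w) = phi_cosets H \<alpha> \<xi> k w" for w
  proof
    have "(\<Sum>j\<leftarrow>rev [l..k]. g w j) = (\<Sum>j\<leftarrow>rev [l..k]. \<xi> j w)" for l
      using assms by (intro arg_cong[where f=sum_list] map_cong) (auto simp: g_def)
    then show "phi_cosets H \<alpha> (\<lambda>i x. x i) k (g w) l = phi_cosets H \<alpha> \<xi> k w l" for l
      by (simp only: phi_cosets_def noise_prod_def)
  qed
  ultimately show ?thesis by simp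
qed

lemma phi_eq_sec:
  assumes "k \<le> 0"
  shows "AE w in M. \<exists>g. limitin (coset_space H) (phi_cosets H \<alpha> \<xi> k w) (g +o H) at_bot \<and> \<phi> k w = sec g"
  using phi_cosets_converge[OF assms]
proof eventually_elim
  fix w assume "\<exists>c. limitin (coset_space H) (phi_cosets H \<alpha> \<xi> k w) c at_bot"
  then obtain c where c: "limitin (coset_space H) (phi_cosets H \<alpha> \<xi> k w) c at_bot" by blast
  then obtain g where g: "c = g +o H" by (rule limitin_topspaceE)
  have "\<phi> k w = sec g"
    using coset_lim_eqI[OF c[unfolded phi_cosets_eq]] g unfolding phi_def phi_cosets_eq by simp
  then show "\<exists>g. limitin (coset_space H) (phi_cosets H \<alpha> \<xi> k w) (g +o H) at_bot \<and> \<phi> k w = sec g"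
    using c g by blast
qed

lemma sec_phi: "k \<le> 0 \<Longrightarrow> AE w in M. sec (\<phi> k w) = \<phi> k w"
  by (drule phi_eq_sec) (auto simp: coset_sec elim!: eventually_mono)

lemma phi_limit:
  assumes "k \<le> 0"
  shows "AE w in M. ((\<lambda>l. e (noise_prod \<xi> k l w + \<alpha> l)) \<longlongrightarrow> e (\<phi> k w)) at_bot"
  using phi_eq_sec[OF assms]
proof eventually_elim
  fix w assume "\<exists>g. limitin (coset_space H) (phi_cosets H \<alpha> \<xi> k w) (g +o H) at_bot \<and> \<phi> k w = sec g"
  then obtain g where g: "limitin (coset_space H) (\<lambda>l. (noise_prod \<xi> k l w + \<alpha> l) +o H) (g +o H) at_bot"
    "\<phi> k w = sec g"
    by (auto simp: phi_cosets_eq)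
  then have "e (\<phi> k w) = e g" by (simp add: e_eq_iff coset_sec)
  then show "((\<lambda>l. e (noise_prod \<xi> k l w + \<alpha> l)) \<longlongrightarrow> e (\<phi> k w)) at_bot"
    using g(1) by (simp add: limitin_coset_iff)
qed

text \<open>Left multiplication by \<open>\<xi> k\<close> acts continuously on \<open>G/H\<close>
  and turns the partial products that start at \<open>k - 1\<close> into those that start at k;
  limits in \<open>G/H\<close> are unique.\<close>

lemma phi_step:
  assumes "k \<le> 0"
  shows "AE w in M. \<phi> k w +o H = (\<xi> k w + \<phi> (k - 1) w) +o H"
proof -
  have "AE w in M. ((\<lambda>l. e (noise_prod \<xi> (k - 1) l w + \<alpha> l)) \<longlongrightarrow> e (\<phi> (k - 1) w)) at_bot"
    using assms by (intro phi_limit) simp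
  with phi_limit[OF assms] show ?thesis
  proof eventually_elim
    fix w
    assume 1: "((\<lambda>l. e (noise_prod \<xi> k l w + \<alpha> l)) \<longlongrightarrow> e (\<phi> k w)) at_bot"
      and 2: "((\<lambda>l. e (noise_prod \<xi> (k - 1) l w + \<alpha> l)) \<longlongrightarrow> e (\<phi> (k - 1) w)) at_bot"
    have "((\<lambda>l. e (\<xi> k w + (noise_prod \<xi> (k - 1) l w + \<alpha> l))) \<longlongrightarrow> e (\<xi> k w + \<phi> (k - 1) w)) at_bot"
    proof (rule tendsto_invariant[OF _ _ 2])
      show "continuous_on UNIV (\<lambda>x. e (\<xi> k w + x))"
        by (intro continuous_on_compose2[OF cont_e] continuous_intros) auto
      show "e (\<xi> k w + (x + h)) = e (\<xi> k w + x)" if "h \<in> H" for x h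
        using coset_absorb[OF that] by (simp add: e_eq_iff add.assoc[symmetric])
    qed
    moreover have "\<forall>\<^sub>F l in at_bot. e (noise_prod \<xi> k l w + \<alpha> l) = e (\<xi> k w + (noise_prod \<xi> (k - 1) l w + \<alpha> l))"
      by (rule eventually_mono[OF eventually_le_at_bot[of k]]) (simp add: noise_prod_rec[of _ k] add.assoc)
    ultimately have "((\<lambda>l. e (noise_prod \<xi> k l w + \<alpha> l)) \<longlongrightarrow> e (\<xi> k w + \<phi> (k - 1) w)) at_bot"
      by (simp add: tendsto_cong)
    with 1 have "e (\<phi> k w) = e (\<xi> k w + \<phi> (k - 1) w)"
      by (intro tendsto_unique[OF trivial_limit_at_bot_linorder])
    then show "\<phi> k w +o H = (\<xi> k w + \<phi> (k - 1) w) +o H" by (simp add: e_eq_iff)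
  qed
qed

text \<open>No augmentation occurs: the limit of cosets with its default value is measurable
  everywhere.\<close>

lemma phi_past: assumes "k \<le> 0" shows "sigma_rv M (\<phi> k) \<subseteq> past M \<xi> k"
proof -
  let ?N = "sigma (space M) (past M \<xi> k)"
  have "noise_prod \<xi> k l \<in> borel_measurable ?N" for l
    using sigma_rv_subset_past[of _ k M \<xi>]
    by (intro measurable_noise_prod) (simp add: sigma_rv_subset_iff[OF sigma_algebra_past, symmetric])
  then have "(\<lambda>w. s (coset_lim H (\<lambda>l. (noise_prod \<xi> k l w + \<alpha> l) +o H))) \<in> borel_measurable ?N"
    by (intro measurable_section_coset_lim[OF section_s]) auto
  then show ?thesis
    unfolding sigma_rv_subset_iff[OF sigma_algebra_past] phi_def phi_cosets_eq .
qed

lemma past_\<xi>_F: "k \<le> 0 \<Longrightarrow> past M \<xi> k \<subseteq> F k"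
  by (intro past_subset sigma_algebra_F \<xi>_F)

lemma phi_F: "k \<le> 0 \<Longrightarrow> sigma_rv M (\<phi> k) \<subseteq> F k"
  using phi_past past_\<xi>_F by blast

lemma phi_measurable: "k \<le> 0 \<Longrightarrow> \<phi> k \<in> borel_measurable M"
  using phi_F F_events sigma_rv_subset_sets_iff by blast

lemma V_measurable: "V \<in> borel_measurable M"
proof -
  have "(\<lambda>w. - \<eta> l w + \<phi> l w) \<in> borel_measurable M" if "l \<le> 0" for l
    using \<eta>_measurable[OF that] phi_measurable[OF that] by (auto intro: borel_measurable_uminus_group)
  then have "(\<lambda>w. s (coset_lim H (\<lambda>l. (- \<eta> l w + \<phi> l w) +o H))) \<in> borel_measurable M"
    by (intro measurable_section_coset_lim[OF section_s])
  then have "(\<lambda>w. - s (coset_lim H (\<lambda>l. (- \<eta> l w + \<phi> l w) +o H))) \<in> borel_measurable M"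
    by (rule borel_measurable_uminus_group)
  then show ?thesis by (simp only: V_rv_def[abs_def] V_cosets_def[abs_def])
qed

lemma V_cosets_const:
  "AE w in M. \<forall>l\<le>0. V_cosets s H \<alpha> \<eta> \<xi> w l = (- \<eta> 0 w + \<phi> 0 w) +o H"
proof -
  \<comment> \<open>There are countably many times, so one null set serves them all and the
    induction can run for a fixed w.\<close>
  have "AE w in M. \<forall>k\<in>{..0::int}. \<eta> k w = \<xi> k w + \<eta> (k - 1) w"
    by (subst AE_ball_countable) (auto intro: \<eta>_step)
  moreover have "AE w in M. \<forall>k\<in>{..0::int}. \<phi> k w +o H = (\<xi> k w + \<phi> (k - 1) w) +o H"
    by (subst AE_ball_countable) (auto intro: phi_step)
  ultimately show ?thesis
  proof eventually_elim
    fix w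
    assume \<eta>: "\<forall>k\<in>{..0}. \<eta> k w = \<xi> k w + \<eta> (k - 1) w"
      and \<phi>: "\<forall>k\<in>{..0}. \<phi> k w +o H = (\<xi> k w + \<phi> (k - 1) w) +o H"
    have step_coset: "(- \<eta> k w + \<phi> k w) +o H = (- \<eta> (k - 1) w + \<phi> (k - 1) w) +o H" if "k \<le> 0" for k
    proof -
      have "(- \<eta> k w + \<phi> k w) +o H = (- \<eta> k w + (\<xi> k w + \<phi> (k - 1) w)) +o H"
        using \<phi> that by (intro coset_plus_cong) auto
      also have "- \<eta> k w + (\<xi> k w + \<phi> (k - 1) w) = - \<eta> (k - 1) w + \<phi> (k - 1) w"
        using bspec[OF \<eta>, of k] that by (simp only: atMost_iff minus_add add.assoc minus_add_cancel)
      finally show ?thesis .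
    qed
    have "(- \<eta> l w + \<phi> l w) +o H = (- \<eta> 0 w + \<phi> 0 w) +o H" if "l \<le> 0" for l
      using that
    proof (induction l rule: int_le_induct)
      case (step i) then show ?case using step_coset[of i] by simp
    qed simp
    then show "\<forall>l\<le>0. V_cosets s H \<alpha> \<eta> \<xi> w l = (- \<eta> 0 w + \<phi> 0 w) +o H"
      unfolding V_cosets_def by blast
  qed
qed

lemma V_limit:
  "AE w in M. limitin (coset_space H) (V_cosets s H \<alpha> \<eta> \<xi> w) ((- \<eta> 0 w + \<phi> 0 w) +o H) at_bot"
  using V_cosets_const
proof eventually_elim
  fix w assume *: "\<forall>l\<le>0. V_cosets s H \<alpha> \<eta> \<xi> w l = (- \<eta> 0 w + \<phi> 0 w) +o H"
  have "\<forall>\<^sub>F l in at_bot. V_cosets s H \<alpha> \<eta> \<xi> w l \<in> C" if "(- \<eta> 0 w + \<phi> 0 w) +o H \<in> C" for C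
    using * that by (auto simp: eventually_at_bot_linorder intro!: exI[of _ 0])
  then show "limitin (coset_space H) (V_cosets s H \<alpha> \<eta> \<xi> w) ((- \<eta> 0 w + \<phi> 0 w) +o H) at_bot"
    by (auto simp: limitin_def topspace_coset_space)
qed

text \<open>The coset family is constant, so V can be read off at any single time l. This is what
  places V in every \<open>F l\<close>.\<close>

lemma V_eq: assumes "l \<le> 0" shows "AE w in M. V w = - sec (- \<eta> l w + \<phi> l w)"
  using V_limit V_cosets_const
proof eventually_elim
  case (elim w)
  have "V_cosets s H \<alpha> \<eta> \<xi> w = (\<lambda>l. (- \<eta> l w + \<phi> l w) +o H)" by (auto simp: V_cosets_def)
  then have "coset_lim H (V_cosets s H \<alpha> \<eta> \<xi> w) = (- \<eta> 0 w + \<phi> 0 w) +o H"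
    using elim(1) coset_lim_eqI by simp
  also have "\<dots> = (- \<eta> l w + \<phi> l w) +o H"
    using elim(2)[rule_format, OF assms] by (simp only: V_cosets_def)
  finally show ?case by (simp add: V_rv_def)
qed

section \<open>The remote past and the process \<open>\<zeta>\<close>\<close>

lemma T_sigma_algebra: "sigma_algebra (space M) T"
proof -
  have *: "F k \<subseteq> Pow (space M)" "{} \<in> F k" "\<forall>A\<in>F k. space M - A \<in> F k"
    "\<forall>A. range A \<subseteq> F k \<longrightarrow> (\<Union>i::nat. A i) \<in> F k" for k
    using sigma_algebra_F[of k] by (auto simp: sigma_algebra_iff2)
  show ?thesis
    unfolding sigma_algebra_iff2
  proof (intro conjI ballI allI impI)
    show "T \<subseteq> Pow (space M)" using *(1)[of 0] by (auto simp: T_def)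
    show "{} \<in> T" using *(2) by (simp add: T_def)
    show "space M - A \<in> T" if "A \<in> T" for A using *(3) that by (auto simp: T_def)
    show "\<Union> (range A) \<in> T" if "range A \<subseteq> T" for A :: "nat \<Rightarrow> 'b set"
      using *(4) that unfolding T_def by (simp add: le_INF_iff)
  qed
qed

lemma T_F: "k \<le> 0 \<Longrightarrow> T \<subseteq> F k" by (auto simp: T_def)

lemma T_events: "T \<subseteq> events" using T_F[of 0] F_events by blast

lemma V_T: "sigma_rv M V \<subseteq> T"
proof -
  have "sigma_rv M V \<subseteq> F l" if "l \<le> 0" for l
  proof -
    have [measurable]: "\<eta> l \<in> borel_measurable (sigma (space M) (F l))"
      "\<phi> l \<in> borel_measurable (sigma (space M) (F l))"
      using \<eta>_F[of l l] phi_F[of l] that by (auto simp: sigma_rv_subset_iff[OF sigma_algebra_F])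
    have "sigma_rv M (\<lambda>w. - sec (- \<eta> l w + \<phi> l w)) \<subseteq> F l"
      unfolding sigma_rv_subset_iff[OF sigma_algebra_F] by measurable
    from sigma_rv_subset_augment[OF V_measurable V_eq[OF that] this] show ?thesis
      using augment_F by blast
  qed
  then show ?thesis by (auto simp: T_def)
qed

lemma \<zeta>_F: assumes "j \<le> k" "k \<le> 0" shows "sigma_rv M (\<zeta> j) \<subseteq> F k"
proof -
  have [measurable]: "\<eta> j \<in> borel_measurable (sigma (space M) (F k))"
    "V \<in> borel_measurable (sigma (space M) (F k))"
    using \<eta>_F[OF assms] V_T T_F[OF assms(2)] by (auto simp: sigma_rv_subset_iff[OF sigma_algebra_F, symmetric])
  show ?thesis unfolding sigma_rv_subset_iff[OF sigma_algebra_F] \<zeta>_def by measurable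
qed

lemma \<zeta>_measurable: "k \<le> 0 \<Longrightarrow> \<zeta> k \<in> borel_measurable M"
  using \<zeta>_F[of k k] F_events sigma_rv_subset_sets_iff by blast

lemma U_eq: "U k w = - sec (\<zeta> k w) + \<zeta> k w"
  by (simp add: U_rv_def h_part_def \<zeta>_def)

lemma U_F: assumes "k \<le> 0" shows "sigma_rv M (U k) \<subseteq> F k"
proof -
  have [measurable]: "\<zeta> k \<in> borel_measurable (sigma (space M) (F k))"
    using \<zeta>_F[of k k] assms by (simp add: sigma_rv_subset_iff[OF sigma_algebra_F])
  show ?thesis unfolding sigma_rv_subset_iff[OF sigma_algebra_F] U_eq by measurable
qed

lemma U_measurable: "k \<le> 0 \<Longrightarrow> U k \<in> borel_measurable M"
  using U_F[of k] F_events sigma_rv_subset_sets_iff by blast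

lemma U_H: "U k w \<in> H"
  unfolding U_eq by (rule diff_sec)

text \<open>\<open>- V w\<close> represents the coset of \<open>- \<eta> k w + \<phi> k w\<close>;
  adding \<open>\<eta> k w\<close> on the left gives the coset of \<open>\<phi> k w\<close>. The
  section returns \<open>\<phi> k w\<close> itself because that is one of its values.\<close>

lemma sec_\<zeta>: assumes "k \<le> 0" shows "AE w in M. sec (\<zeta> k w) = \<phi> k w"
  using V_eq[OF assms] sec_phi[OF assms]
proof eventually_elim
  case (elim w)
  have "- (- \<eta> k w + \<phi> k w) + sec (- \<eta> k w + \<phi> k w) \<in> H"
    using coset_eq_iff[OF subgroup] coset_sec by metis
  then have "- (- \<eta> k w + \<phi> k w) + - V w \<in> H" by (simp only: elim(1) minus_minus)
  then have "- \<phi> k w + \<zeta> k w \<in> H" by (simp only: \<zeta>_def minus_add add.assoc minus_minus)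
  then have "\<zeta> k w +o H = \<phi> k w +o H" using coset_eq_iff[OF subgroup] by blast
  with elim(2) show ?case by simp
qed

lemma \<zeta>_eq: assumes "k \<le> 0" shows "AE w in M. \<zeta> k w = \<phi> k w + U k w"
  using sec_\<zeta>[OF assms] by eventually_elim (simp add: U_eq add.assoc[symmetric])

lemma \<eta>_eq: assumes "k \<le> 0" shows "AE w in M. \<eta> k w = \<phi> k w + U k w + V w"
  using \<zeta>_eq[OF assms]
proof eventually_elim
  case (elim w)
  then have "\<phi> k w + U k w + V w = \<zeta> k w + V w" by simp
  then show ?case by (simp add: \<zeta>_def add.assoc)
qed

lemma \<eta>_noise:
  assumes "j \<le> k" "k \<le> 0" shows "AE w in M. \<eta> k w = noise_prod \<xi> k (j + 1) w + \<eta> j w"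
  using assms
proof (induction k rule: int_ge_induct)
  case base then show ?case by (simp add: noise_prod_empty)
next
  case (step k)
  then have "AE w in M. \<eta> k w = noise_prod \<xi> k (j + 1) w + \<eta> j w" by simp
  moreover have "AE w in M. \<eta> (k + 1) w = \<xi> (k + 1) w + \<eta> k w"
    using \<eta>_step[of "k + 1"] step.prems by simp
  ultimately show ?case
  proof eventually_elim
    case (elim w)
    then show ?case
      using step.hyps noise_prod_rec[of "j + 1" "k + 1" \<xi> w] by (simp add: add.assoc)
  qed
qed

lemma \<zeta>_noise:
  assumes "j \<le> k" "k \<le> 0" shows "AE w in M. \<zeta> k w = noise_prod \<xi> k (j + 1) w + \<zeta> j w"
  using \<eta>_noise[OF assms] by eventually_elim (simp only: \<zeta>_def add.assoc)

section \<open>Limit laws of the partial products\<close>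

lemma partial_measurable:
  assumes "k \<le> 0" shows "(\<lambda>w. noise_prod \<xi> k l w + \<alpha> l) \<in> borel_measurable M"
proof -
  have [measurable]: "noise_prod \<xi> k l \<in> borel_measurable M"
    using assms by (intro measurable_noise_prod \<xi>_measurable) auto
  show ?thesis by measurable
qed

lemma partial_F:
  assumes "k \<le> 0" shows "sigma_rv M (\<lambda>w. noise_prod \<xi> k l w + \<alpha> l) \<subseteq> F k"
proof -
  have [measurable]: "noise_prod \<xi> k l \<in> borel_measurable (sigma (space M) (F k))"
    using \<xi>_F[of _ k] assms
    by (intro measurable_noise_prod) (simp add: sigma_rv_subset_iff[OF sigma_algebra_F, symmetric])
  show ?thesis unfolding sigma_rv_subset_iff[OF sigma_algebra_F] by measurable
qed

lemma law_partial:
  assumes "l - 1 \<le> k" "k \<le> 0"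
  shows "distr M borel (\<lambda>w. noise_prod \<xi> k l w + \<alpha> l) = conv_prod \<mu> k l (return borel (\<alpha> l))"
  using assms
proof (induction k rule: int_ge_induct)
  \<comment> \<open>At \<open>k = l - 1\<close> the product is empty, and both sides are the point
    mass at \<open>\<alpha> l\<close>.\<close>
  case base
  then show ?case
    using distr_const[of "\<alpha> l" borel] by (simp add: noise_prod_empty conv_prod_empty)
next
  case (step k)
  let ?X = "\<lambda>w. noise_prod \<xi> k l w + \<alpha> l"
  have "indep_set (sigma_rv M (\<xi> (k + 1))) (sigma_rv M ?X)"
    using indep_F_\<xi>[of "k + 1"] partial_F[of k l] step.prems
    by (auto intro!: indep_set_commute[of "sigma_rv M ?X"] elim: indep_set_mono)
  then have "conv (distr M borel (\<xi> (k + 1))) (distr M borel ?X) =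
      distr M borel (\<lambda>w. \<xi> (k + 1) w + (noise_prod \<xi> k l w + \<alpha> l))"
    using step.prems by (intro conv_distr prob_space_axioms \<xi>_measurable partial_measurable) auto
  moreover have "\<xi> (k + 1) w + (noise_prod \<xi> k l w + \<alpha> l) = noise_prod \<xi> (k + 1) l w + \<alpha> l" for w
    using step.hyps noise_prod_rec[of l "k + 1" \<xi> w] by (simp add: add.assoc)
  moreover have "conv_prod \<mu> (k + 1) l (return borel (\<alpha> l)) =
      conv (\<mu> (k + 1)) (conv_prod \<mu> k l (return borel (\<alpha> l)))"
    using step.hyps conv_prod_rec[of l "k + 1"] by simp
  ultimately show ?case using step.IH step.prems distr_\<xi>[of "k + 1"] by simp
qed

lemma weakly_tendsto_partial:
  assumes "k \<le> 0"
  shows "weakly_tendsto (\<lambda>l. distr M borel (\<lambda>w. noise_prod \<xi> k l w + \<alpha> l)) (\<Lambda> k) at_bot"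
proof -
  have eq: "\<forall>\<^sub>F l in at_bot. distr M borel (\<lambda>w. noise_prod \<xi> k l w + \<alpha> l) = conv_prod \<mu> k l (return borel (\<alpha> l))"
    by (rule eventually_mono[OF eventually_le_at_bot[of k]]) (use assms in \<open>auto intro!: law_partial\<close>)
  have "weakly_tendsto (\<lambda>l. conv_prod \<mu> k l (return borel (\<alpha> l))) (\<Lambda> k) at_bot"
    using I1 assms by (simp add: cond_I1_def)
  then show ?thesis
    unfolding weakly_tendsto_def
  proof (intro allI impI)
    fix f :: "'a \<Rightarrow> real"
    assume *: "\<forall>f :: 'a \<Rightarrow> real. continuous_on UNIV f \<and> bounded (range f) \<longrightarrow>
      ((\<lambda>i. \<integral>x. f x \<partial>conv_prod \<mu> k i (return borel (\<alpha> i))) \<longlongrightarrow> (\<integral>x. f x \<partial>\<Lambda> k)) at_bot"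
      and f: "continuous_on UNIV f \<and> bounded (range f)"
    have "((\<lambda>l. \<integral>x. f x \<partial>conv_prod \<mu> k l (return borel (\<alpha> l))) \<longlongrightarrow> (\<integral>x. f x \<partial>\<Lambda> k)) at_bot"
      by (rule *[rule_format, OF f])
    moreover have "\<forall>\<^sub>F l in at_bot. (\<integral>x. f x \<partial>conv_prod \<mu> k l (return borel (\<alpha> l))) =
        (\<integral>x. f x \<partial>distr M borel (\<lambda>w. noise_prod \<xi> k l w + \<alpha> l))"
      using eq by eventually_elim (simp only:)
    ultimately show "((\<lambda>l. \<integral>x. f x \<partial>distr M borel (\<lambda>w. noise_prod \<xi> k l w + \<alpha> l)) \<longlongrightarrow> (\<integral>x. f x \<partial>\<Lambda> k)) at_bot"
      by (rule Lim_transform_eventually)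
  qed
qed

text \<open>The partial products tend to \<open>\<phi> k\<close> only modulo H, and in law to
  \<open>\<Lambda> k\<close>; functions invariant under H on the right see both limits. So
  \<open>\<phi> k\<close> and \<open>\<Lambda> k\<close> induce the same law on
  \<open>G/H\<close>.\<close>

lemma expectation_phi:
  fixes f :: "'a \<Rightarrow> real"
  assumes "k \<le> 0" and f: "continuous_on UNIV f" "\<And>x h. h \<in> H \<Longrightarrow> f (x + h) = f x"
  shows "(\<integral>w. f (\<phi> k w) \<partial>M) = (\<integral>x. f x \<partial>\<Lambda> k)"
proof -
  obtain B where B: "\<And>x. \<bar>f x\<bar> \<le> B" using continuous_real_bound[OF compact_UNIV f(1)] by metis
  have [measurable]: "f \<in> borel_measurable borel" using f(1) by (rule borel_measurable_continuous_onI)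
  note [measurable] = partial_measurable[OF assms(1)] phi_measurable[OF assms(1)]
  have "((\<lambda>l. \<integral>x. f x \<partial>distr M borel (\<lambda>w. noise_prod \<xi> k l w + \<alpha> l)) \<longlongrightarrow> (\<integral>x. f x \<partial>\<Lambda> k)) at_bot"
    using weakly_tendsto_partial[OF assms(1)] f(1) compact_imp_bounded[OF compact_continuous_image[OF f(1) compact_UNIV]]
    by (simp add: weakly_tendsto_def)
  then have "((\<lambda>l. \<integral>w. f (noise_prod \<xi> k l w + \<alpha> l) \<partial>M) \<longlongrightarrow> (\<integral>x. f x \<partial>\<Lambda> k)) at_bot"
    by (simp add: integral_distr)
  then have "(\<lambda>n. \<integral>w. f (noise_prod \<xi> k (- int n) w + \<alpha> (- int n)) \<partial>M) \<longlonglongrightarrow> (\<integral>x. f x \<partial>\<Lambda> k)"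
    by (simp add: filterlim_at_bot_int_iff)
  moreover have "(\<lambda>n. \<integral>w. f (noise_prod \<xi> k (- int n) w + \<alpha> (- int n)) \<partial>M) \<longlonglongrightarrow> (\<integral>w. f (\<phi> k w) \<partial>M)"
  proof (rule integral_dominated_convergence[where w="\<lambda>_. B"])
    show "AE w in M. (\<lambda>n. f (noise_prod \<xi> k (- int n) w + \<alpha> (- int n))) \<longlonglongrightarrow> f (\<phi> k w)"
      using phi_limit[OF assms(1)]
    proof eventually_elim
      case (elim w)
      from tendsto_invariant[OF f elim] show ?case by (simp add: filterlim_at_bot_int_iff)
    qed
  qed (use B in auto)
  ultimately show ?thesis by (rule LIMSEQ_unique[THEN sym])
qed

section \<open>The law of \<open>\<zeta> k\<close> and its independence of the remote past\<close>

lemma prob_space_\<omega>: "prob_space \<omega>" and sets_\<omega>: "sets \<omega> = sets borel"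
  using haar by (simp_all add: normalized_haar_def borel_law_def)

lemma AE_\<omega>_H: "AE x in \<omega>. x \<in> H"
proof -
  interpret \<omega>: prob_space \<omega> by (rule prob_space_\<omega>)
  have "H \<in> sets \<omega>"
    using subgroup by (simp add: sets_\<omega> compact_subgroup_def borel_compact)
  then show ?thesis
    using haar by (subst \<omega>.AE_in_set_eq_1) (simp_all add: normalized_haar_def \<omega>.emeasure_eq_measure)
qed

text \<open>Here \<open>\<zeta> k = X + Y\<close>, where the partial product X is independent of \<open>F (l - 1)\<close>, is
  asymptotically right H-invariant by (I1) and (I3), and Y tends to H in probability by (I2).\<close>

lemma integral_\<zeta>:
  fixes f :: "'a \<Rightarrow> real"
  assumes k: "k \<le> 0" and A: "A \<in> T" and f: "continuous_on UNIV f"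
  shows "(\<integral>w. indicator A w * f (\<zeta> k w) \<partial>M) = prob A * (\<integral>x. f x \<partial>\<Lambda> k)"
proof -
  define G where "G y = (\<integral>x. f (x + y) \<partial>\<Lambda> k)" for y
  \<comment> \<open>The distance between the cosets of y and of 0, measured through e. It is
    continuous, invariant under H on the right, and zero exactly on H.\<close>
  define q where "q y = dist (e y) (e 0)" for y
  have [measurable]: "A \<in> events" using A T_events by auto
  have [measurable]: "f \<in> borel_measurable borel" using f by (rule borel_measurable_continuous_onI)
  have G: "continuous_on UNIV G"
    unfolding G_def by (intro continuous_integral_translate compact_UNIV f law_\<Lambda> k)
  have G_H: "G h = G 0" if "h \<in> H" for h
  proof -
    have "conv (\<Lambda> k) (return borel h) = \<Lambda> k" using I3 that k by (simp add: cond_I3_def)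
    then have eq: "distr (\<Lambda> k) borel (\<lambda>x. x + h) = \<Lambda> k" using conv_return_right[OF law_\<Lambda>[OF k], of h] by (simp only:)
    have [measurable_cong]: "sets (\<Lambda> k) = sets borel" using law_\<Lambda>[OF k] by (simp add: borel_law_def)
    have "(\<integral>x. f x \<partial>distr (\<Lambda> k) borel (\<lambda>x. x + h)) = G h"
      unfolding G_def by (rule integral_distr) measurable
    then show ?thesis by (simp add: eq G_def)
  qed
  have q: "continuous_on UNIV q" "\<And>y. q y \<ge> 0"
    unfolding q_def by (intro continuous_intros cont_e) simp
  have q_H: "q (y + h) = q y" if "h \<in> H" for y h
    using coset_absorb[OF that] e_eq_iff unfolding q_def by metis
  have q_0: "q y = 0 \<longleftrightarrow> y \<in> H" for y
    using e_eq_iff'[of 0 y] by (auto simp: q_def)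
  obtain B where B: "0 < B" "\<And>x. \<bar>G x\<bar> \<le> B" using continuous_real_bound[OF compact_UNIV G] by metis
  obtain Bf where Bf: "0 < Bf" "\<And>x. \<bar>f x\<bar> \<le> Bf" using continuous_real_bound[OF compact_UNIV f] by metis
  have "\<bar>(\<integral>w. indicator A w * f (\<zeta> k w) \<partial>M) - prob A * G 0\<bar> \<le> 0 + \<epsilon>" if "\<epsilon> > 0" for \<epsilon>
  proof -
    \<comment> \<open>One third each for the weak convergence in (I1), for the variation of G near
      H, and for the mean distance of Y from H.\<close>
    define \<delta> where "\<delta> = \<epsilon> / 3"
    have "\<delta> > 0" using that by (simp add: \<delta>_def)
    \<comment> \<open>G is constant on H, so on the compact set where it deviates from
      \<open>G 0\<close> by \<delta> or more, q has a positive minimum \<open>q z\<close>. There the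
      crude bound \<open>2 * B\<close> on the deviation is at most
      \<open>(2 * B / q z) * q y\<close>. A bound linear in q allows closeness of Y to H to be used
      through one expectation.\<close>
    have "\<exists>C\<ge>0. \<forall>y. \<bar>G y - G 0\<bar> \<le> \<delta> + C * q y"
    proof (cases "{y. \<bar>G y - G 0\<bar> \<ge> \<delta>} = {}")
      case True
      then show ?thesis by (intro exI[of _ 0]) (auto intro: less_imp_le simp: not_le)
    next
      case False
      have "closed {y. \<bar>G y - G 0\<bar> \<ge> \<delta>}"
        by (intro closed_Collect_le continuous_intros G)
      then have "compact {y. \<bar>G y - G 0\<bar> \<ge> \<delta>}"
        using compact_Int_closed[OF compact_UNIV] by simp
      then obtain z where z: "\<bar>G z - G 0\<bar> \<ge> \<delta>" "\<And>y. \<bar>G y - G 0\<bar> \<ge> \<delta> \<Longrightarrow> q z \<le> q y"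
        using continuous_attains_inf[OF _ False continuous_on_subset[OF q(1)]] by auto
      have "z \<notin> H" using z(1) G_H \<open>\<delta> > 0\<close> by force
      then have qz: "q z > 0" using q(2)[of z] q_0[of z] by linarith
      have "\<bar>G y - G 0\<bar> \<le> \<delta> + (2 * B / q z) * q y" for y
      proof (cases "\<bar>G y - G 0\<bar> \<ge> \<delta>")
        case True
        have "\<bar>G y - G 0\<bar> \<le> 2 * B" using B(2)[of y] B(2)[of 0] by linarith
        also have "2 * B \<le> 2 * B / q z * q y"
          using z(2)[OF True] qz B(1) by (simp add: field_simps)
        finally show ?thesis using \<open>\<delta> > 0\<close> by linarith
      next
        case False
        moreover have "2 * B / q z * q y \<ge> 0" using qz B(1) q(2) by simp
        ultimately show ?thesis by linarith
      qed
      then show ?thesis using qz B(1) by (intro exI[of _ "2 * B / q z"]) auto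
    qed
    then obtain C where C: "C \<ge> 0" "\<And>y. \<bar>G y - G 0\<bar> \<le> \<delta> + C * q y" by blast
    define \<nu> where "\<nu> l = distr M borel (\<lambda>w. noise_prod \<xi> k l w + \<alpha> l)" for l
    have \<nu>: "borel_law (\<nu> l)" for l
      unfolding \<nu>_def borel_law_def using partial_measurable[OF k] by (auto intro: prob_space_distr)
    have 1: "\<forall>\<^sub>F l in at_bot. \<forall>y. \<bar>(\<integral>x. f (x + y) \<partial>\<nu> l) - G y\<bar> < \<delta>"
      unfolding G_def
      using weakly_tendsto_partial[OF k] \<nu> \<open>\<delta> > 0\<close>
      by (intro weakly_tendsto_uniform_translate compact_UNIV f law_\<Lambda> k) (auto simp: \<nu>_def)
    have "((\<lambda>l. \<integral>x. q x \<partial>conv (return borel (- \<alpha> l)) (\<Lambda> (l - 1))) \<longlongrightarrow> (\<integral>x. q x \<partial>\<omega>)) at_bot"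
      using I2 q(1) compact_imp_bounded[OF compact_continuous_image[OF q(1) compact_UNIV]]
      by (simp add: cond_I2_def weakly_tendsto_def)
    moreover have "(\<integral>x. q x \<partial>\<omega>) = 0"
    proof -
      show ?thesis using AE_\<omega>_H q_0 by (intro integral_eq_zero_AE) auto
    qed
    ultimately have "((\<lambda>l. C * (\<integral>x. q x \<partial>conv (return borel (- \<alpha> l)) (\<Lambda> (l - 1)))) \<longlongrightarrow> C * 0) at_bot"
      by (intro tendsto_mult tendsto_const) simp
    then have "\<forall>\<^sub>F l in at_bot. C * (\<integral>x. q x \<partial>conv (return borel (- \<alpha> l)) (\<Lambda> (l - 1))) < \<delta>"
      using \<open>\<delta> > 0\<close> by (intro order_tendstoD) auto
    with 1 have "\<forall>\<^sub>F l in at_bot. l \<le> k \<and> (\<forall>y. \<bar>(\<integral>x. f (x + y) \<partial>\<nu> l) - G y\<bar> < \<delta>) \<and>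
        C * (\<integral>x. q x \<partial>conv (return borel (- \<alpha> l)) (\<Lambda> (l - 1))) < \<delta>"
      using eventually_le_at_bot[of k] by eventually_elim auto
    then obtain l where l: "l \<le> k" "\<And>y. \<bar>(\<integral>x. f (x + y) \<partial>\<nu> l) - G y\<bar> < \<delta>"
      "C * (\<integral>x. q x \<partial>conv (return borel (- \<alpha> l)) (\<Lambda> (l - 1))) < \<delta>"
      using eventually_happens'[OF trivial_limit_at_bot_linorder] by blast
    have l0: "l - 1 \<le> 0" using l(1) k by simp
    define X where "X w = noise_prod \<xi> k l w + \<alpha> l" for w
    define Y where "Y w = - \<alpha> l + \<zeta> (l - 1) w" for w
    have [measurable]: "X \<in> borel_measurable M"
      unfolding X_def using partial_measurable[OF k] .
    have [measurable]: "\<zeta> (l - 1) \<in> borel_measurable (sigma (space M) (F (l - 1)))"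
      using \<zeta>_F[of "l - 1" "l - 1"] l0 by (simp add: sigma_rv_subset_iff[OF sigma_algebra_F])
    have Y: "Y \<in> borel_measurable (sigma (space M) (F (l - 1)))"
      unfolding Y_def by measurable
    have [measurable]: "Y \<in> borel_measurable M"
      using Y F_events[of "l - 1"] sigma_rv_subset_iff[OF sigma_algebra_F[of "l - 1"], of Y]
        sigma_rv_subset_sets_iff[of M Y] by blast
    have [measurable]: "q \<in> borel_measurable borel" using q(1) by (rule borel_measurable_continuous_onI)
    have "AE w in M. indicator A w * f (\<zeta> k w) = indicator A w * f (X w + Y w)"
      using \<zeta>_noise[of "l - 1" k] l(1) k
      by (auto simp: X_def Y_def add.assoc elim!: eventually_mono)
    then have "(\<integral>w. indicator A w * f (\<zeta> k w) \<partial>M) = (\<integral>w. indicator A w * f (X w + Y w) \<partial>M)"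
      using \<zeta>_measurable[OF k] by (intro integral_cong_AE) auto
    also have "\<dots> = (\<integral>w. indicator A w * (\<integral>x. f (x + Y w) \<partial>\<nu> l) \<partial>M)"
    proof -
      have "indep_set (F (l - 1)) (sigma_rv M X)"
      proof -
        \<comment> \<open>Joining the noise from l to k to the trivial sigma-field turns
          \<open>indep_join_\<xi>\<close> into independence of \<open>F (l - 1)\<close> and this
          stretch of noise.\<close>
        let ?S = "sigma_sets (space M) ({{}, space M} \<union> (\<Union>i\<in>{l - 1<..k}. sigma_rv M (\<xi> i)))"
        have triv: "sigma_algebra (space M) {{}, space M}" by (rule sigma_algebra_trivial)
        have ind0: "indep_set (F (l - 1)) {{}, space M}"
        proof (rule indep_setI)
          fix a b assume "a \<in> F (l - 1)" "b \<in> {{}, space M}"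
          moreover from this have "a \<inter> space M = a"
            using F_events sets.sets_into_space by (metis Int_absorb2 subsetD)
          ultimately show "prob (a \<inter> b) = prob a * prob b" by (auto simp: prob_space)
        qed (use F_events in auto)
        have "indep_set (F (l - 1)) ?S"
        proof (rule indep_join_\<xi>[OF sigma_algebra_F triv order_refl])
          interpret sigma_algebra "space M" "F (l - 1)" by (rule sigma_algebra_F)
          show "{{}, space M} \<subseteq> F (l - 1)" by auto
        qed (use ind0 l(1) k in auto)
        moreover have "sigma_rv M X \<subseteq> ?S"
        proof -
          have sa: "sigma_algebra (space M) ?S"
            using sigma_rv_subset_Pow by (intro sigma_algebra_sigma_sets) blast
          have "\<xi> i \<in> borel_measurable (sigma (space M) ?S)" if "l \<le> i" "i \<le> k" for i
            using that unfolding sigma_rv_subset_iff[OF sa, symmetric] by auto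
          then have [measurable]: "noise_prod \<xi> k l \<in> borel_measurable (sigma (space M) ?S)"
            by (rule measurable_noise_prod)
          show ?thesis unfolding sigma_rv_subset_iff[OF sa] X_def by measurable
        qed
        ultimately show ?thesis by (rule indep_set_mono[OF _ order_refl])
      qed
      moreover have "(\<lambda>z. f (fst z + snd z)) \<in> borel_measurable (borel \<Otimes>\<^sub>M borel)" by measurable
      moreover have "A \<in> F (l - 1)" using A T_F[OF l0] by auto
      ultimately have "(\<integral>w. indicator A w * f (fst (X w, Y w) + snd (X w, Y w)) \<partial>M) =
          (\<integral>w. indicator A w * (\<integral>x. f (fst (x, Y w) + snd (x, Y w)) \<partial>distr M borel X) \<partial>M)"
        using Y Bf(2) sigma_algebra_F
        by (intro integral_freeze[where \<G>="F (l - 1)" and B=Bf and g="\<lambda>z. f (fst z + snd z)"])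
          (auto intro: indep_set_commute[of "F (l - 1)"])
      then show ?thesis by (simp add: \<nu>_def X_def[abs_def])
    qed
    finally have eq: "(\<integral>w. indicator A w * f (\<zeta> k w) \<partial>M) = (\<integral>w. indicator A w * (\<integral>x. f (x + Y w) \<partial>\<nu> l) \<partial>M)" .
    have cont\<nu>: "continuous_on UNIV (\<lambda>y. \<integral>x. f (x + y) \<partial>\<nu> l)"
      by (intro continuous_integral_translate compact_UNIV f \<nu>)
    then have [measurable]: "(\<lambda>y. \<integral>x. f (x + y) \<partial>\<nu> l) \<in> borel_measurable borel"
      by (rule borel_measurable_continuous_onI)
    obtain B\<nu> where B\<nu>: "\<And>y. \<bar>\<integral>x. f (x + y) \<partial>\<nu> l\<bar> \<le> B\<nu>"
      using continuous_real_bound[OF compact_UNIV cont\<nu>] by metis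
    obtain Bq where Bq: "\<And>y. \<bar>q y\<bar> \<le> Bq"
      using continuous_real_bound[OF compact_UNIV q(1)] by metis
    have int1: "integrable M (\<lambda>w. indicator A w * (\<integral>x. f (x + Y w) \<partial>\<nu> l))"
    proof (rule integrable_const_bound[of _ B\<nu>])
      show "AE w in M. norm (indicator A w * (\<integral>x. f (x + Y w) \<partial>\<nu> l)) \<le> B\<nu>"
        using B\<nu> order_trans[OF abs_ge_zero B\<nu>] by (intro AE_I2) (auto simp: indicator_def)
      show "(\<lambda>w. indicator A w * (\<integral>x. f (x + Y w) \<partial>\<nu> l)) \<in> borel_measurable M"
        by measurable
    qed
    have int2: "integrable M (\<lambda>w. indicator A w * G 0)"
      by (intro integrable_mult_left) (simp add: integrable_indicator_iff emeasure_eq_measure)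
    have int3: "integrable M (\<lambda>w. q (Y w))"
      using Bq by (intro integrable_const_bound[of _ Bq]) auto
    have pt: "\<bar>indicator A w * (\<integral>x. f (x + Y w) \<partial>\<nu> l) - indicator A w * G 0\<bar> \<le> 2 * \<delta> + C * q (Y w)" for w
    proof (cases "w \<in> A")
      case True
      have "\<bar>(\<integral>x. f (x + Y w) \<partial>\<nu> l) - G 0\<bar> \<le> 2 * \<delta> + C * q (Y w)"
        using l(2)[of "Y w"] C(2)[of "Y w"] by linarith
      then show ?thesis using True by simp
    next
      case False
      have "C * q (Y w) \<ge> 0" using C(1) q(2) by simp
      then show ?thesis using False \<open>\<delta> > 0\<close> by simp
    qed
    have "\<bar>(\<integral>w. indicator A w * f (\<zeta> k w) \<partial>M) - prob A * G 0\<bar> =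
        \<bar>\<integral>w. indicator A w * (\<integral>x. f (x + Y w) \<partial>\<nu> l) - indicator A w * G 0 \<partial>M\<bar>"
      by (subst Bochner_Integration.integral_diff[OF int1 int2]) (simp add: eq)
    also have "\<dots> \<le> (\<integral>w. \<bar>indicator A w * (\<integral>x. f (x + Y w) \<partial>\<nu> l) - indicator A w * G 0\<bar> \<partial>M)"
      by (rule integral_abs_bound)
    also have "\<dots> \<le> (\<integral>w. 2 * \<delta> + C * q (Y w) \<partial>M)"
      using pt by (intro integral_mono integrable_abs Bochner_Integration.integrable_diff
          Bochner_Integration.integrable_add integrable_mult_right int1 int2 int3) auto
    also have "\<dots> = 2 * \<delta> + C * (\<integral>w. q (Y w) \<partial>M)"
      using int3 by (simp add: prob_space)
    \<comment> \<open>q does not see the factor \<open>U (l - 1)\<close> in H, so only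
      \<open>\<phi> (l - 1)\<close> remains, and the invariant expectation is known there. The law
      of \<open>\<zeta> (l - 1)\<close>, which is still unknown, does not enter.\<close>
    also have "(\<integral>w. q (Y w) \<partial>M) = (\<integral>w. q (- \<alpha> l + \<phi> (l - 1) w) \<partial>M)"
    proof (rule integral_cong_AE)
      show "AE w in M. q (Y w) = q (- \<alpha> l + \<phi> (l - 1) w)"
        using \<zeta>_eq[OF l0]
      proof eventually_elim
        case (elim w)
        have "Y w = (- \<alpha> l + \<phi> (l - 1) w) + U (l - 1) w" by (simp add: Y_def elim add.assoc)
        then show ?case using q_H[OF U_H] by simp
      qed
      show "(\<lambda>w. q (- \<alpha> l + \<phi> (l - 1) w)) \<in> borel_measurable M"
        using phi_measurable[OF l0] by measurable
    qed measurable
    also have "\<dots> = (\<integral>x. q (- \<alpha> l + x) \<partial>\<Lambda> (l - 1))"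
    proof (rule expectation_phi[OF l0])
      show "continuous_on UNIV (\<lambda>x. q (- \<alpha> l + x))"
        by (intro continuous_on_compose2[OF q(1)] continuous_intros) auto
      show "q (- \<alpha> l + (x + h)) = q (- \<alpha> l + x)" if "h \<in> H" for x h
        using q_H[OF that] by (simp add: add.assoc[symmetric])
    qed
    also have "\<dots> = (\<integral>x. q x \<partial>conv (return borel (- \<alpha> l)) (\<Lambda> (l - 1)))"
    proof -
      have [measurable_cong]: "sets (\<Lambda> (l - 1)) = sets borel" using law_\<Lambda>[OF l0] by (simp add: borel_law_def)
      show ?thesis
        unfolding conv_return_left[OF law_\<Lambda>[OF l0]] by (rule integral_distr[symmetric]) measurable
    qed
    finally show ?thesis using l(3) by (simp add: \<delta>_def)
  qed
  then have "\<bar>(\<integral>w. indicator A w * f (\<zeta> k w) \<partial>M) - prob A * G 0\<bar> \<le> 0"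
    by (rule field_le_epsilon)
  then show ?thesis by (simp add: G_def)
qed

lemma prob_Int_\<zeta>:
  assumes "k \<le> 0" "A \<in> T" "B \<in> sets borel"
  shows "prob (A \<inter> (\<zeta> k -` B \<inter> space M)) = prob A * measure (\<Lambda> k) B"
  using assms T_events
  by (intro prob_Int_eq_if_continuous compact_UNIV \<zeta>_measurable law_\<Lambda> integral_\<zeta>) auto

lemma indep_T_\<zeta>: assumes "k \<le> 0" shows "indep_set T (sigma_rv M (\<zeta> k))"
proof (rule indep_setI)
  fix A C assume A: "A \<in> T" and "C \<in> sigma_rv M (\<zeta> k)"
  then obtain B where B: "B \<in> sets borel" "C = \<zeta> k -` B \<inter> space M" by (auto simp: sigma_rv_def)
  have "space M \<in> T" using T_sigma_algebra by (simp add: sigma_algebra_iff2) (metis Diff_empty)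
  then have "prob C = measure (\<Lambda> k) B"
    using prob_Int_\<zeta>[OF assms _ B(1), of "space M"] B(2) by (simp add: prob_space Int_absorb1)
  then show "prob (A \<inter> C) = prob A * prob C"
    using prob_Int_\<zeta>[OF assms A B(1)] B(2) by simp
qed (use T_events \<zeta>_F[OF order_refl assms] F_events in blast)+

section \<open>The uniform factor\<close>

lemma integral_\<omega>_translate:
  fixes f :: "'a \<Rightarrow> real"
  assumes "u \<in> H" and [measurable]: "f \<in> borel_measurable borel"
  shows "(\<integral>x. f (u + x) \<partial>\<omega>) = (\<integral>x. f x \<partial>\<omega>)"
proof -
  note [measurable_cong] = sets_\<omega>
  have "distr \<omega> borel (\<lambda>x. u + x) = \<omega>" using haar assms(1) by (simp add: normalized_haar_def)
  moreover have "(\<integral>x. f x \<partial>distr \<omega> borel (\<lambda>x. u + x)) = (\<integral>x. f (u + x) \<partial>\<omega>)"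
    by (rule integral_distr) measurable
  ultimately show ?thesis by simp
qed

text \<open>By (I3), z may be replaced by \<open>z + h\<close> with h independent of z and uniform
  on H. This leaves \<open>sec z\<close> alone and changes the H-part into
  \<open>(- sec z + z) + h\<close>, which is uniform whatever z is.\<close>

lemma measure_\<Lambda>_split:
  assumes k: "k \<le> 0" and B[measurable]: "B \<in> sets borel" and C[measurable]: "C \<in> sets borel"
  shows "measure (\<Lambda> k) {z. sec z \<in> B \<and> - sec z + z \<in> C} = measure (\<Lambda> k) {z. sec z \<in> B} * measure \<omega> C"
proof -
  interpret L: prob_space "\<Lambda> k" using law_\<Lambda>[OF k] by (simp add: borel_law_def)
  interpret \<omega>: prob_space \<omega> by (rule prob_space_\<omega>)
  interpret P: pair_prob_space "\<Lambda> k" \<omega> ..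
  have sL: "sets (\<Lambda> k) = sets borel" using law_\<Lambda>[OF k] by (simp add: borel_law_def)
  note [measurable_cong] = sL sets_\<omega>
  have sp: "space (\<Lambda> k) = UNIV" "space \<omega> = UNIV"
    using sets_eq_imp_space_eq[OF sL] sets_eq_imp_space_eq[OF sets_\<omega>] by simp_all
  define D where "D = {z. sec z \<in> B \<and> - sec z + z \<in> C}"
  have D[measurable]: "D \<in> sets borel"
    using measurable_sets[of "\<lambda>z. (sec z, - sec z + z)" borel "borel \<Otimes>\<^sub>M borel" "B \<times> C"]
    by (simp add: D_def vimage_def)
  have SB[measurable]: "{z. sec z \<in> B} \<in> sets borel"
    using measurable_sets[OF sec_measurable B] by (simp add: vimage_def)
  \<comment> \<open>Integrating over z first gives the left side of the claim by (I3); integrating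
    over h first gives the right side by invariance of \<open>\<omega>\<close>.\<close>
  have "(\<integral>h. (\<integral>z. indicator D (z + h) \<partial>\<Lambda> k) \<partial>\<omega>) = (\<integral>z. (\<integral>h. indicator D (z + h) \<partial>\<omega>) \<partial>\<Lambda> k :: real)"
  proof (rule P.Fubini_integral)
    have "(\<lambda>(z, h). indicator D (z + h) :: real) \<in> borel_measurable (\<Lambda> k \<Otimes>\<^sub>M \<omega>)" by measurable
    then show "integrable (\<Lambda> k \<Otimes>\<^sub>M \<omega>) (\<lambda>(z, h). indicator D (z + h) :: real)"
      by (intro P.integrable_const_bound[of _ 1]) (auto simp: indicator_def)
  qed
  moreover have "(\<integral>h. (\<integral>z. indicator D (z + h) \<partial>\<Lambda> k) \<partial>\<omega>) = (\<integral>h. measure (\<Lambda> k) D \<partial>\<omega>)"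
  proof (rule integral_cong_AE)
    show "AE h in \<omega>. (\<integral>z. indicator D (z + h) \<partial>\<Lambda> k) = measure (\<Lambda> k) D"
      using AE_\<omega>_H
    proof eventually_elim
      fix h assume "h \<in> H"
      then have "conv (\<Lambda> k) (return borel h) = \<Lambda> k" using I3 k by (simp add: cond_I3_def)
      then have eq: "distr (\<Lambda> k) borel (\<lambda>x. x + h) = \<Lambda> k"
        using conv_return_right[OF law_\<Lambda>[OF k], of h] by (simp only:)
      have "(\<integral>z. indicator D z \<partial>distr (\<Lambda> k) borel (\<lambda>x. x + h)) = (\<integral>z. indicator D (z + h) \<partial>\<Lambda> k :: real)"
        by (rule integral_distr) measurable
      then show "(\<integral>z. indicator D (z + h) \<partial>\<Lambda> k) = measure (\<Lambda> k) D"
        unfolding eq by (simp add: sp)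
    qed
    show "(\<lambda>h. \<integral>z. indicator D (z + h) \<partial>\<Lambda> k :: real) \<in> borel_measurable \<omega>"
      by measurable
  qed simp
  moreover have "(\<integral>h. indicator D (z + h) \<partial>\<omega>) = (indicator {z. sec z \<in> B} z * measure \<omega> C :: real)" for z
  proof -
    have "(\<integral>h. indicator D (z + h) \<partial>\<omega>) =
        (\<integral>h. indicator {z. sec z \<in> B} z * indicator C ((- sec z + z) + h) \<partial>\<omega> :: real)"
    proof (rule integral_cong_AE)
      show "AE h in \<omega>. indicator D (z + h) =
          (indicator {z. sec z \<in> B} z * indicator C ((- sec z + z) + h) :: real)"
        using AE_\<omega>_H
      proof eventually_elim
        fix h assume "h \<in> H"
        then show "indicator D (z + h) =
            (indicator {z. sec z \<in> B} z * indicator C ((- sec z + z) + h) :: real)"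
          using sec_add[of h z] by (simp add: D_def indicator_def add.assoc)
      qed
    qed measurable
    also have "\<dots> = indicator {z. sec z \<in> B} z * (\<integral>h. indicator C h \<partial>\<omega>)"
      using integral_\<omega>_translate[OF diff_sec, of "indicator C" z] by simp
    finally show ?thesis by (simp add: sp)
  qed
  ultimately have "measure (\<Lambda> k) D = (\<integral>z. indicator {z. sec z \<in> B} z * measure \<omega> C \<partial>\<Lambda> k)"
    by (simp add: \<omega>.prob_space)
  then show ?thesis by (simp add: D_def sp)
qed

lemma space_T: "space M \<in> T"
  using T_sigma_algebra by (simp add: sigma_algebra_iff2) (metis Diff_empty)

text \<open>Almost surely \<open>\<phi> k\<close> and \<open>U k\<close> are the section part and
  the H-part of \<open>\<zeta> k\<close>, so the splitting of \<open>\<Lambda> k\<close> carries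
  over to them, jointly with the events of T.\<close>

lemma prob_Int_U:
  assumes k: "k \<le> 0" and A: "A \<in> T" and [measurable]: "B \<in> sets borel" "C \<in> sets borel"
  shows "prob ((U k -` C \<inter> space M) \<inter> (A \<inter> (\<phi> k -` B \<inter> space M))) =
    prob (A \<inter> (\<phi> k -` B \<inter> space M)) * measure \<omega> C"
proof -
  have [measurable]: "A \<in> events" using A T_events by auto
  note [measurable] = \<zeta>_measurable[OF k] phi_measurable[OF k] U_measurable[OF k]
  have D[measurable]: "{z. sec z \<in> B \<and> - sec z + z \<in> C} \<in> sets borel"
    using measurable_sets[of "\<lambda>z. (sec z, - sec z + z)" borel "borel \<Otimes>\<^sub>M borel" "B \<times> C"]
    by (simp add: vimage_def)
  have SB[measurable]: "{z. sec z \<in> B} \<in> sets borel"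
    using measurable_sets[OF sec_measurable \<open>B \<in> sets borel\<close>] by (simp add: vimage_def)
  have "prob ((U k -` C \<inter> space M) \<inter> (A \<inter> (\<phi> k -` B \<inter> space M))) =
      prob (A \<inter> (\<zeta> k -` {z. sec z \<in> B \<and> - sec z + z \<in> C} \<inter> space M))"
    using sec_\<zeta>[OF k] by (intro finite_measure_eq_AE) (auto simp: U_eq elim!: eventually_mono)
  also have "\<dots> = prob A * (measure (\<Lambda> k) {z. sec z \<in> B} * measure \<omega> C)"
    using prob_Int_\<zeta>[OF k A D] measure_\<Lambda>_split[OF k] by simp
  also have "\<dots> = prob (A \<inter> (\<zeta> k -` {z. sec z \<in> B} \<inter> space M)) * measure \<omega> C"
    using prob_Int_\<zeta>[OF k A SB] by simp
  also have "prob (A \<inter> (\<zeta> k -` {z. sec z \<in> B} \<inter> space M)) = prob (A \<inter> (\<phi> k -` B \<inter> space M))"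
    using sec_\<zeta>[OF k] by (intro finite_measure_eq_AE) (auto elim!: eventually_mono)
  finally show ?thesis .
qed

lemma prob_U: assumes "k \<le> 0" "C \<in> sets borel" shows "prob (U k -` C \<inter> space M) = measure \<omega> C"
  using prob_Int_U[OF assms(1) space_T _ assms(2), of UNIV] by (simp add: prob_space)

lemma distr_U: assumes "k \<le> 0" shows "distr M borel (U k) = \<omega>"
proof (rule measure_eqI)
  interpret \<omega>: prob_space \<omega> by (rule prob_space_\<omega>)
  show "sets (distr M borel (U k)) = sets \<omega>" by (simp add: sets_\<omega>)
  fix C assume "C \<in> sets (distr M borel (U k))"
  then show "emeasure (distr M borel (U k)) C = emeasure \<omega> C"
    using prob_U[OF assms, of C] U_measurable[OF assms]
    by (simp add: emeasure_distr emeasure_eq_measure \<omega>.emeasure_eq_measure)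
qed

lemma indep_U_phi:
  assumes k: "k \<le> 0"
  shows "indep_set (sigma_rv M (U k)) (sigma_sets (space M) (T \<union> sigma_rv M (\<phi> k)))"
proof -
  let ?P = "{A \<inter> D | A D. A \<in> T \<and> D \<in> sigma_rv M (\<phi> k)}"
  have "indep_set (sigma_rv M (U k)) ?P"
  proof (rule indep_setI)
    show "sigma_rv M (U k) \<subseteq> events" using U_F[OF k] F_events by blast
    show "?P \<subseteq> events" using T_events phi_F[OF k] F_events[of k] by blast
    fix a b assume "a \<in> sigma_rv M (U k)" "b \<in> ?P"
    then obtain A B C where "A \<in> T" "B \<in> sets borel" "C \<in> sets borel"
      "a = U k -` C \<inter> space M" "b = A \<inter> (\<phi> k -` B \<inter> space M)"
      by (auto simp: sigma_rv_def)
    then show "prob (a \<inter> b) = prob a * prob b"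
      using prob_Int_U[OF k] prob_U[OF k] by simp
  qed
  then have "indep_set (sigma_sets (space M) (sigma_rv M (U k))) (sigma_sets (space M) ?P)"
    by (intro indep_set_sigma_sets Int_stable_Int_sets[OF T_sigma_algebra]
        Int_stable_sigma_algebra[OF sigma_algebra_sigma_rv] sigma_algebra_sigma_rv)
  then show ?thesis
    by (simp add: sigma_sets_Un_eq_Int[OF T_sigma_algebra sigma_algebra_sigma_rv]
        sigma_algebra.sigma_sets_eq[OF sigma_algebra_sigma_rv])
qed

text \<open>\<open>U k = Z + U j\<close> with Z a function of \<open>\<phi> j\<close> and the noise after time j, taking values in H; so
  the uniform law and the independence are inherited from \<open>U j\<close>.\<close>

lemma indep_U_noise:
  assumes jk: "j \<le> k" and k: "k \<le> 0"
  shows "indep_set (sigma_rv M (U k))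
    (sigma_sets (space M) (T \<union> (\<Union>i\<in>{j<..0}. sigma_rv M (\<xi> i))))"
proof -
  have j: "j \<le> 0" using assms by simp
  let ?B = "sigma_sets (space M) (T \<union> sigma_rv M (\<phi> j))"
  let ?E = "sigma_sets (space M) (?B \<union> (\<Union>i\<in>{j<..0}. sigma_rv M (\<xi> i)))"
  have B: "sigma_algebra (space M) ?B"
    using T_sigma_algebra sigma_rv_subset_Pow[of M "\<phi> j"]
    by (intro sigma_algebra_sigma_sets) (auto simp: sigma_algebra_iff2)
  have E: "sigma_algebra (space M) ?E"
  proof (intro sigma_algebra_sigma_sets Un_least UN_least sigma_rv_subset_Pow)
    show "?B \<subseteq> Pow (space M)" using B by (simp add: sigma_algebra_iff2)
  qed
  have BF: "?B \<subseteq> F j"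
    using T_F[OF j] phi_F[OF j] by (intro sigma_algebra.sigma_sets_subset[OF sigma_algebra_F]) auto
  have ind: "indep_set (sigma_rv M (U j)) ?E"
    by (rule indep_join_\<xi>[OF sigma_algebra_sigma_rv B U_F[OF j] BF indep_U_phi[OF j] j order_refl])
  have Eev: "?E \<subseteq> events" using ind by (simp add: indep_sets2_eq)
  \<comment> \<open>N is \<open>\<zeta> k\<close> with the last factor \<open>U j\<close> removed.
    This factor lies in H, so N and \<open>\<zeta> k\<close> have the same section, and the H-part Z
    of N turns into \<open>U k\<close> after adding \<open>U j\<close> on the right.\<close>
  define N where "N w = noise_prod \<xi> k (j + 1) w + \<phi> j w" for w
  define Z where "Z w = - sec (N w) + N w" for w
  have "\<xi> i \<in> borel_measurable (sigma (space M) ?E)" if "j + 1 \<le> i" "i \<le> k" for i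
    using that k unfolding sigma_rv_subset_iff[OF E, symmetric] by auto
  then have [measurable]: "noise_prod \<xi> k (j + 1) \<in> borel_measurable (sigma (space M) ?E)"
    by (rule measurable_noise_prod)
  have [measurable]: "\<phi> j \<in> borel_measurable (sigma (space M) ?E)"
    unfolding sigma_rv_subset_iff[OF E, symmetric] by auto
  have Z: "Z \<in> borel_measurable (sigma (space M) ?E)"
    unfolding Z_def N_def by measurable
  have ZU: "AE w in M. U k w = Z w + U j w"
    using \<zeta>_noise[OF jk k] \<zeta>_eq[OF j]
  proof eventually_elim
    case (elim w)
    have *: "\<zeta> k w = N w + U j w" by (simp add: elim N_def add.assoc)
    then have "sec (\<zeta> k w) = sec (N w)" using sec_add[OF U_H] by simp
    then show ?case by (simp only: U_eq[of k] Z_def * add.assoc)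
  qed
  have ZH: "Z w \<in> H" for w unfolding Z_def by (rule diff_sec)
  have "Z \<in> borel_measurable M"
    using Z[folded sigma_rv_subset_iff[OF E]] Eev sigma_rv_subset_sets_iff by blast
  note [measurable] = this U_measurable[OF k] U_measurable[OF j]
  interpret \<omega>: prob_space \<omega> by (rule prob_space_\<omega>)
  have sp\<omega>: "space \<omega> = UNIV" using sets_eq_imp_space_eq[OF sets_\<omega>] by simp
  have "indep_set (sigma_rv M (U k)) ?E"
  proof (rule indep_setI)
    show "sigma_rv M (U k) \<subseteq> events" using U_F[OF k] F_events by blast
    fix a A assume "a \<in> sigma_rv M (U k)" and A: "A \<in> ?E"
    then obtain C where C[measurable]: "C \<in> sets borel" and a: "a = U k -` C \<inter> space M"
      by (auto simp: sigma_rv_def)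
    have [measurable]: "A \<in> events" using A Eev by auto
    have "prob (a \<inter> A) = (\<integral>w. indicator (a \<inter> A) w \<partial>M)"
      by (simp add: Int_commute Int_assoc sets.Int_space_eq2 a)
    also have "\<dots> = (\<integral>w. indicator A w * indicator C (snd (U j w, Z w) + fst (U j w, Z w)) \<partial>M)"
    proof (rule integral_cong_AE)
      show "AE w in M. indicator (a \<inter> A) w =
          (indicator A w * indicator C (snd (U j w, Z w) + fst (U j w, Z w)) :: real)"
        using ZU AE_space by eventually_elim (auto simp: a indicator_def)
      show "indicator (a \<inter> A) \<in> borel_measurable M" unfolding a by measurable
    qed measurable
    also have "\<dots> = (\<integral>w. indicator A w *
        (\<integral>x. indicator C (snd (x, Z w) + fst (x, Z w)) \<partial>distr M borel (U j)) \<partial>M)"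
    proof (rule integral_freeze[OF _ E ind Z A, where B=1 and g="\<lambda>z. indicator C (snd z + fst z)"])
      show "(\<lambda>z. indicator C (snd z + fst z) :: real) \<in> borel_measurable (borel \<Otimes>\<^sub>M borel)" by measurable
    qed (auto simp: indicator_def U_measurable[OF j])
    \<comment> \<open>With Z frozen, only \<open>U j\<close> is random in the inner integral; its
      law \<open>\<omega>\<close> absorbs the left translation by the value of Z in H.\<close>
    also have "\<dots> = (\<integral>w. indicator A w * measure \<omega> C \<partial>M)"
    proof (intro Bochner_Integration.integral_cong refl arg_cong2[where f="(*)"])
      fix w
      show "(\<integral>x. indicator C (snd (x, Z w) + fst (x, Z w)) \<partial>distr M borel (U j)) = measure \<omega> C"
        using integral_\<omega>_translate[OF ZH, of "indicator C" w] by (simp add: distr_U[OF j] sp\<omega>)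
    qed
    also have "\<dots> = prob A * measure \<omega> C" by simp
    finally show "prob (a \<inter> A) = prob a * prob A" using prob_U[OF k C] by (simp add: a)
  qed (rule Eev)
  then show ?thesis
    by (rule indep_set_mono[OF _ order_refl]) (intro sigma_sets_mono', auto)
qed

lemma indep_U: assumes k: "k \<le> 0"
  shows "indep_set (sigma_rv M (U k)) (sigma_join M (sigma_rv M V) (past M \<xi> 0))"
proof -
  let ?G = "\<lambda>j. sigma_sets (space M) (T \<union> (\<Union>i\<in>{j<..0}. sigma_rv M (\<xi> i)))"
  have Pow: "T \<union> (\<Union>i\<in>{j<..0}. sigma_rv M (\<xi> i)) \<subseteq> Pow (space M)" for j
    using T_sigma_algebra sigma_rv_subset_Pow by (fastforce simp: sigma_algebra_iff2)
  have anti: "?G j \<subseteq> ?G i" if "i \<le> j" for i j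
    using that by (intro sigma_sets_mono') force
  \<comment> \<open>\<open>indep_U_noise\<close> asks for a starting time at most k; an earlier
    start only enlarges the sigma-field.\<close>
  have "indep_set (sigma_rv M (U k)) (?G j)" for j
    using k anti[of "min j k" j]
    by (intro indep_set_mono[OF indep_U_noise[of "min j k" k] order_refl]) auto
  then have *: "indep_set (sigma_rv M (U k)) (sigma_sets (space M) (\<Union>j\<in>{..0}. ?G j))"
    using anti Pow
    by (intro indep_set_sigma_Union sigma_algebra_sigma_rv sigma_algebra_sigma_sets) auto
  have sa: "sigma_algebra (space M) (sigma_sets (space M) (\<Union>j\<in>{..0}. ?G j))"
    using sigma_sets_into_sp[OF Pow] by (intro sigma_algebra_sigma_sets) blast
  have "sigma_rv M (\<xi> m) \<subseteq> sigma_sets (space M) (\<Union>j\<in>{..0}. ?G j)" if "m \<le> 0" for m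
  proof -
    \<comment> \<open>The noise in \<open>?G j\<close> begins at \<open>j + 1\<close>, hence the
      shift by one.\<close>
    have "sigma_rv M (\<xi> m) \<subseteq> ?G (m - 1)" using that by auto
    also have "\<dots> \<subseteq> (\<Union>j\<in>{..0}. ?G j)" using that by (intro UN_upper) simp
    also have "\<dots> \<subseteq> sigma_sets (space M) (\<Union>j\<in>{..0}. ?G j)" by (rule sigma_sets_superset_generator)
    finally show ?thesis .
  qed
  then have "past M \<xi> 0 \<subseteq> sigma_sets (space M) (\<Union>j\<in>{..0}. ?G j)"
    by (rule past_subset[OF sa])
  moreover have "sigma_rv M V \<subseteq> sigma_sets (space M) (\<Union>j\<in>{..0}. ?G j)"
  proof -
    have "sigma_rv M V \<subseteq> ?G 0" using V_T by auto
    then show ?thesis by blast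
  qed
  ultimately have "sigma_join M (sigma_rv M V) (past M \<xi> 0) \<subseteq> sigma_sets (space M) (\<Union>j\<in>{..0}. ?G j)"
    unfolding sigma_join_def by (intro sigma_algebra.sigma_sets_subset[OF sa]) auto
  from indep_set_mono[OF * order_refl this] show ?thesis .
qed

section \<open>Independence of V and the noise\<close>

text \<open>From time j on, \<open>\<zeta>\<close> is almost surely a function of
  \<open>\<zeta> j\<close> and the later noise. T is independent of \<open>\<zeta> j\<close>, and
  the later noise joins by \<open>indep_join_\<xi>\<close> because T lies in \<open>F j\<close>;
  then j tends to minus infinity.\<close>

lemma indep_T_past_\<zeta>: "indep_set T (past M \<zeta> 0)"
proof -
  let ?W = "\<lambda>j. sigma_sets (space M) (sigma_rv M (\<zeta> j) \<union> (\<Union>i\<in>{j<..0}. sigma_rv M (\<xi> i)))"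
  let ?Z = "\<lambda>j. sigma_sets (space M) (\<Union>i\<in>{j..0}. sigma_rv M (\<zeta> i))"
  have ind: "indep_set T (?Z j)" if j: "j \<le> 0" for j
  proof -
    have "indep_set T (?W j)"
      by (rule indep_join_\<xi>[OF T_sigma_algebra sigma_algebra_sigma_rv T_F[OF j]
            \<zeta>_F[OF order_refl j] indep_T_\<zeta>[OF j] j order_refl])
    from indep_set_augment[OF this] show ?thesis
    proof (rule indep_set_mono)
      show "T \<subseteq> augment M T" by (rule subset_augment[OF T_events])
      have W: "sigma_algebra (space M) (?W j)"
        using sigma_rv_subset_Pow by (intro sigma_algebra_sigma_sets Un_least UN_least)
      have "sigma_rv M (\<zeta> i) \<subseteq> augment M (?W j)" if i: "j \<le> i" "i \<le> 0" for i
      proof (rule sigma_rv_subset_augment[OF \<zeta>_measurable[OF i(2)] \<zeta>_noise[OF i]])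
        have "\<xi> m \<in> borel_measurable (sigma (space M) (?W j))" if "j + 1 \<le> m" "m \<le> i" for m
          using that i unfolding sigma_rv_subset_iff[OF W, symmetric] by auto
        then have [measurable]: "noise_prod \<xi> i (j + 1) \<in> borel_measurable (sigma (space M) (?W j))"
          by (rule measurable_noise_prod)
        have [measurable]: "\<zeta> j \<in> borel_measurable (sigma (space M) (?W j))"
          unfolding sigma_rv_subset_iff[OF W, symmetric] by auto
        show "sigma_rv M (\<lambda>w. noise_prod \<xi> i (j + 1) w + \<zeta> j w) \<subseteq> ?W j"
          unfolding sigma_rv_subset_iff[OF W] by measurable
      qed
      then show "?Z j \<subseteq> augment M (?W j)"
        by (intro sigma_algebra.sigma_sets_subset[OF sigma_algebra_augment[OF W]] UN_least) auto
    qed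
  qed
  have Pow: "(\<Union>i\<in>{j..0}. sigma_rv M (\<zeta> i)) \<subseteq> Pow (space M)" for j
    using sigma_rv_subset_Pow by blast
  have anti: "?Z j \<subseteq> ?Z i" if "i \<le> j" for i j
    using that by (intro sigma_sets_mono') force
  have *: "indep_set T (sigma_sets (space M) (\<Union>j\<in>{..0}. ?Z j))"
    using anti Pow ind by (intro indep_set_sigma_Union T_sigma_algebra sigma_algebra_sigma_sets) auto
  have "past M \<zeta> 0 \<subseteq> sigma_sets (space M) (\<Union>j\<in>{..0}. ?Z j)"
  proof (rule past_subset)
    show "sigma_algebra (space M) (sigma_sets (space M) (\<Union>j\<in>{..0}. ?Z j))"
      using sigma_sets_into_sp[OF Pow] by (intro sigma_algebra_sigma_sets) blast
    fix m :: int assume "m \<le> 0"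
    then have "sigma_rv M (\<zeta> m) \<subseteq> (\<Union>i\<in>{m..0}. sigma_rv M (\<zeta> i))" by (intro UN_upper) simp
    then have "sigma_rv M (\<zeta> m) \<subseteq> ?Z m" by blast
    then show "sigma_rv M (\<zeta> m) \<subseteq> sigma_sets (space M) (\<Union>j\<in>{..0}. ?Z j)"
      using \<open>m \<le> 0\<close> by blast
  qed
  from indep_set_mono[OF * order_refl this] show ?thesis .
qed

text \<open>Almost surely \<open>\<xi> m = \<zeta> m + - \<zeta> (m - 1)\<close>, so the noise
  belongs to the augmented sigma-field of \<open>\<zeta>\<close>, which is independent of T and
  hence of V.\<close>

lemma indep_V_past_\<xi>: "indep_set (sigma_rv M V) (past M \<xi> 0)"
  using indep_set_augment[OF indep_T_past_\<zeta>]
proof (rule indep_set_mono)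
  show "sigma_rv M V \<subseteq> augment M T" using V_T subset_augment[OF T_events] by blast
  show "past M \<xi> 0 \<subseteq> augment M (past M \<zeta> 0)"
  proof (rule past_subset[OF sigma_algebra_augment[OF sigma_algebra_past]])
    fix m :: int assume m: "m \<le> 0"
    have "\<zeta> i \<in> borel_measurable (sigma (space M) (past M \<zeta> 0))" if "i \<le> 0" for i
      using sigma_rv_subset_past[OF that, of M \<zeta>] sigma_rv_subset_iff[OF sigma_algebra_past] by blast
    then have [measurable]: "\<zeta> m \<in> borel_measurable (sigma (space M) (past M \<zeta> 0))"
      "\<zeta> (m - 1) \<in> borel_measurable (sigma (space M) (past M \<zeta> 0))"
      using m by auto
    show "sigma_rv M (\<xi> m) \<subseteq> augment M (past M \<zeta> 0)"
    proof (rule sigma_rv_subset_augment[OF \<xi>_measurable[OF m]])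
      show "AE w in M. \<xi> m w = \<zeta> m w + - \<zeta> (m - 1) w"
        using \<zeta>_noise[of "m - 1" m] m
        by (auto simp: noise_prod_rec noise_prod_empty add.assoc elim!: eventually_mono)
      show "sigma_rv M (\<lambda>w. \<zeta> m w + - \<zeta> (m - 1) w) \<subseteq> past M \<zeta> 0"
        unfolding sigma_rv_subset_iff[OF sigma_algebra_past] by measurable
    qed
  qed
qed

section \<open>Generators of the remote past and of each past\<close>

lemma remote_past_T: "remote_past M \<eta> \<subseteq> T"
  unfolding remote_past_def T_def using past_\<eta>_F by blast

lemma remote_past_subset_augment_V: "remote_past M \<eta> \<subseteq> augment M (sigma_rv M V)"
proof
  fix A assume A: "A \<in> remote_past M \<eta>"
  let ?S = "sigma_sets (space M) (past M \<zeta> 0 \<union> sigma_rv M V)"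
  have ev: "past M \<zeta> 0 \<subseteq> events" "sigma_rv M V \<subseteq> events"
    using indep_T_past_\<zeta> V_measurable by (auto simp: indep_sets2_eq sigma_rv_subset_sets_iff)
  have S: "sigma_algebra (space M) ?S"
    using ev sets.space_closed by (intro sigma_algebra_sigma_sets) blast
  have "past M \<eta> 0 \<subseteq> ?S"
  proof (rule past_subset[OF S])
    fix m :: int assume m: "m \<le> 0"
    have [measurable]: "\<zeta> m \<in> borel_measurable (sigma (space M) ?S)" "V \<in> borel_measurable (sigma (space M) ?S)"
      using sigma_rv_subset_past[OF m, of M \<zeta>] unfolding sigma_rv_subset_iff[OF S, symmetric] by auto
    \<comment> \<open>An identity for every w by the definition of \<open>\<zeta>\<close>; so the
      past of \<open>\<eta>\<close> lies in the join of the sigma-fields of \<open>\<zeta>\<close>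
      and V without augmentation.\<close>
    have "\<eta> m = (\<lambda>w. \<zeta> m w + V w)" by (simp add: \<zeta>_def fun_eq_iff)
    then show "sigma_rv M (\<eta> m) \<subseteq> ?S"
      by (simp only: sigma_rv_subset_iff[OF S]) measurable
  qed
  moreover have "A \<in> past M \<eta> 0" using A by (auto simp: remote_past_def)
  moreover have "?S \<subseteq> events" using ev by (intro sets.sigma_sets_subset) auto
  ultimately have "A \<in> augment M ?S" using subset_augment by blast
  then show "A \<in> augment M (sigma_rv M V)"
    using A remote_past_T
    by (intro in_augment_if_indep[OF T_sigma_algebra sigma_algebra_past sigma_algebra_sigma_rv
          indep_set_commute[OF indep_T_past_\<zeta>] V_T]) auto
qed

text \<open>Given versions \<open>B n\<close> of A in the past of each time \<open>- n\<close>, their limit superior is a version in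
  the remote past.\<close>

lemma T_subset_augment_remote_past: "T \<subseteq> augment M (remote_past M \<eta>)"
proof
  fix A assume A: "A \<in> T"
  have "\<forall>n. \<exists>B. B \<in> past M \<eta> (- int n) \<and> (AE w in M. w \<in> A \<longleftrightarrow> w \<in> B)"
  proof
    fix n
    have "A \<in> augment M (past M \<eta> (- int n))" using A by (auto simp: T_def F_def)
    then show "\<exists>B. B \<in> past M \<eta> (- int n) \<and> (AE w in M. w \<in> A \<longleftrightarrow> w \<in> B)"
      by (auto simp: augment_def)
  qed
  then obtain B where B: "\<And>n. B n \<in> past M \<eta> (- int n)" "\<And>n. AE w in M. w \<in> A \<longleftrightarrow> w \<in> B n"
    by metis
  define C where "C = (\<Inter>n. \<Union>m. B (n + m))"
  have "C \<in> past M \<eta> k" if "k \<le> 0" for k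
  proof -
    interpret P: sigma_algebra "space M" "past M \<eta> k" by (rule sigma_algebra_past)
    define N where "N = nat (- k)"
    \<comment> \<open>A limit superior does not change when the first N sets are dropped, and from
      index N on all of them lie in the past of k.\<close>
    have "C = (\<Inter>n. \<Union>m. B (N + n + m))"
      unfolding C_def
    proof (intro subset_antisym subsetI INT_I)
      fix x n assume "x \<in> (\<Inter>n. \<Union>m. B (n + m))"
      then show "x \<in> (\<Union>m. B (N + n + m))" by blast
    next
      fix x n assume "x \<in> (\<Inter>n. \<Union>m. B (N + n + m))"
      then obtain m where "x \<in> B (N + n + m)" by blast
      then show "x \<in> (\<Union>m. B (n + m))" by (intro UN_I[of "N + m"]) (simp_all add: ac_simps)
    qed
    moreover have "B (N + n + m) \<in> past M \<eta> k" for n m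
      using B(1)[of "N + n + m"] past_mono[of "- int (N + n + m)" k M \<eta>] that by (auto simp: N_def)
    ultimately show ?thesis by (auto intro!: P.countable_INT P.countable_UN)
  qed
  then have "C \<in> remote_past M \<eta>" by (simp add: remote_past_def)
  moreover have "AE w in M. \<forall>n. w \<in> A \<longleftrightarrow> w \<in> B n" using B(2) by (simp add: AE_all_countable)
  then have "AE w in M. w \<in> A \<longleftrightarrow> w \<in> C" by eventually_elim (auto simp: C_def)
  ultimately show "A \<in> augment M (remote_past M \<eta>)"
    using A T_events by (intro augmentI) auto
qed

text \<open>For the direction from V to the remote past, T is the intermediate stage: V lies in T,
  and every event of T has a version in the true remote past.\<close>

lemma remote_past_eq: "eq_mod_null M (remote_past M \<eta>) (sigma_rv M V)"
proof -
  have "remote_past M \<eta> \<subseteq> events" using remote_past_T T_events by blast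
  moreover have "sigma_rv M V \<subseteq> events" using V_T T_events by blast
  ultimately show ?thesis
    using remote_past_subset_augment_V V_T T_subset_augment_remote_past
    by (simp add: eq_mod_null_iff_augment)
qed

text \<open>The three ingredients determine \<open>\<eta> k\<close>, and the values at earlier times
  m are recovered by undoing the noise between m and k. Conversely, each ingredient is measurable
  for \<open>F k\<close>.\<close>

lemma past_eq:
  assumes k: "k \<le> 0"
  shows "eq_mod_null M (past M \<eta> k)
    (sigma_join M (sigma_join M (sigma_rv M (U k)) (sigma_rv M V)) (past M \<xi> k))"
proof -
  let ?UV = "sigma_join M (sigma_rv M (U k)) (sigma_rv M V)"
  let ?J = "sigma_join M ?UV (past M \<xi> k)"
  have UVF: "?UV \<subseteq> F k"
    unfolding sigma_join_def using U_F[OF k] V_T T_F[OF k]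
    by (intro sigma_algebra.sigma_sets_subset[OF sigma_algebra_F]) auto
  have JF: "?J \<subseteq> F k"
    unfolding sigma_join_def[of M ?UV] using UVF past_\<xi>_F[OF k]
    by (intro sigma_algebra.sigma_sets_subset[OF sigma_algebra_F]) auto
  have J: "sigma_algebra (space M) ?J"
    unfolding sigma_join_def[of M ?UV]
    using UVF past_\<xi>_F[OF k] F_events[of k] sets.space_closed[of M]
    by (intro sigma_algebra_sigma_sets) blast
  have UV_J: "?UV \<subseteq> ?J" "past M \<xi> k \<subseteq> ?J" unfolding sigma_join_def[of M ?UV] by auto
  have U_UV: "sigma_rv M (U k) \<subseteq> ?UV" "sigma_rv M V \<subseteq> ?UV" unfolding sigma_join_def by auto
  have J_meas: "X \<in> borel_measurable (sigma (space M) ?J)" if "sigma_rv M X \<subseteq> ?J" for X :: "'b \<Rightarrow> 'a"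
    using that by (simp add: sigma_rv_subset_iff[OF J])
  have [measurable]: "U k \<in> borel_measurable (sigma (space M) ?J)"
      "V \<in> borel_measurable (sigma (space M) ?J)" "\<phi> k \<in> borel_measurable (sigma (space M) ?J)"
    using UV_J U_UV phi_past[OF k] by (auto intro!: J_meas)
  have "past M \<eta> k \<subseteq> augment M ?J"
  proof (rule past_subset[OF sigma_algebra_augment[OF J]])
    fix m assume m: "m \<le> k"
    have "\<xi> i \<in> borel_measurable (sigma (space M) ?J)" if "m + 1 \<le> i" "i \<le> k" for i
      using sigma_rv_subset_past[OF that(2), of M \<xi>] UV_J(2) by (intro J_meas) blast
    then have [measurable]: "noise_prod \<xi> k (m + 1) \<in> borel_measurable (sigma (space M) ?J)"
      by (rule measurable_noise_prod)
    show "sigma_rv M (\<eta> m) \<subseteq> augment M ?J"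
    proof (rule sigma_rv_subset_augment)
      show "\<eta> m \<in> borel_measurable M" using m k by (intro \<eta>_measurable) simp
      show "AE w in M. \<eta> m w = - noise_prod \<xi> k (m + 1) w + (\<phi> k w + U k w + V w)"
        using \<eta>_noise[OF m k] \<eta>_eq[OF k]
        by eventually_elim (metis add.assoc add.left_inverse add_0)
      show "sigma_rv M (\<lambda>w. - noise_prod \<xi> k (m + 1) w + (\<phi> k w + U k w + V w)) \<subseteq> ?J"
        unfolding sigma_rv_subset_iff[OF J] by measurable
    qed
  qed
  then show ?thesis
    using JF F_events[of k] past_\<eta>_events[OF k] by (subst eq_mod_null_iff_augment) (auto simp: F_def)
qed

text \<open>Two splittings suffice: \<open>U k\<close> is independent of V and the noise jointly,
  and V is independent of the noise.\<close>

lemma indep_three: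
  assumes k: "k \<le> 0"
  shows "indep_sets (\<lambda>i. [sigma_rv M (U k), sigma_rv M V, past M \<xi> k] ! i) {..<3::nat}"
proof -
  have I: "{..<3::nat} = {0, 1, 2}" by auto
  have ev: "sigma_rv M (U k) \<subseteq> events" "sigma_rv M V \<subseteq> events" "past M \<xi> k \<subseteq> events"
    using U_F[OF k] F_events V_T T_events past_\<xi>_events[OF k] by blast+
  have sp: "space M \<in> sigma_rv M X" for X :: "'b \<Rightarrow> 'a"
    by (auto simp: sigma_rv_def intro!: exI[of _ UNIV])
  have sp': "space M \<in> past M \<xi> k" using sp sigma_rv_subset_past by blast
  show ?thesis
  proof (subst indep_sets_finite)
    show "[sigma_rv M (U k), sigma_rv M V, past M \<xi> k] ! i \<subseteq> events" if "i \<in> {..<3}" for i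
      using that ev by (auto simp: I)
    show "space M \<in> [sigma_rv M (U k), sigma_rv M V, past M \<xi> k] ! i" if "i \<in> {..<3}" for i
      using that sp sp' by (auto simp: I)
    show "\<forall>A\<in>Pi {..<3} (\<lambda>i. [sigma_rv M (U k), sigma_rv M V, past M \<xi> k] ! i).
        prob (\<Inter>j\<in>{..<3}. A j) = (\<Prod>j\<in>{..<3}. prob (A j))"
    proof
      fix A assume "A \<in> Pi {..<3} (\<lambda>i. [sigma_rv M (U k), sigma_rv M V, past M \<xi> k] ! i)"
      then have A: "A 0 \<in> sigma_rv M (U k)" "A 1 \<in> sigma_rv M V" "A 2 \<in> past M \<xi> k"
        by (auto simp: Pi_iff I)
      have A2: "A 2 \<in> past M \<xi> 0" using A(3) past_mono[OF k, of M \<xi>] by auto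
      interpret J: sigma_algebra "space M" "sigma_join M (sigma_rv M V) (past M \<xi> 0)"
        unfolding sigma_join_def using ev(2) past_\<xi>_events[of 0] sets.space_closed[of M]
        by (intro sigma_algebra_sigma_sets) auto
      have "A 1 \<inter> A 2 \<in> sigma_join M (sigma_rv M V) (past M \<xi> 0)"
        using A(2) A2 by (intro J.Int) (auto simp: sigma_join_def)
      then have "prob (A 0 \<inter> (A 1 \<inter> A 2)) = prob (A 0) * prob (A 1 \<inter> A 2)"
        using indep_setD[OF indep_U[OF k] A(1)] by blast
      moreover have "prob (A 1 \<inter> A 2) = prob (A 1) * prob (A 2)"
        by (rule indep_setD[OF indep_V_past_\<xi> A(2) A2])
      ultimately show "prob (\<Inter>j\<in>{..<3}. A j) = (\<Prod>j\<in>{..<3}. prob (A j))"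
        by (simp add: I)
    qed
  qed (auto simp: I)
qed

end

theorem theorem2p8:
  fixes \<mu> \<Lambda> :: "int \<Rightarrow> 'a::{topological_group_add, t2_space, second_countable_topology} measure"
    and \<alpha> :: "int \<Rightarrow> 'a" and H :: "'a set" and \<omega> :: "'a measure" and s :: "'a set \<Rightarrow> 'a"
    and M :: "'b measure" and \<eta> \<xi> :: "int \<Rightarrow> 'b \<Rightarrow> 'a"
  assumes "compact (UNIV :: 'a set)"
    and "\<exists>x y :: 'a. x \<noteq> y"
    and "\<forall>k\<le>0. borel_law (\<mu> k)"
    and "\<forall>k\<le>0. borel_law (\<Lambda> k)"
    and "compact_subgroup H"
    and "normalized_haar H \<omega>"
    and "cond_I1 \<mu> \<Lambda> \<alpha>"
    and "cond_I2 \<Lambda> \<alpha> \<omega>"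
    and "cond_I3 \<Lambda> H"
    and "cond_I4 \<mu> \<alpha> H"
    and "measurable_section H s"
    and "is_solution \<mu> M \<eta> \<xi>"
  defines "\<phi> \<equiv> phi s H \<alpha> \<xi>"
    and "V \<equiv> V_rv s H \<alpha> \<eta> \<xi>"
    and "U \<equiv> U_rv s H \<alpha> \<eta> \<xi>"
  shows
    "(\<forall>k\<le>0. AE w in M. \<exists>c. limitin (coset_space H) (phi_cosets H \<alpha> \<xi> k w) c at_bot) \<and>
     (AE w in M. \<exists>c. limitin (coset_space H) (V_cosets s H \<alpha> \<eta> \<xi> w) c at_bot) \<and>
     (\<forall>k\<le>0. \<phi> k \<in> borel_measurable M) \<and>
     V \<in> borel_measurable M \<and>
     (\<forall>k\<le>0. U k \<in> borel_measurable M) \<and>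
     (\<forall>k\<le>0. AE w in M. \<eta> k w = \<phi> k w + U k w + V w) \<and>
     (\<forall>k\<le>0. as_measurable M (past M \<xi> k) (\<phi> k)) \<and>
     (\<forall>k\<le>0. prob_space.indep_set M (sigma_rv M (U k)) (sigma_join M (sigma_rv M V) (past M \<xi> 0)) \<and>
             distr M borel (U k) = \<omega>) \<and>
     eq_mod_null M (remote_past M \<eta>) (sigma_rv M V) \<and>
     (\<forall>k\<le>0. eq_mod_null M (past M \<eta> k)
                (sigma_join M (sigma_join M (sigma_rv M (U k)) (sigma_rv M V)) (past M \<xi> k)) \<and>
             prob_space.indep_sets M
                (\<lambda>i. [sigma_rv M (U k), sigma_rv M V, past M \<xi> k] ! i) {..<3::nat})"
proof -
  obtain e :: "'a \<Rightarrow> nat \<Rightarrow> real"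
    where e: "continuous_on UNIV e" "\<And>g g'. e g = e g' \<longleftrightarrow> g +o H = g' +o H"
    using coset_embedding[OF assms(1,5)] by metis
  interpret coset_embedded H e
    using assms(1,5) e by unfold_locales
  interpret prob_space M using assms(12) by (simp add: is_solution_def)
  interpret noise_solution H e M \<mu> \<Lambda> \<alpha> \<omega> s \<eta> \<xi>
    using assms(3-12) by unfold_locales auto
  have "as_measurable M (past M \<xi> k) (phi s H \<alpha> \<xi> k)" if "k \<le> 0" for k
    using phi_past[OF that] unfolding as_measurable_def sigma_rv_subset_iff[OF sigma_algebra_past]
    by (intro bexI[of _ "phi s H \<alpha> \<xi> k"]) auto
  moreover have "AE w in M. \<exists>c. limitin (coset_space H) (V_cosets s H \<alpha> \<eta> \<xi> w) c at_bot"
    using V_limit by eventually_elim blast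
  ultimately show ?thesis
    unfolding \<phi>_def V_def U_def
    using phi_cosets_converge phi_measurable V_measurable U_measurable \<eta>_eq indep_U distr_U
      remote_past_eq past_eq indep_three
    by (intro conjI allI impI) assumption+
qed

end
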